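(* Let $p\in[1,\infty]\setminus\{2\}$ and let $\mu$ be a localizable measure. A contraction $T\in B(L^p(\mu))$ is a spatial partial isometry if and only if it has a contractive generalized inverse $T^*\in B(L^p(\mu))$ such that both $TT^*$ and $T^*T$ are multiplication operators on $L^p(\mu)$. Thus spatial partial isometries coincide with $L^p$-partial isometries on $L^p(\mu)$: $$\mathrm{SPIso}(L^p(\mu))=L^p\text{-}\mathrm{PIso}(L^p(\mu)),$$ and in the complex case ($\mathbb F=\mathbb C$) also with $MP$-partial isometries in $B(L^p(\mu))$.
   Context: $\mathbb F\in\{\mathbb R,\mathbb C\}$ is the scalar field; $1/\infty=0$. A generalized inverse of $T$ is $T^*$ with $TT^*T=T$ and $T^*TT^*=T^*$. A measure space $(\Omega,\Sigma,\mu)$ is localizable if it is semi-finite and the Boolean algebra $[\Sigma]$ of measurable sets modulo null sets is Dedekind complete. For $D\in\Sigma$, $\Sigma_D=\{C\cap D:C\in\Sigma\}$. A partial set automorphism is a map $\Phi:\Sigma_{D_{\Phi^*}}\to\Sigma_{D_\Phi}$ ($D_\Phi,D_{\Phi^*}\in\Sigma$) that induces an isomorphism of Boolean algebras $[\Sigma_{D_{\Phi^*}}]\to[\Sigma_{D_\Phi}]$; $\Phi^*:\Sigma_{D_\Phi}\to\Sigma_{D_{\Phi^*}}$ is a map inducing the inverse isomorphism. $T_\Phi$ is the linear operator on the space $L_0(\mu)$ of measurable functions (modulo a.e. equality) with $T_\Phi1_C=1_{\Phi(C\cap D_{\Phi^*})}$, $C\in\Sigma$, that preserves (monotone) limits.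 A spatial partial isometry on $L^p(\mu)$ is an operator of the form $$\omega\Big(\tfrac{d\mu\circ\Phi^*}{d\mu|_{D_\Phi}}\Big)^{1/p}T_\Phi,$$ where $\Phi$ is a partial set automorphism and $\omega:D_\Phi\to\{z\in\mathbb F:|z|=1\}$ is measurable (weights are extended by zero off $D_\Phi$). $\mathrm{SPIso}(L^p(\mu))$ is the set (inverse semigroup) of all of them. An $L^p$-projection on a Banach space $E$ is an idempotent $P\in B(E)$ with $\|\xi\|^p=\|P\xi\|^p+\|(1-P)\xi\|^p$ for all $\xi$ if $p<\infty$, and $\|\xi\|=\max\{\|P\xi\|,\|(1-P)\xi\|\}$ if $p=\infty$. An $L^p$-partial isometry on $E$ is a contraction $T\in B(E)$ with a contractive generalized inverse $T^*$ such that $TT^*$ and $T^*T$ are $L^p$-projections; $L^p\text{-}\mathrm{PIso}(E)$ is the set of these. In a complex unital Banach algebra $B$, an element $a$ is hermitian if $\|e^{ita}\|=1$ for all $t\in\mathbb R$, and $T\in B$ is an $MP$-partial isometry if it is contractive and has a contractive generalized inverse $T^*$ such that $TT^*$ and $T^*T$ are hermitian. *)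

theory Defs
  imports "HOL-Probability.Essential_Supremum"
begin

section \<open>Normed spaces and normed algebras with explicit carrier\<close>

text \<open>
  The space \<open>L\<^sup>p(M)\<close> depends on the measure \<open>M\<close>, so it cannot be a type; normed spaces are
  therefore records. The scalar type \<open>'k\<close> is only ever instantiated to \<^typ>\<open>real\<close> and
  \<^typ>\<open>complex\<close>.
\<close>

record ('k, 'v) nspace =
  vectors :: "'v set"
  vadd :: "'v \<Rightarrow> 'v \<Rightarrow> 'v"
  vzero :: 'v
  vscale :: "'k \<Rightarrow> 'v \<Rightarrow> 'v"
  vnorm :: "'v \<Rightarrow> real"

record ('k, 'v) nalgebra = "('k, 'v) nspace" +
  amult :: "'v \<Rightarrow> 'v \<Rightarrow> 'v"
  aone :: 'v

text \<open>
  The algebra \<open>B(E)\<close>. Operators are \<^const>\<open>extensional\<close> functions, so that equality of operators is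
  equality of functions. The operator norm has the same form as \<^const>\<open>onorm\<close>.
\<close>

definition bounded_ops :: "('k::real_normed_field, 'v) nspace \<Rightarrow> ('k, 'v \<Rightarrow> 'v) nalgebra" where
  "bounded_ops E =
    \<lparr> vectors = {T \<in> vectors E \<rightarrow>\<^sub>E vectors E.
        (\<forall>x\<in>vectors E. \<forall>y\<in>vectors E. T (vadd E x y) = vadd E (T x) (T y)) \<and>
        (\<forall>c. \<forall>x\<in>vectors E. T (vscale E c x) = vscale E c (T x)) \<and>
        (\<exists>K. \<forall>x\<in>vectors E. vnorm E (T x) \<le> K * vnorm E x)},
      vadd = (\<lambda>S T. \<lambda>x\<in>vectors E. vadd E (S x) (T x)),
      vzero = (\<lambda>x\<in>vectors E. vzero E),
      vscale = (\<lambda>c T. \<lambda>x\<in>vectors E. vscale E c (T x)),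
      vnorm = (\<lambda>T. SUP x\<in>vectors E. vnorm E (T x) / vnorm E x),
      amult = compose (vectors E),
      aone = (\<lambda>x\<in>vectors E. x) \<rparr>"

definition contractive :: "('k, 'v) nalgebra \<Rightarrow> 'v \<Rightarrow> bool" where
  "contractive B a \<longleftrightarrow> a \<in> vectors B \<and> vnorm B a \<le> 1"

definition generalized_inverse :: "('k, 'v) nalgebra \<Rightarrow> 'v \<Rightarrow> 'v \<Rightarrow> bool" where
  "generalized_inverse B a b \<longleftrightarrow> a \<in> vectors B \<and> b \<in> vectors B \<and>
     amult B (amult B a b) a = a \<and> amult B (amult B b a) b = b"

section \<open>\<open>L\<^sup>p\<close>-partial isometries on a normed space\<close>

definition Lp_projection :: "ennreal \<Rightarrow> ('k::real_normed_field, 'v) nspace \<Rightarrow> ('v \<Rightarrow> 'v) \<Rightarrow> bool" where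
  "Lp_projection p E P \<longleftrightarrow>
     P \<in> vectors (bounded_ops E) \<and> amult (bounded_ops E) P P = P \<and>
     (\<forall>x\<in>vectors E.
        let y = P x; z = vadd E x (vscale E (-1) (P x))
        in if p = \<infinity> then vnorm E x = max (vnorm E y) (vnorm E z)
           else vnorm E x powr enn2real p = vnorm E y powr enn2real p + vnorm E z powr enn2real p)"

definition Lp_PIso :: "ennreal \<Rightarrow> ('k::real_normed_field, 'v) nspace \<Rightarrow> ('v \<Rightarrow> 'v) set" where
  "Lp_PIso p E = {T. contractive (bounded_ops E) T \<and>
     (\<exists>T'. contractive (bounded_ops E) T' \<and> generalized_inverse (bounded_ops E) T T' \<and>
        Lp_projection p E (amult (bounded_ops E) T T') \<and>
        Lp_projection p E (amult (bounded_ops E) T' T))}"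

section \<open>MP-partial isometries in a complex unital Banach algebra\<close>

primrec apower :: "('k, 'v) nalgebra \<Rightarrow> 'v \<Rightarrow> nat \<Rightarrow> 'v" where
  "apower B a 0 = aone B"
| "apower B a (Suc n) = amult B a (apower B a n)"

primrec exp_partial_sum :: "('k::real_normed_field, 'v) nalgebra \<Rightarrow> 'v \<Rightarrow> nat \<Rightarrow> 'v" where
  "exp_partial_sum B a 0 = vzero B"
| "exp_partial_sum B a (Suc n) =
     vadd B (exp_partial_sum B a n) (vscale B (inverse (fact n)) (apower B a n))"

text \<open>
  \<open>exp_sums B a e\<close> states that the exponential series of \<open>a\<close> converges in norm to \<open>e\<close>.
  In a Banach algebra there is exactly one such \<open>e\<close>.
\<close>

definition exp_sums :: "('k::real_normed_field, 'v) nalgebra \<Rightarrow> 'v \<Rightarrow> 'v \<Rightarrow> bool" where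
  "exp_sums B a e \<longleftrightarrow> e \<in> vectors B \<and>
     (\<lambda>n. vnorm B (vadd B (exp_partial_sum B a n) (vscale B (-1) e))) \<longlonglongrightarrow> 0"

definition hermitian :: "(complex, 'v) nalgebra \<Rightarrow> 'v \<Rightarrow> bool" where
  "hermitian B a \<longleftrightarrow> a \<in> vectors B \<and>
     (\<forall>t::real. \<exists>e. exp_sums B (vscale B (\<i> * of_real t) a) e \<and> vnorm B e = 1)"

definition MP_PIso :: "(complex, 'v) nalgebra \<Rightarrow> 'v set" where
  "MP_PIso B = {a. contractive B a \<and>
     (\<exists>b. contractive B b \<and> generalized_inverse B a b \<and>
        hermitian B (amult B a b) \<and> hermitian B (amult B b a))}"

section \<open>Measure algebras and localizable measures\<close>

record 'b balgebra =
  bcarrier :: "'b set"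
  bjoin :: "'b \<Rightarrow> 'b \<Rightarrow> 'b"
  bmeet :: "'b \<Rightarrow> 'b \<Rightarrow> 'b"
  bcompl :: "'b \<Rightarrow> 'b"

definition ble :: "'b balgebra \<Rightarrow> 'b \<Rightarrow> 'b \<Rightarrow> bool" where
  "ble \<A> x y \<longleftrightarrow> bjoin \<A> x y = y"

definition dedekind_complete :: "'b balgebra \<Rightarrow> bool" where
  "dedekind_complete \<A> \<longleftrightarrow>
     (\<forall>S \<subseteq> bcarrier \<A>. S \<noteq> {} \<and> (\<exists>u\<in>bcarrier \<A>. \<forall>x\<in>S. ble \<A> x u) \<longrightarrow>
        (\<exists>s\<in>bcarrier \<A>. (\<forall>x\<in>S. ble \<A> x s) \<and>
           (\<forall>u\<in>bcarrier \<A>. (\<forall>x\<in>S. ble \<A> x u) \<longrightarrow> ble \<A> s u)))"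

definition balgebra_iso :: "'b balgebra \<Rightarrow> 'c balgebra \<Rightarrow> ('b \<Rightarrow> 'c) \<Rightarrow> bool" where
  "balgebra_iso \<A> \<B> h \<longleftrightarrow> bij_betw h (bcarrier \<A>) (bcarrier \<B>) \<and>
     (\<forall>x\<in>bcarrier \<A>. \<forall>y\<in>bcarrier \<A>.
        h (bjoin \<A> x y) = bjoin \<B> (h x) (h y) \<and> h (bmeet \<A> x y) = bmeet \<B> (h x) (h y)) \<and>
     (\<forall>x\<in>bcarrier \<A>. h (bcompl \<A> x) = bcompl \<B> (h x))"

definition set_class :: "'a measure \<Rightarrow> 'a set \<Rightarrow> 'a set set" where
  "set_class M A = {B \<in> sets M. sym_diff A B \<in> null_sets M}"

definition measure_algebra :: "'a measure \<Rightarrow> 'a set set balgebra" where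
  "measure_algebra M =
    \<lparr> bcarrier = set_class M ` sets M,
      bjoin = (\<lambda>X Y. \<Union>A\<in>X. \<Union>B\<in>Y. set_class M (A \<union> B)),
      bmeet = (\<lambda>X Y. \<Union>A\<in>X. \<Union>B\<in>Y. set_class M (A \<inter> B)),
      bcompl = (\<lambda>X. \<Union>A\<in>X. set_class M (space M - A)) \<rparr>"

definition semifinite_measure :: "'a measure \<Rightarrow> bool" where
  "semifinite_measure M \<longleftrightarrow>
     (\<forall>A\<in>sets M. emeasure M A = \<infinity> \<longrightarrow> (\<exists>B\<in>sets M. B \<subseteq> A \<and> 0 < emeasure M B \<and> emeasure M B < \<infinity>))"

definition localizable :: "'a measure \<Rightarrow> bool" where
  "localizable M \<longleftrightarrow> semifinite_measure M \<and> dedekind_complete (measure_algebra M)"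

section \<open>The spaces \<open>L\<^sup>0\<close> and \<open>L\<^sup>p\<close>\<close>

text \<open>Elements are equivalence classes of measurable functions modulo almost everywhere equality.\<close>

definition ae_class :: "'a measure \<Rightarrow> ('a \<Rightarrow> 'k::real_normed_field) \<Rightarrow> ('a \<Rightarrow> 'k) set" where
  "ae_class M f = {g \<in> borel_measurable M. AE x in M. f x = g x}"

definition L0 :: "'a measure \<Rightarrow> ('a \<Rightarrow> 'k::real_normed_field) set set" where
  "L0 M = ae_class M ` borel_measurable M"

definition L0_add ::
  "'a measure \<Rightarrow> ('a \<Rightarrow> 'k::real_normed_field) set \<Rightarrow> ('a \<Rightarrow> 'k) set \<Rightarrow> ('a \<Rightarrow> 'k) set" where
  "L0_add M F G = (\<Union>f\<in>F. \<Union>g\<in>G. ae_class M (\<lambda>x. f x + g x))"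

definition L0_mult ::
  "'a measure \<Rightarrow> ('a \<Rightarrow> 'k::real_normed_field) set \<Rightarrow> ('a \<Rightarrow> 'k) set \<Rightarrow> ('a \<Rightarrow> 'k) set" where
  "L0_mult M F G = (\<Union>f\<in>F. \<Union>g\<in>G. ae_class M (\<lambda>x. f x * g x))"

definition L0_scale ::
  "'a measure \<Rightarrow> 'k \<Rightarrow> ('a \<Rightarrow> 'k::real_normed_field) set \<Rightarrow> ('a \<Rightarrow> 'k) set" where
  "L0_scale M c F = (\<Union>f\<in>F. ae_class M (\<lambda>x. c * f x))"

text \<open>
  Almost everywhere convergence of a sequence of classes; it does not depend on the
  representatives, as countably many null sets are involved.
\<close>

definition L0_tendsto ::
  "'a measure \<Rightarrow> (nat \<Rightarrow> ('a \<Rightarrow> 'k::real_normed_field) set) \<Rightarrow> ('a \<Rightarrow> 'k) set \<Rightarrow> bool" where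
  "L0_tendsto M F G \<longleftrightarrow>
     (\<exists>f g. (\<forall>n. f n \<in> F n) \<and> g \<in> G \<and> (AE x in M. (\<lambda>n. f n x) \<longlonglongrightarrow> g x))"

text \<open>
  \<open>lp_size\<close> is \<open>\<integral>|f|\<^sup>p\<close> for \<open>p < \<infinity>\<close> and the essential supremum of \<open>|f|\<close> for \<open>p = \<infinity>\<close>.
  It is finite exactly on \<open>L\<^sup>p\<close>.
\<close>

definition lp_size :: "ennreal \<Rightarrow> 'a measure \<Rightarrow> ('a \<Rightarrow> 'k::real_normed_field) \<Rightarrow> ennreal" where
  "lp_size p M f =
     (if p = \<infinity> then esssup M (\<lambda>x. ennreal (norm (f x)))
      else (\<integral>\<^sup>+x. ennreal (norm (f x) powr enn2real p) \<partial>M))"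

definition lp_norm :: "ennreal \<Rightarrow> 'a measure \<Rightarrow> ('a \<Rightarrow> 'k::real_normed_field) \<Rightarrow> real" where
  "lp_norm p M f =
     (if p = \<infinity> then enn2real (lp_size p M f)
      else enn2real (lp_size p M f) powr (1 / enn2real p))"

text \<open>The norm takes the common value of \<^const>\<open>lp_norm\<close> on the representatives of a class.\<close>

definition Lp_space ::
  "ennreal \<Rightarrow> 'a measure \<Rightarrow> ('k::real_normed_field, ('a \<Rightarrow> 'k) set) nspace" where
  "Lp_space p M =
    \<lparr> vectors = {F \<in> L0 M. \<exists>f\<in>F. lp_size p M f < \<infinity>},
      vadd = L0_add M,
      vzero = ae_class M (\<lambda>x. 0),
      vscale = L0_scale M,
      vnorm = (\<lambda>F. the_elem (lp_norm p M ` F)) \<rparr>"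

abbreviation B_Lp ::
  "ennreal \<Rightarrow> 'a measure \<Rightarrow> ('k::real_normed_field, ('a \<Rightarrow> 'k) set \<Rightarrow> ('a \<Rightarrow> 'k) set) nalgebra" where
  "B_Lp p M \<equiv> bounded_ops (Lp_space p M)"

definition multiplication_operator ::
  "ennreal \<Rightarrow> 'a measure \<Rightarrow> (('a \<Rightarrow> 'k::real_normed_field) set \<Rightarrow> ('a \<Rightarrow> 'k) set) \<Rightarrow> bool" where
  "multiplication_operator p M T \<longleftrightarrow> T \<in> vectors (B_Lp p M) \<and>
     (\<exists>G \<in> vectors (Lp_space \<infinity> M). \<forall>F\<in>vectors (Lp_space p M). T F = L0_mult M G F)"

section \<open>Spatial partial isometries\<close>

text \<open>
  \<open>\<Sigma>\<^sub>D\<close> is \<^term>\<open>sets (restrict_space M D)\<close>. In the following, \<open>D\<close> is the range domain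
  \<open>D\<^sub>\<Phi>\<close> of \<open>\<Phi>\<close>, \<open>D'\<close> is its source domain (the \<open>D\<close> of the inverse), and \<open>\<Phi>'\<close>, written
  \<open>\<Phi>*\<close> in the literature, is a map that induces the inverse isomorphism.
\<close>

definition partial_set_automorphism ::
  "'a measure \<Rightarrow> 'a set \<Rightarrow> 'a set \<Rightarrow> ('a set \<Rightarrow> 'a set) \<Rightarrow> ('a set \<Rightarrow> 'a set) \<Rightarrow> bool" where
  "partial_set_automorphism M D D' \<Phi> \<Phi>' \<longleftrightarrow>
     D \<in> sets M \<and> D' \<in> sets M \<and>
     \<Phi> \<in> sets (restrict_space M D') \<rightarrow> sets (restrict_space M D) \<and>
     \<Phi>' \<in> sets (restrict_space M D) \<rightarrow> sets (restrict_space M D') \<and>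
     (\<exists>h. balgebra_iso (measure_algebra (restrict_space M D')) (measure_algebra (restrict_space M D)) h \<and>
        (\<forall>C\<in>sets (restrict_space M D').
           h (set_class (restrict_space M D') C) = set_class (restrict_space M D) (\<Phi> C)) \<and>
        (\<forall>C\<in>sets (restrict_space M D).
           inv_into (bcarrier (measure_algebra (restrict_space M D'))) h (set_class (restrict_space M D) C)
             = set_class (restrict_space M D') (\<Phi>' C)))"

text \<open>
  \<open>is_T\<^sub>\<Phi>\<close> characterizes \<open>T\<^sub>\<Phi>\<close> on \<open>L\<^sup>0\<close>, which is determined by its values on indicator functions
  because the simple functions are sequentially dense for almost everywhere convergence.
\<close>

definition is_T\<^sub>\<Phi> ::
  "'a measure \<Rightarrow> 'a set \<Rightarrow> ('a set \<Rightarrow> 'a set) \<Rightarrow>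
    (('a \<Rightarrow> 'k::real_normed_field) set \<Rightarrow> ('a \<Rightarrow> 'k) set) \<Rightarrow> bool" where
  "is_T\<^sub>\<Phi> M D' \<Phi> S \<longleftrightarrow>
     S \<in> L0 M \<rightarrow> L0 M \<and>
     (\<forall>F\<in>L0 M. \<forall>G\<in>L0 M. S (L0_add M F G) = L0_add M (S F) (S G)) \<and>
     (\<forall>c. \<forall>F\<in>L0 M. S (L0_scale M c F) = L0_scale M c (S F)) \<and>
     (\<forall>C\<in>sets M. S (ae_class M (indicator C)) = ae_class M (indicator (\<Phi> (C \<inter> D')))) \<and>
     (\<forall>F G. (\<forall>n. F n \<in> L0 M) \<and> G \<in> L0 M \<and> L0_tendsto M F G \<longrightarrow> L0_tendsto M (\<lambda>n. S (F n)) (S G))"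

definition transported_measure :: "'a measure \<Rightarrow> 'a set \<Rightarrow> ('a set \<Rightarrow> 'a set) \<Rightarrow> 'a measure" where
  "transported_measure M D \<Phi>' =
     measure_of D (sets (restrict_space M D)) (\<lambda>C. emeasure M (\<Phi>' C))"

text \<open>
  For localizable \<open>M\<close> the derivative below exists and is positive and finite almost everywhere on \<open>D\<close>.
  For \<open>p = \<infinity>\<close> the exponent \<^term>\<open>enn2real (inverse p)\<close> is \<open>0\<close>.
\<close>

definition spatial_weight ::
  "ennreal \<Rightarrow> 'a measure \<Rightarrow> 'a set \<Rightarrow> ('a set \<Rightarrow> 'a set) \<Rightarrow> ('a \<Rightarrow> 'k::real_normed_field) \<Rightarrow> 'a \<Rightarrow> 'k" where
  "spatial_weight p M D \<Phi>' \<omega> x =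
     (if x \<in> D
      then \<omega> x * of_real (enn2real (RN_deriv (restrict_space M D) (transported_measure M D \<Phi>') x)
                            powr enn2real (inverse p))
      else 0)"

definition SPIso ::
  "ennreal \<Rightarrow> 'a measure \<Rightarrow> (('a \<Rightarrow> 'k::real_normed_field) set \<Rightarrow> ('a \<Rightarrow> 'k) set) set" where
  "SPIso p M = {T \<in> extensional (vectors (Lp_space p M)).
     \<exists>D D' \<Phi> \<Phi>' \<omega> S. partial_set_automorphism M D D' \<Phi> \<Phi>' \<and>
       \<omega> \<in> borel_measurable (restrict_space M D) \<and> (\<forall>x\<in>D. norm (\<omega> x) = 1) \<and>
       is_T\<^sub>\<Phi> M D' \<Phi> S \<and>
       (\<forall>F\<in>vectors (Lp_space p M).
          T F = L0_mult M (ae_class M (spatial_weight p M D \<Phi>' \<omega>)) (S F))}"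

end

theory Submission
  imports Defs
begin

text \<open>
  The theorem compares four classes of operators. Each of them is shown to consist of the
  operators \<open>T\<close> that belong to an isometric pair: there are measurable sets \<open>D\<close>, \<open>D'\<close> and a
  contraction \<open>T'\<close> such that \<open>T T' = 1\<^sub>D\<close>, \<open>T' T = 1\<^sub>D\<^sub>'\<close> (multiplication by indicator
  functions), \<open>T T' T = T\<close> and \<open>T' T T' = T'\<close>. In other words, \<open>T\<close> vanishes on the functions
  supported off \<open>D'\<close> and maps \<open>L\<^sup>p(D')\<close> isometrically onto \<open>L\<^sup>p(D)\<close>.

  The central fact is that for \<open>p \<noteq> 2\<close> every \<open>L\<^sup>p\<close>-projection \<open>P\<close> is multiplication by an
  indicator function (\<open>Lp_projection_mult\<close>). First, the range and the kernel of \<open>P\<close> consist of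
  functions with disjoint supports. For finite \<open>p\<close>, elements \<open>f\<close> of the range and \<open>g\<close> of the
  kernel give equality in Clarkson's inequality for \<open>\<parallel>f + g\<parallel>\<^sup>p + \<parallel>f - g\<parallel>\<^sup>p\<close>, and the pointwise
  inequality is strict where both functions are nonzero. For \<open>p = \<infinity>\<close>, one has
  \<open>\<parallel>h + f + g\<parallel> \<le> max \<parallel>h + f\<parallel> \<parallel>h + g\<parallel>\<close> for all \<open>h\<close>, which fails for a large \<open>h\<close> concentrated on
  the common support and pointing in the direction of \<open>f + g\<close>. Second, since the measure algebra
  is Dedekind complete, the supports of the functions in the range have a supremum \<open>E\<close>, and then
  \<open>P = 1\<^sub>E\<close>. As idempotent multiplication operators are multiplications by indicator functions
  too, the description by multiplication operators and that by \<open>L\<^sup>p\<close>-projections both amount to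
  isometric pairs.

  Let \<open>T\<close>, \<open>T'\<close> be an isometric pair. For \<open>C \<subseteq> D'\<close>, the operator \<open>T 1\<^sub>C T'\<close> is again an
  \<open>L\<^sup>p\<close>-projection, hence equal to \<open>1\<^sub>E\<close> for a set \<open>E = \<Phi> C\<close>. This defines the partial set
  automorphism \<open>\<Phi>\<close>; its inverse comes from \<open>T' 1\<^sub>C T\<close> in the same way, and all Boolean
  identities are inherited from identities between operators. The functions \<open>T 1\<^sub>A\<close> agree on
  overlaps with a single weight \<open>w\<close> supported on \<open>D\<close>, and for finite \<open>p\<close> the function \<open>|w|\<^sup>p\<close>
  must be the Radon-Nikodym derivative of the transported measure because \<open>T\<close> preserves norms.
  So \<open>T\<close> agrees with a spatial partial isometry on indicator functions, and hence everywhere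
  (\<open>pair_SPIso\<close>).

  Conversely, an isomorphism \<open>\<Phi>\<close> of measure algebras relates a function \<open>f\<close> to a function \<open>g\<close> if
  it maps the sets \<open>{f \<in> U}\<close> to the sets \<open>{g \<in> U}\<close>. This relation is compatible with all Borel
  operations on sequences of functions, which gives existence, linearity and continuity of
  \<open>T\<^sub>\<Phi>\<close>, and it comes with a change of variables formula. It follows that a spatial partial
  isometry is isometric on \<open>L\<^sup>p(D')\<close>; it is onto \<open>L\<^sup>p(D)\<close> because functions can be transported
  back along \<open>\<Phi>*\<close> (\<open>SPIso_pair\<close>).

  For complex scalars, an idempotent \<open>P\<close> satisfies \<open>exp(itP) = 1 + (exp(it) - 1) P\<close>. If \<open>P\<close> is
  hermitian, these operators are invertible isometries \<open>U\<close>. Conjugation by \<open>U\<close> maps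
  \<open>L\<^sup>p\<close>-projections to \<open>L\<^sup>p\<close>-projections, so that \<open>U\<close> preserves disjointness of supports.
  Comparing two values of \<open>t\<close> shows that \<open>P\<close> commutes with all restrictions \<open>1\<^sub>E\<close>, which again
  makes range and kernel of \<open>P\<close> disjoint, and \<open>P\<close> is multiplication by an indicator function
  (\<open>hermitian_idempotent_restr\<close>). The converse is immediate, as \<open>1 + (exp(it) - 1) 1\<^sub>E\<close> is
  multiplication by a unimodular function.
\<close>

section \<open>Almost everywhere classes and the norm of an operator\<close>

lemma ae_class_self: "f \<in> borel_measurable M \<Longrightarrow> f \<in> ae_class M f"
  by (simp add: ae_class_def)

lemma ae_class_eqI:
  assumes "AE x in M. f x = g x"
  shows "ae_class M f = ae_class M g"
proof -
  have "(AE x in M. f x = h x) \<longleftrightarrow> (AE x in M. g x = h x)" for h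
    using assms by (auto elim: AE_mp)
  then show ?thesis by (simp add: ae_class_def)
qed

lemma ae_class_eq_iff:
  "f \<in> borel_measurable M \<Longrightarrow> g \<in> borel_measurable M \<Longrightarrow>
    ae_class M f = ae_class M g \<longleftrightarrow> (AE x in M. f x = g x)"
  using ae_class_self[of g M] by (auto simp: ae_class_def intro: ae_class_eqI)

lemma L0_E:
  assumes "F \<in> L0 M"
  obtains f where "f \<in> borel_measurable M" "F = ae_class M f"
  using assms by (auto simp: L0_def)

lemma ae_class_in_L0 [simp]: "f \<in> borel_measurable M \<Longrightarrow> ae_class M f \<in> L0 M"
  by (auto simp: L0_def)

text \<open>
  The operations on classes are unions over all representatives. Every member of such a union is
  the same class, so that the operations can be computed on any choice of representatives.
\<close>

lemma ae_class_UN2: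
  assumes "f \<in> borel_measurable M" "g \<in> borel_measurable M"
  shows "(\<Union>f'\<in>ae_class M f. \<Union>g'\<in>ae_class M g. ae_class M (\<lambda>x. op (f' x) (g' x)))
     = ae_class M (\<lambda>x. op (f x) (g x))"
proof -
  have "ae_class M (\<lambda>x. op (f' x) (g' x)) = ae_class M (\<lambda>x. op (f x) (g x))"
    if "f' \<in> ae_class M f" "g' \<in> ae_class M g" for f' g'
    using that by (intro ae_class_eqI) (auto simp: ae_class_def)
  then show ?thesis using assms[THEN ae_class_self] by blast
qed

lemma L0_add_class [simp]:
  "f \<in> borel_measurable M \<Longrightarrow> g \<in> borel_measurable M \<Longrightarrow>
    L0_add M (ae_class M f) (ae_class M g) = ae_class M (\<lambda>x. f x + g x)"
  unfolding L0_add_def by (rule ae_class_UN2)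

lemma L0_mult_class [simp]:
  "f \<in> borel_measurable M \<Longrightarrow> g \<in> borel_measurable M \<Longrightarrow>
    L0_mult M (ae_class M f) (ae_class M g) = ae_class M (\<lambda>x. f x * g x)"
  unfolding L0_mult_def by (rule ae_class_UN2)

lemma L0_scale_class [simp]:
  "f \<in> borel_measurable M \<Longrightarrow> L0_scale M c (ae_class M f) = ae_class M (\<lambda>x. c * f x)"
  unfolding L0_scale_def
  using ae_class_UN2[of f M f "\<lambda>a b. c * a"] ae_class_self[of f M] by (auto split: if_splits)

lemma bounded_ops_simps [simp]:
  "vnorm (bounded_ops E) T = (SUP x\<in>vectors E. vnorm E (T x) / vnorm E x)"
  "amult (bounded_ops E) = compose (vectors E)"
  "aone (bounded_ops E) = (\<lambda>x\<in>vectors E. x)"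
  "vzero (bounded_ops E) = (\<lambda>x\<in>vectors E. vzero E)"
  "vadd (bounded_ops E) S T = (\<lambda>x\<in>vectors E. vadd E (S x) (T x))"
  "vscale (bounded_ops E) c T = (\<lambda>x\<in>vectors E. vscale E c (T x))"
  by (simp_all add: bounded_ops_def)

lemma bounded_ops_vectors:
  "T \<in> vectors (bounded_ops E) \<longleftrightarrow> T \<in> vectors E \<rightarrow>\<^sub>E vectors E \<and>
        (\<forall>x\<in>vectors E. \<forall>y\<in>vectors E. T (vadd E x y) = vadd E (T x) (T y)) \<and>
        (\<forall>c. \<forall>x\<in>vectors E. T (vscale E c x) = vscale E c (T x)) \<and>
        (\<exists>K. \<forall>x\<in>vectors E. vnorm E (T x) \<le> K * vnorm E x)"
  by (simp add: bounded_ops_def)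

lemma Lp_space_simps [simp]:
  "vectors (Lp_space p M) = {F \<in> L0 M. \<exists>f\<in>F. lp_size p M f < \<infinity>}"
  "vadd (Lp_space p M) = L0_add M"
  "vzero (Lp_space p M) = ae_class M (\<lambda>x. 0)"
  "vscale (Lp_space p M) = L0_scale M"
  "vnorm (Lp_space p M) F = the_elem (lp_norm p M ` F)"
  by (simp_all add: Lp_space_def)

text \<open>
  A vector of norm zero contributes the quotient \<open>0\<close> to the supremum. This does not hide
  anything, because the boundedness of \<open>T\<close> forces its image to have norm zero as well.
\<close>

lemma opnorm_le_one_iff:
  assumes T: "T \<in> vectors (bounded_ops E)" and nn: "\<And>x. x \<in> vectors E \<Longrightarrow> 0 \<le> vnorm E x"
    and ne: "vectors E \<noteq> {}"
  shows "vnorm (bounded_ops E) T \<le> 1 \<longleftrightarrow> (\<forall>x\<in>vectors E. vnorm E (T x) \<le> vnorm E x)"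
proof -
  obtain K where K: "\<And>x. x \<in> vectors E \<Longrightarrow> vnorm E (T x) \<le> K * vnorm E x"
    using T unfolding bounded_ops_vectors by blast
  have bdd: "bdd_above ((\<lambda>x. vnorm E (T x) / vnorm E x) ` vectors E)"
  proof (rule bdd_aboveI2)
    fix x assume "x \<in> vectors E"
    then show "vnorm E (T x) / vnorm E x \<le> max K 0"
      using K[of x] nn[of x] by (cases "vnorm E x = 0") (auto simp: divide_le_eq le_max_iff_disj)
  qed
  have "vnorm E (T x) / vnorm E x \<le> 1 \<longleftrightarrow> vnorm E (T x) \<le> vnorm E x" if "x \<in> vectors E" for x
    using K[OF that] nn[OF that] by (cases "vnorm E x = 0") (auto simp: divide_le_eq)
  then show ?thesis
    using cSUP_le_iff[OF ne bdd, of 1] by simp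
qed

section \<open>The norm of \<open>L\<^sup>p\<close>\<close>

lemma lp_norm_nonneg [simp]: "0 \<le> lp_norm p M f"
  by (simp add: lp_norm_def)

locale lp =
  fixes p :: ennreal and M :: "'a measure"
  assumes one_le_p: "1 \<le> p"
begin

definition lpf :: "('a \<Rightarrow> 'k::real_normed_field) set" where
  "lpf = {f \<in> borel_measurable M. lp_size p M f < \<infinity>}"

abbreviation cl :: "('a \<Rightarrow> 'k::real_normed_field) \<Rightarrow> ('a \<Rightarrow> 'k) set" where
  "cl \<equiv> ae_class M"

abbreviation Lp :: "('a \<Rightarrow> 'k::real_normed_field) set set" where
  "Lp \<equiv> vectors (Lp_space p M)"

abbreviation nrm :: "('a \<Rightarrow> 'k::real_normed_field) set \<Rightarrow> real" where
  "nrm \<equiv> vnorm (Lp_space p M)"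

lemma lpf_measurable [measurable_dest]: "f \<in> lpf \<Longrightarrow> f \<in> borel_measurable M"
  by (simp add: lpf_def)

lemma p_ge_1: "p \<noteq> \<infinity> \<Longrightarrow> 1 \<le> enn2real p"
  using one_le_p enn2real_mono[of 1 p] by (simp add: less_top)

lemma lp_size_mono:
  assumes [measurable]: "f \<in> borel_measurable M"
    and le: "AE x in M. norm (f x) \<le> norm (g x)"
  shows "lp_size p M f \<le> lp_size p M g"
proof (cases "p = \<infinity>")
  case True
  have "AE x in M. ennreal (norm (f x)) \<le> ennreal (norm (g x))"
    using le by eventually_elim (rule ennreal_leI)
  then show ?thesis using True by (auto simp: lp_size_def intro!: esssup_AE_mono)
next
  case False
  have "AE x in M. ennreal (norm (f x) powr enn2real p) \<le> ennreal (norm (g x) powr enn2real p)"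
    using le by eventually_elim (use p_ge_1[OF False] in \<open>auto intro!: ennreal_leI powr_mono2\<close>)
  then show ?thesis using False by (auto simp: lp_size_def intro!: nn_integral_mono_AE)
qed

lemma lp_size_cong:
  assumes "f \<in> borel_measurable M" "g \<in> borel_measurable M"
    and "AE x in M. norm (f x) = norm (g x)"
  shows "lp_size p M f = lp_size p M g"
proof (rule antisym)
  show "lp_size p M f \<le> lp_size p M g" using assms(3) by (intro lp_size_mono assms) auto
  show "lp_size p M g \<le> lp_size p M f" using assms(3) by (intro lp_size_mono assms) auto
qed

lemma lp_norm_cong:
  assumes "f \<in> borel_measurable M" "g \<in> borel_measurable M"
    and "AE x in M. norm (f x) = norm (g x)"
  shows "lp_norm p M f = lp_norm p M g"
  unfolding lp_norm_def lp_size_cong[OF assms] ..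

lemma lpf_mono:
  assumes "g \<in> lpf" "f \<in> borel_measurable M" "AE x in M. norm (f x) \<le> norm (g x)"
  shows "f \<in> lpf"
  using assms lp_size_mono[OF assms(2,3)] by (auto simp: lpf_def)

lemma in_Lp_iff [simp]: "f \<in> borel_measurable M \<Longrightarrow> cl f \<in> Lp \<longleftrightarrow> f \<in> lpf"
proof -
  assume f: "f \<in> borel_measurable M"
  have "lp_size p M g = lp_size p M f" if "g \<in> cl f" for g
    using that f by (intro lp_size_cong) (auto simp: ae_class_def)
  with ae_class_self[OF f] have "(\<exists>g\<in>cl f. lp_size p M g < \<infinity>) \<longleftrightarrow> lp_size p M f < \<infinity>" by metis
  then show ?thesis using f by (simp add: lpf_def)
qed

lemma LpE:
  assumes "F \<in> Lp"
  obtains f where "f \<in> lpf" "F = cl f"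
proof -
  have "F \<in> L0 M" using assms by simp
  then obtain f where f: "f \<in> borel_measurable M" "F = cl f" by (rule L0_E)
  with assms show thesis by (intro that[of f]) (simp_all only: in_Lp_iff)
qed

lemma nrm_class: "f \<in> borel_measurable M \<Longrightarrow> nrm (cl f) = lp_norm p M f"
proof -
  assume f: "f \<in> borel_measurable M"
  have "lp_norm p M g = lp_norm p M f" if "g \<in> cl f" for g
    using that f by (intro lp_norm_cong) (auto simp: ae_class_def)
  with ae_class_self[OF f] have "lp_norm p M ` cl f = {lp_norm p M f}" by blast
  then show ?thesis by simp
qed

declare Lp_space_simps(1,5) [simp del]

lemma lp_size_eq:
  assumes "f \<in> lpf"
  shows "lp_size p M f = ennreal (if p = \<infinity> then lp_norm p M f else lp_norm p M f powr enn2real p)"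
proof (cases "p = \<infinity>")
  case True
  then show ?thesis using assms unfolding lpf_def lp_norm_def by (simp only: if_True) auto
next
  case False
  then show ?thesis using assms p_ge_1[OF False] unfolding lpf_def lp_norm_def by (auto simp: powr_powr)
qed

lemma lp_norm_le_iff:
  assumes "f \<in> lpf" "g \<in> lpf"
  shows "lp_norm p M f \<le> lp_norm p M g \<longleftrightarrow> lp_size p M f \<le> lp_size p M g"
proof -
  have "a powr enn2real p \<le> b powr enn2real p \<longleftrightarrow> a \<le> b" if "p \<noteq> \<infinity>" "0 \<le> a" "0 \<le> b" for a b :: real
    using p_ge_1[OF that(1)] that powr_mono2[of "enn2real p" a b] powr_less_mono2[of "enn2real p" b a]
    by fastforce
  then show ?thesis
    unfolding lp_size_eq[OF assms(1)] lp_size_eq[OF assms(2)] by (cases "p = \<infinity>") (simp_all only: if_True if_False simp_thms ennreal_le_iff lp_norm_nonneg powr_ge_zero enn2real_top)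
qed

lemma lp_norm_mono:
  assumes "g \<in> lpf" "f \<in> borel_measurable M" "AE x in M. norm (f x) \<le> norm (g x)"
  shows "lp_norm p M f \<le> lp_norm p M g"
  using lp_norm_le_iff[OF lpf_mono[OF assms] assms(1)] lp_size_mono[OF assms(2,3)] by simp

text \<open>
  The following characterizations by almost everywhere bounds replace computations with
  essential suprema.
\<close>

lemma Linf_size_le_iff:
  assumes "p = \<infinity>" "f \<in> borel_measurable M"
  shows "lp_size p M f \<le> ennreal r \<longleftrightarrow> (AE x in M. ennreal (norm (f x)) \<le> ennreal r)"
proof
  assume "lp_size p M f \<le> ennreal r"
  with esssup_AE[of "\<lambda>x. ennreal (norm (f x))" M] show "AE x in M. ennreal (norm (f x)) \<le> ennreal r"
    using assms by (auto simp: lp_size_def elim!: eventually_mono intro: order_trans)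
qed (use assms in \<open>auto simp: lp_size_def intro!: esssup_I\<close>)

lemma Linf_in_lpf_iff:
  assumes "p = \<infinity>" "f \<in> borel_measurable M"
  shows "f \<in> lpf \<longleftrightarrow> (\<exists>r. AE x in M. norm (f x) \<le> r)"
proof
  assume "f \<in> lpf"
  then have "lp_size p M f \<le> ennreal (lp_norm p M f)" using lp_size_eq assms by fastforce
  then have "AE x in M. norm (f x) \<le> lp_norm p M f"
    unfolding Linf_size_le_iff[OF assms] by simp
  then show "\<exists>r. AE x in M. norm (f x) \<le> r" ..
next
  assume "\<exists>r. AE x in M. norm (f x) \<le> r"
  then obtain r where "AE x in M. norm (f x) \<le> r" ..
  then have "lp_size p M f \<le> ennreal r"
    unfolding Linf_size_le_iff[OF assms] by eventually_elim (rule ennreal_leI)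
  then show "f \<in> lpf" using assms(2) unfolding lpf_def by (auto simp: less_top[symmetric] top_unique)
qed

lemma Linf_norm_le_iff:
  assumes "p = \<infinity>" "f \<in> lpf" "0 \<le> r"
  shows "lp_norm p M f \<le> r \<longleftrightarrow> (AE x in M. norm (f x) \<le> r)"
proof -
  have "lp_norm p M f \<le> r \<longleftrightarrow> lp_size p M f \<le> ennreal r"
    using lp_size_eq[OF assms(2)] assms by simp
  also have "\<dots> \<longleftrightarrow> (AE x in M. norm (f x) \<le> r)"
    using Linf_size_le_iff[OF assms(1) lpf_measurable[OF assms(2)]] assms by simp
  finally show ?thesis .
qed

lemma lp_norm_powr:
  assumes "p \<noteq> \<infinity>" "f \<in> lpf"
  shows "ennreal (lp_norm p M f powr enn2real p) = (\<integral>\<^sup>+x. ennreal (norm (f x) powr enn2real p) \<partial>M)"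
  using lp_size_eq[OF assms(2)] assms by (simp add: lp_size_def)

lemma lpf_scale:
  assumes "f \<in> lpf"
  shows "(\<lambda>x. c * f x :: 'k::{real_normed_field,second_countable_topology}) \<in> lpf"
proof (cases "p = \<infinity>")
  case True
  have [measurable]: "f \<in> borel_measurable M" using assms by simp
  obtain r where r: "AE x in M. norm (f x) \<le> r" using assms Linf_in_lpf_iff[OF True, of f] by auto
  have "AE x in M. norm (c * f x) \<le> norm c * r"
    using r by eventually_elim (simp add: norm_mult mult_left_mono)
  then show ?thesis by (subst Linf_in_lpf_iff[OF True]) auto
next
  case False
  have [measurable]: "f \<in> borel_measurable M" using assms by simp
  have "lp_size p M (\<lambda>x. c * f x) = ennreal (norm c powr enn2real p) * lp_size p M f"
    using False by (simp add: lp_size_def norm_mult powr_mult ennreal_mult' nn_integral_cmult)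
  then show ?thesis using assms by (auto simp: lpf_def ennreal_mult_less_top)
qed

lemma lp_norm_scale:
  assumes "f \<in> lpf"
  shows "lp_norm p M (\<lambda>x. c * f x :: 'k::{real_normed_field,second_countable_topology}) = norm c * lp_norm p M f"
proof (cases "p = \<infinity>")
  case True
  have le: "lp_norm p M (\<lambda>x. c * f x) \<le> norm c * lp_norm p M f" if "f \<in> lpf" for f :: "'a \<Rightarrow> 'k" and c
  proof (subst Linf_norm_le_iff[OF True lpf_scale[OF that]])
    show "AE x in M. norm (c * f x) \<le> norm c * lp_norm p M f"
      using Linf_norm_le_iff[OF True that, of "lp_norm p M f", THEN iffD1]
      by (auto simp: norm_mult elim!: eventually_mono intro: mult_left_mono)
  qed simp
  show ?thesis
  proof (cases "c = 0")
    case False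
    have "lp_norm p M (\<lambda>x. inverse c * (c * f x)) \<le> norm (inverse c) * lp_norm p M (\<lambda>x. c * f x)"
      by (intro le lpf_scale assms)
    then have "norm c * lp_norm p M f \<le> lp_norm p M (\<lambda>x. c * f x)"
      using False by (simp add: norm_divide field_simps)
    with le[OF assms, of c] show ?thesis by simp
  qed (use le[OF assms, of 0] lp_norm_nonneg[of p M "\<lambda>x. 0::'k"] in simp)
next
  case False
  have [measurable]: "f \<in> borel_measurable M" using assms by simp
  have "lp_size p M (\<lambda>x. c * f x) = ennreal (norm c powr enn2real p) * lp_size p M f"
    using False by (simp add: lp_size_def norm_mult powr_mult ennreal_mult' nn_integral_cmult)
  then show ?thesis
    using False p_ge_1 by (simp add: lp_norm_def enn2real_mult powr_mult powr_powr)
qed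

lemma lp_norm_eq_0_iff:
  assumes "f \<in> lpf"
  shows "lp_norm p M f = 0 \<longleftrightarrow> (AE x in M. f x = 0)"
proof (cases "p = \<infinity>")
  case True
  show ?thesis using Linf_norm_le_iff[OF True assms, of 0] lp_norm_nonneg[of p M f]
    by (simp add: antisym_conv)
next
  case False
  have [measurable]: "f \<in> borel_measurable M" using assms by simp
  have "lp_norm p M f = 0 \<longleftrightarrow> (\<integral>\<^sup>+x. ennreal (norm (f x) powr enn2real p) \<partial>M) = 0"
    using lp_norm_powr[OF False assms] by (metis ennreal_0 ennreal_eq_0_iff lp_norm_nonneg powr_0 powr_ge_zero powr_eq_0_iff order_antisym)
  also have "\<dots> \<longleftrightarrow> (AE x in M. f x = 0)" 
    by (subst nn_integral_0_iff_AE) auto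
  finally show ?thesis .
qed

lemma zero_lpf [simp]: "(\<lambda>x. 0) \<in> lpf"
proof (cases "p = \<infinity>")
  case True
  then show ?thesis by (subst Linf_in_lpf_iff) auto
next
  case False
  then show ?thesis using p_ge_1[OF False] unfolding lpf_def lp_size_def by simp
qed

lemma lp_norm_zero [simp]: "lp_norm p M (\<lambda>x. 0) = 0"
  by (simp add: lp_norm_eq_0_iff)

text \<open>
  The constant is immaterial: the inequality serves to pass to limits and to see that sums of
  bounded operators are bounded.
\<close>

lemma lp_add:
  fixes f g :: "'a \<Rightarrow> 'k::{real_normed_field,second_countable_topology}"
  assumes "f \<in> lpf" "g \<in> lpf"
  shows lpf_add: "(\<lambda>x. f x + g x) \<in> lpf"
    and lp_norm_add: "lp_norm p M (\<lambda>x. f x + g x) \<le> 4 * max (lp_norm p M f) (lp_norm p M g)"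
proof -
  have [measurable]: "f \<in> borel_measurable M" "g \<in> borel_measurable M" using assms by simp_all
  define m where "m = max (lp_norm p M f) (lp_norm p M g)"
  have m: "0 \<le> m" "lp_norm p M f \<le> m" "lp_norm p M g \<le> m"
    by (auto simp: m_def le_max_iff_disj)
  have "(\<lambda>x. f x + g x) \<in> lpf \<and> lp_norm p M (\<lambda>x. f x + g x) \<le> 4 * m"
  proof (cases "p = \<infinity>")
    case True
    have "AE x in M. norm (f x + g x) \<le> 4 * m"
      using Linf_norm_le_iff[OF True assms(1) m(1), THEN iffD1, OF m(2)]
        Linf_norm_le_iff[OF True assms(2) m(1), THEN iffD1, OF m(3)]
      by eventually_elim (rule norm_triangle_le, use m(1) in linarith)
    moreover from this have "(\<lambda>x. f x + g x) \<in> lpf" by (subst Linf_in_lpf_iff[OF True]) auto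
    ultimately show ?thesis using Linf_norm_le_iff[OF True, of "\<lambda>x. f x + g x" "4 * m"] m by auto
  next
    case False
    let ?q = "enn2real p"
    have q: "1 \<le> ?q" using p_ge_1[OF False] .
    have le: "norm (a + b) powr ?q \<le> 2 powr ?q * (norm a powr ?q + norm b powr ?q)" for a b :: 'k
    proof -
      have "norm (a + b) powr ?q \<le> (2 * max (norm a) (norm b)) powr ?q"
        using q by (intro powr_mono2) (auto intro: norm_triangle_le)
      also have "\<dots> = 2 powr ?q * max (norm a) (norm b) powr ?q" by (simp add: powr_mult)
      also have "\<dots> \<le> 2 powr ?q * (norm a powr ?q + norm b powr ?q)"
        by (intro mult_left_mono) (auto simp: max_def)
      finally show ?thesis .
    qed
    have "lp_size p M (\<lambda>x. f x + g x) \<le>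
        (\<integral>\<^sup>+x. ennreal (2 powr ?q) * (ennreal (norm (f x) powr ?q) + ennreal (norm (g x) powr ?q)) \<partial>M)"
      using False le by (auto simp: lp_size_def ennreal_plus[symmetric] ennreal_mult'[symmetric]
          simp del: ennreal_plus intro!: nn_integral_mono ennreal_leI)
    also have "\<dots> = ennreal (2 powr ?q) * (ennreal (lp_norm p M f powr ?q) + ennreal (lp_norm p M g powr ?q))"
      using assms by (simp add: nn_integral_cmult nn_integral_add lp_norm_powr[OF False])
    also have "\<dots> = ennreal (2 powr ?q * (lp_norm p M f powr ?q + lp_norm p M g powr ?q))"
      by (simp add: ennreal_mult')
    finally have sz: "lp_size p M (\<lambda>x. f x + g x) \<le> \<dots>" .
    then have l: "(\<lambda>x. f x + g x) \<in> lpf" by (auto simp: lpf_def less_top[symmetric] top_unique)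
    have "lp_norm p M (\<lambda>x. f x + g x) powr ?q \<le> 2 powr ?q * (lp_norm p M f powr ?q + lp_norm p M g powr ?q)"
      using sz lp_size_eq[OF l] False by simp
    also have "\<dots> \<le> 2 powr ?q * (m powr ?q + m powr ?q)"
      using m q by (intro mult_left_mono add_mono powr_mono2) auto
    also have "\<dots> = 2 * (2 powr ?q * m powr ?q)" by simp
    also have "\<dots> \<le> 2 powr ?q * (2 powr ?q * m powr ?q)"
      using q powr_mono[of 1 ?q 2] by (intro mult_right_mono) auto
    also have "\<dots> = (4 * m) powr ?q" using m by (simp add: powr_mult[symmetric])
    finally have "lp_norm p M (\<lambda>x. f x + g x) \<le> 4 * m"
      using q m powr_less_mono2[of ?q "4 * m" "lp_norm p M (\<lambda>x. f x + g x)"] by fastforce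
    with l show ?thesis by simp
  qed
  then show "(\<lambda>x. f x + g x) \<in> lpf"
    and "lp_norm p M (\<lambda>x. f x + g x) \<le> 4 * max (lp_norm p M f) (lp_norm p M g)"
    by (auto simp: m_def)
qed

text \<open>
  The relation between the norms of a vector and of its two parts that defines
  \<open>L\<^sup>p\<close>-projections, for finite and infinite \<open>p\<close> at once.
\<close>

definition lp_split :: "real \<Rightarrow> real \<Rightarrow> real \<Rightarrow> bool" where
  "lp_split c a b \<longleftrightarrow> (if p = \<infinity> then c = max a b
     else c powr enn2real p = a powr enn2real p + b powr enn2real p)"

lemma lp_split_disjoint:
  fixes f g :: "'a \<Rightarrow> 'k::{real_normed_field,second_countable_topology}"
  assumes "f \<in> lpf" "g \<in> lpf" and disj: "AE x in M. f x = 0 \<or> g x = 0"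
  shows "lp_split (lp_norm p M (\<lambda>x. f x + g x)) (lp_norm p M f) (lp_norm p M g)"
proof (cases "p = \<infinity>")
  case True
  note fg = lpf_add[OF assms(1,2)]
  have "lp_norm p M (\<lambda>x. f x + g x) \<le> r \<longleftrightarrow> max (lp_norm p M f) (lp_norm p M g) \<le> r" if "0 \<le> r" for r
  proof -
    have "(AE x in M. norm (f x + g x) \<le> r) \<longleftrightarrow> (AE x in M. norm (f x) \<le> r \<and> norm (g x) \<le> r)"
      using disj that by (intro eventually_subst) (auto elim!: eventually_mono)
    then show ?thesis
      using Linf_norm_le_iff[OF True fg that] Linf_norm_le_iff[OF True assms(1) that]
        Linf_norm_le_iff[OF True assms(2) that] by simp
  qed
  from this[of "lp_norm p M (\<lambda>x. f x + g x)"] this[of "max (lp_norm p M f) (lp_norm p M g)"]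
  show ?thesis using True unfolding lp_split_def by (auto simp: le_max_iff_disj)
next
  case False
  have [measurable]: "f \<in> borel_measurable M" "g \<in> borel_measurable M" using assms by simp_all
  let ?q = "enn2real p"
  have "ennreal (lp_norm p M (\<lambda>x. f x + g x) powr ?q)
      = (\<integral>\<^sup>+x. ennreal (norm (f x) powr ?q) + ennreal (norm (g x) powr ?q) \<partial>M)"
    unfolding lp_norm_powr[OF False lpf_add[OF assms(1,2)]]
    using disj p_ge_1[OF False] by (intro nn_integral_cong_AE) (auto elim!: eventually_mono)
  also have "\<dots> = ennreal (lp_norm p M f powr ?q + lp_norm p M g powr ?q)"
    using assms by (simp add: nn_integral_add lp_norm_powr[OF False])
  finally show ?thesis using False by (simp add: lp_split_def del: ennreal_plus)
qed

end

section \<open>Strict Clarkson inequalities\<close>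

text \<open>
  Write \<open>c powr r\<close> as \<open>c * c powr (r - 1)\<close> and use the strict monotonicity of the second factor.
\<close>

lemma powr_add_strict:
  fixes a b r :: real
  assumes "0 < a" "0 < b"
  shows "r < 1 \<Longrightarrow> (a + b) powr r < a powr r + b powr r"
    and "1 < r \<Longrightarrow> a powr r + b powr r < (a + b) powr r"
proof -
  have eq: "c powr r = c * c powr (r - 1)" if "0 < c" for c :: real
    using that by (simp add: powr_mult_base)
  have sum: "(a + b) powr r = a * (a + b) powr (r - 1) + b * (a + b) powr (r - 1)"
    using eq[of "a + b"] assms by (simp add: algebra_simps)
  { assume "r < 1"
    then have "(a + b) powr (r - 1) < a powr (r - 1)" "(a + b) powr (r - 1) < b powr (r - 1)"
      using assms by (auto intro: powr_less_mono2_neg)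
    then show "(a + b) powr r < a powr r + b powr r"
      unfolding sum eq[OF assms(1)] eq[OF assms(2)] using assms by (intro add_strict_mono) auto }
  { assume "1 < r"
    then have "a powr (r - 1) < (a + b) powr (r - 1)" "b powr (r - 1) < (a + b) powr (r - 1)"
      using assms by (auto intro: powr_less_mono2)
    then show "a powr r + b powr r < (a + b) powr r"
      unfolding sum eq[OF assms(1)] eq[OF assms(2)] using assms by (intro add_strict_mono) auto }
qed

text \<open>
  For \<open>r \<ge> 1\<close> this is convexity, which has to be extended from the positive axis to \<open>0\<close>. The
  case \<open>r \<le> 1\<close> follows by applying the first one to \<open>u powr r\<close>, \<open>v powr r\<close> and the exponent
  \<open>1 / r\<close>.
\<close>

lemma powr_mean:
  fixes u v r :: real
  assumes "0 \<le> u" "0 \<le> v" "0 < r"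
  shows "1 \<le> r \<Longrightarrow> 2 * ((u + v) / 2) powr r \<le> u powr r + v powr r"
    and "r \<le> 1 \<Longrightarrow> u powr r + v powr r \<le> 2 * ((u + v) / 2) powr r"
proof -
  have half: "2 * (w / 2) powr s \<le> w powr s" if "1 \<le> s" "0 \<le> w" for w s :: real
  proof -
    have "2 * (w / 2) powr s = 2 / 2 powr s * w powr s" using that by (simp add: powr_divide)
    also have "\<dots> \<le> 1 * w powr s"
      using powr_mono[of 1 s 2] that by (intro mult_right_mono) (auto simp: divide_le_eq)
    finally show ?thesis by simp
  qed
  have convex: "2 * ((u + v) / 2) powr s \<le> u powr s + v powr s"
    if "1 \<le> s" "0 \<le> u" "0 \<le> v" for u v s :: real
  proof (cases "u = 0 \<or> v = 0")
    case True
    then show ?thesis using half[of s] that by auto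
  next
    case False
    then show ?thesis
      using convex_onD[OF powr_convex[OF that(1)], of "1/2" u v] that by (simp add: field_simps)
  qed
  show "1 \<le> r \<Longrightarrow> 2 * ((u + v) / 2) powr r \<le> u powr r + v powr r"
    using convex assms by simp
  assume "r \<le> 1"
  then have "2 * ((u powr r + v powr r) / 2) powr (1 / r) \<le> u + v"
    using convex[of "1 / r" "u powr r" "v powr r"] assms by (simp add: powr_powr)
  then have "(((u powr r + v powr r) / 2) powr (1 / r)) powr r \<le> ((u + v) / 2) powr r"
    using assms by (intro powr_mono2) auto
  then show "u powr r + v powr r \<le> 2 * ((u + v) / 2) powr r"
    using assms by (simp add: powr_powr)
qed

text \<open>
  By the parallelogram law, the squares \<open>u\<close>, \<open>v\<close> of \<open>norm (a + b)\<close>, \<open>norm (a - b)\<close> and the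
  squares \<open>\<alpha>\<close>, \<open>\<beta>\<close> of \<open>norm a\<close>, \<open>norm b\<close> satisfy \<open>u + v = 2 (\<alpha> + \<beta>)\<close>. Comparing \<open>q/2\<close>-th powers,
  the mean inequality for \<open>u\<close>, \<open>v\<close> and the strict sub- or superadditivity for \<open>\<alpha>\<close>, \<open>\<beta>\<close> point in
  the same direction.
\<close>

lemma clarkson_strict:
  fixes a b :: "'k::real_inner"
  assumes "0 < q" "a \<noteq> 0" "b \<noteq> 0"
  shows "q < 2 \<Longrightarrow> norm (a + b) powr q + norm (a - b) powr q < 2 * (norm a powr q + norm b powr q)"
    and "2 < q \<Longrightarrow> 2 * (norm a powr q + norm b powr q) < norm (a + b) powr q + norm (a - b) powr q"
proof -
  define u v \<alpha> \<beta> where d: "u = (norm (a + b))^2" "v = (norm (a - b))^2" "\<alpha> = (norm a)^2" "\<beta> = (norm b)^2"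
  have uv: "(u + v) / 2 = \<alpha> + \<beta>"
    by (simp add: d power2_norm_eq_inner inner_simps inner_commute)
  have p: "norm x powr q = ((norm x)^2) powr (q / 2)" for x :: 'k
    using powr_powr[of "norm x" 2 "q / 2"] by simp
  have pos: "0 < \<alpha>" "0 < \<beta>" "0 \<le> u" "0 \<le> v" "0 < q / 2" using assms by (auto simp: d)
  { assume "q < 2"
    have "u powr (q / 2) + v powr (q / 2) \<le> 2 * (\<alpha> + \<beta>) powr (q / 2)"
      using powr_mean(2)[OF pos(3-5)] \<open>q < 2\<close> unfolding uv by simp
    also have "\<dots> < 2 * (\<alpha> powr (q / 2) + \<beta> powr (q / 2))"
      using powr_add_strict(1)[OF pos(1,2), of "q / 2"] \<open>q < 2\<close> by (intro mult_strict_left_mono) simp_all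
    finally show "norm (a + b) powr q + norm (a - b) powr q < 2 * (norm a powr q + norm b powr q)"
      unfolding p[of a] p[of b] p[of "a + b"] p[of "a - b"] d . }
  { assume "2 < q"
    have "2 * (\<alpha> powr (q / 2) + \<beta> powr (q / 2)) < 2 * (\<alpha> + \<beta>) powr (q / 2)"
      using powr_add_strict(2)[OF pos(1,2), of "q / 2"] \<open>2 < q\<close> by (intro mult_strict_left_mono) simp_all
    also have "\<dots> \<le> u powr (q / 2) + v powr (q / 2)"
      using powr_mean(1)[OF pos(3-5)] \<open>2 < q\<close> unfolding uv by simp
    finally show "2 * (norm a powr q + norm b powr q) < norm (a + b) powr q + norm (a - b) powr q"
      unfolding p[of a] p[of b] p[of "a + b"] p[of "a - b"] d . }
qed
section \<open>Operators on \<open>L\<^sup>p\<close> and restriction to measurable sets\<close>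

context lp begin

definition restr :: "'a set \<Rightarrow> ('a \<Rightarrow> 'k::real_normed_field) set \<Rightarrow> ('a \<Rightarrow> 'k) set" where
  "restr E F = L0_mult M (cl (indicator E)) F"

lemma restr_class:
  fixes f :: "'a \<Rightarrow> 'k::{real_normed_field,second_countable_topology}"
  assumes "E \<in> sets M" "f \<in> borel_measurable M"
  shows "restr E (cl f) = cl (\<lambda>x. indicator E x * f x)"
  using assms by (simp add: restr_def)

lemma lpf_indicator_mult:
  fixes f :: "'a \<Rightarrow> 'k::{real_normed_field,second_countable_topology}"
  assumes "E \<in> sets M" "f \<in> lpf"
  shows "(\<lambda>x. indicator E x * f x) \<in> lpf"
  using assms by (intro lpf_mono[OF assms(2)]) (auto simp: indicator_def)

end

text \<open>
  Real and complex scalars are treated simultaneously: both fields are Euclidean spaces, and the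
  inner product plays the role of the real part of \<open>a\<close> times the conjugate of \<open>b\<close>.
\<close>

locale lp_scalar = lp p M for p :: ennreal and M :: "'a measure" +
  fixes scalar :: "'k::{real_normed_field,euclidean_space} itself"
begin

declare bounded_ops_simps(1,2) [simp del]

abbreviation V :: "('a \<Rightarrow> 'k) set set" where "V \<equiv> Lp"
abbreviation B :: "('k, ('a \<Rightarrow> 'k) set \<Rightarrow> ('a \<Rightarrow> 'k) set) nalgebra" where "B \<equiv> B_Lp p M"
abbreviation add (infixl "\<oplus>" 65) where "F \<oplus> G \<equiv> L0_add M F (G :: ('a \<Rightarrow> 'k) set)"
abbreviation scale (infixr "\<cdot>" 75) where "c \<cdot> F \<equiv> L0_scale M c (F :: ('a \<Rightarrow> 'k) set)"
abbreviation minus (infixl "\<ominus>" 65) where "F \<ominus> G \<equiv> F \<oplus> (-1) \<cdot> G"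
abbreviation nul :: "('a \<Rightarrow> 'k) set" where "nul \<equiv> cl (\<lambda>x. 0)"

lemma V_closed [simp]:
  "F \<in> V \<Longrightarrow> G \<in> V \<Longrightarrow> F \<oplus> G \<in> V" "F \<in> V \<Longrightarrow> c \<cdot> F \<in> V" "nul \<in> V"
  "E \<in> sets M \<Longrightarrow> F \<in> V \<Longrightarrow> restr E F \<in> V"
proof -
  show "F \<in> V \<Longrightarrow> G \<in> V \<Longrightarrow> F \<oplus> G \<in> V" by (erule LpE, erule LpE) (simp add: lpf_add)
  show "F \<in> V \<Longrightarrow> c \<cdot> F \<in> V" by (erule LpE) (simp add: lpf_scale)
  show "E \<in> sets M \<Longrightarrow> F \<in> V \<Longrightarrow> restr E F \<in> V"
    by (erule LpE) (simp add: restr_class lpf_indicator_mult)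
qed simp

lemma nrm_nonneg [simp]: "F \<in> V \<Longrightarrow> 0 \<le> nrm F"
  by (erule LpE) (simp add: nrm_class)

lemma nrm_scale: "F \<in> V \<Longrightarrow> nrm (c \<cdot> F) = norm c * nrm F"
  by (erule LpE) (simp add: nrm_class lp_norm_scale)

lemma nrm_eq_0_iff: "F \<in> V \<Longrightarrow> nrm F = 0 \<longleftrightarrow> F = nul"
  by (erule LpE) (simp add: nrm_class lp_norm_eq_0_iff ae_class_eq_iff)

lemma nrm_nul [simp]: "nrm nul = 0" by (simp add: nrm_class)

lemma nrm_add_le: "F \<in> V \<Longrightarrow> G \<in> V \<Longrightarrow> nrm (F \<oplus> G) \<le> 4 * max (nrm F) (nrm G)"
  by (erule LpE, erule LpE) (simp add: nrm_class lp_norm_add)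

lemma class_algebra [simp]:
  assumes "F \<in> V"
  shows "F \<oplus> nul = F" "nul \<oplus> F = F" "1 \<cdot> F = F" "0 \<cdot> F = nul" "F \<ominus> F = nul"
    "G \<in> V \<Longrightarrow> (F \<ominus> G) \<oplus> G = F"
  using assms by - (erule LpE, (erule LpE)?, simp)+

lemma class_algebra2:
  assumes "F \<in> V" "G \<in> V" "H \<in> V"
  shows "F \<oplus> G = G \<oplus> F" "F \<oplus> (G \<oplus> H) = (F \<oplus> G) \<oplus> H"
    "c \<cdot> d \<cdot> F = (c * d) \<cdot> F" "c \<cdot> (F \<oplus> G) = c \<cdot> F \<oplus> c \<cdot> G" "(c + d) \<cdot> F = c \<cdot> F \<oplus> d \<cdot> F"
  using assms by - (erule LpE, erule LpE, erule LpE, simp add: algebra_simps)+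

lemma restr_restr: "E \<in> sets M \<Longrightarrow> E' \<in> sets M \<Longrightarrow> F \<in> V \<Longrightarrow> restr E (restr E' F) = restr (E \<inter> E') F"
  by (erule LpE) (auto simp: restr_class indicator_def intro!: ae_class_eqI AE_I2)

lemma restr_linear:
  assumes "E \<in> sets M" "F \<in> V" 
  shows "G \<in> V \<Longrightarrow> restr E (F \<oplus> G) = restr E F \<oplus> restr E G"
    and "restr E (c \<cdot> F) = c \<cdot> restr E F"
proof -
  show "G \<in> V \<Longrightarrow> restr E (F \<oplus> G) = restr E F \<oplus> restr E G"
    using assms by - (erule LpE, erule LpE, simp add: restr_class distrib_left)
  show "restr E (c \<cdot> F) = c \<cdot> restr E F"
    using assms by - (erule LpE, simp add: restr_class mult.left_commute)
qed

lemma nrm_restr_le: "E \<in> sets M \<Longrightarrow> F \<in> V \<Longrightarrow> nrm (restr E F) \<le> nrm F"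
  by (erule LpE) (auto simp: restr_class nrm_class indicator_def intro!: lp_norm_mono)

lemma restr_compl: "E \<in> sets M \<Longrightarrow> F \<in> V \<Longrightarrow> F \<ominus> restr E F = restr (space M - E) F"
  by (erule LpE) (simp add: restr_class ae_class_eqI indicator_def)

lemma restr_space [simp]: "F \<in> V \<Longrightarrow> restr (space M) F = F"
  by (erule LpE) (simp add: restr_class ae_class_eqI)

lemma opI:
  assumes "\<And>F. F \<in> V \<Longrightarrow> T F \<in> V" "T \<in> extensional V"
    and "\<And>F G. F \<in> V \<Longrightarrow> G \<in> V \<Longrightarrow> T (F \<oplus> G) = T F \<oplus> T G"
    and "\<And>c F. F \<in> V \<Longrightarrow> T (c \<cdot> F) = c \<cdot> T F"
    and "\<And>F. F \<in> V \<Longrightarrow> nrm (T F) \<le> K * nrm F"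
  shows "T \<in> vectors B"
proof -
  have "\<exists>K. \<forall>F\<in>V. nrm (T F) \<le> K * nrm F" using assms(5) by blast
  then show ?thesis using assms(1-4) unfolding bounded_ops_vectors by (simp add: PiE_def)
qed

lemma opD:
  assumes "T \<in> vectors B"
  shows "F \<in> V \<Longrightarrow> T F \<in> V" "T \<in> extensional V"
    "F \<in> V \<Longrightarrow> G \<in> V \<Longrightarrow> T (F \<oplus> G) = T F \<oplus> T G"
    "F \<in> V \<Longrightarrow> T (c \<cdot> F) = c \<cdot> T F"
  using assms unfolding bounded_ops_vectors by (auto simp: PiE_def)

lemma op_bound:
  assumes "T \<in> vectors B"
  obtains K where "0 < K" "\<forall>F\<in>V. nrm (T F) \<le> K * nrm F"
proof -
  obtain K where K: "\<And>F. F \<in> V \<Longrightarrow> nrm (T F) \<le> K * nrm F"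
    using assms unfolding bounded_ops_vectors by blast
  have "nrm (T F) \<le> max K 1 * nrm F" if "F \<in> V" for F
    using K[OF that] mult_right_mono[of K "max K 1" "nrm F"] nrm_nonneg[OF that] by linarith
  then show thesis by (intro that[of "max K 1"]) auto
qed

lemma opD_zero: "T \<in> vectors B \<Longrightarrow> T nul = nul"
  using opD(4)[of T nul 0] opD(1)[of T nul] by simp

lemma contractive_iff:
  "contractive B T \<longleftrightarrow> T \<in> vectors B \<and> (\<forall>F\<in>V. nrm (T F) \<le> nrm F)"
proof -
  have "V \<noteq> {}" using V_closed(3) by blast
  then show ?thesis
    unfolding contractive_def using opnorm_le_one_iff[of T "Lp_space p M"] nrm_nonneg by blast
qed

lemma contractiveI:
  assumes "\<And>F. F \<in> V \<Longrightarrow> T F \<in> V" "T \<in> extensional V"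
    and "\<And>F G. F \<in> V \<Longrightarrow> G \<in> V \<Longrightarrow> T (F \<oplus> G) = T F \<oplus> T G"
    and "\<And>c F. F \<in> V \<Longrightarrow> T (c \<cdot> F) = c \<cdot> T F"
    and "\<And>F. F \<in> V \<Longrightarrow> nrm (T F) \<le> nrm F"
  shows "contractive B T"
  unfolding contractive_iff using opI[of T 1] assms by auto

lemma amult_apply [simp]: "F \<in> V \<Longrightarrow> amult B S T F = S (T F)"
  by (simp add: bounded_ops_simps(2) compose_def)

lemma op_eqI:
  assumes "S \<in> extensional V" "T \<in> extensional V" "\<And>F. F \<in> V \<Longrightarrow> S F = T F"
  shows "S = T"
  using assms by (rule extensionalityI)

lemma amult_ext [simp]: "amult B S T \<in> extensional V"
  by (simp add: bounded_ops_simps(2))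

lemma op_eq_iff: "T \<in> extensional V \<Longrightarrow> amult B S R = T \<longleftrightarrow> (\<forall>F\<in>V. S (R F) = T F)"
  using op_eqI[OF amult_ext, of T S R] amult_apply[of _ S R] by auto

lemma amult_vectors:
  assumes "S \<in> vectors B" "T \<in> vectors B"
  shows "amult B S T \<in> vectors B"
proof -
  obtain K where K: "0 < K" "\<forall>F\<in>V. nrm (S F) \<le> K * nrm F" by (rule op_bound[OF assms(1)])
  obtain L where L: "0 < L" "\<forall>F\<in>V. nrm (T F) \<le> L * nrm F" by (rule op_bound[OF assms(2)])
  show ?thesis
  proof (rule opI[where K = "K * L"])
    fix F assume F: "F \<in> V"
    have "nrm (S (T F)) \<le> K * nrm (T F)" using K opD(1)[OF assms(2) F] by blast
    also have "\<dots> \<le> K * (L * nrm F)" using K L F by (intro mult_left_mono) auto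
    finally show "nrm (amult B S T F) \<le> K * L * nrm F" using F by (simp add: mult.assoc)
  qed (use opD[OF assms(1)] opD[OF assms(2)] in auto)
qed

lemma generalized_inverse_iff:
  "generalized_inverse B S T \<longleftrightarrow> S \<in> vectors B \<and> T \<in> vectors B \<and>
     (\<forall>F\<in>V. S (T (S F)) = S F) \<and> (\<forall>F\<in>V. T (S (T F)) = T F)"
proof -
  have "amult B (amult B S T) S = S \<longleftrightarrow> (\<forall>F\<in>V. S (T (S F)) = S F)"
    if "S \<in> vectors B" "T \<in> vectors B" for S T
    unfolding op_eq_iff[OF opD(2)[OF that(1)]] using opD(1)[OF that(1)] by simp
  then show ?thesis unfolding generalized_inverse_def by blast
qed

lemma Lp_projection_iff:
  "Lp_projection p (Lp_space p M) P \<longleftrightarrow> P \<in> vectors B \<and> (\<forall>F\<in>V. P (P F) = P F) \<and>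
     (\<forall>F\<in>V. lp_split (nrm F) (nrm (P F)) (nrm (F \<ominus> P F)))"
proof -
  have "amult B P P = P \<longleftrightarrow> (\<forall>F\<in>V. P (P F) = P F)" if "P \<in> vectors B"
    by (rule op_eq_iff[OF opD(2)[OF that]])
  then show ?thesis
    unfolding Lp_projection_def lp_split_def Let_def Lp_space_simps(2,4) by blast
qed

end

section \<open>Suprema of sets modulo null sets\<close>

lemma set_class_eq_iff:
  assumes "A \<in> sets M" "B \<in> sets M"
  shows "set_class M A = set_class M B \<longleftrightarrow> sym_diff A B \<in> null_sets M"
proof
  assume "set_class M A = set_class M B"
  then have "B \<in> set_class M A" using assms by (auto simp: set_class_def)
  then show "sym_diff A B \<in> null_sets M" by (simp add: set_class_def)
next
  have *: "sym_diff B C \<in> null_sets M" if "sym_diff A B \<in> null_sets M" "sym_diff A C \<in> null_sets M"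
    "A \<in> sets M" "B \<in> sets M" "C \<in> sets M" for A B C
    by (rule null_sets_subset[OF null_sets.Un[OF that(1,2)]]) (use that in auto)
  assume AB: "sym_diff A B \<in> null_sets M"
  then have BA: "sym_diff B A \<in> null_sets M" by (simp add: Un_commute)
  show "set_class M A = set_class M B"
    unfolding set_class_def using *[OF AB _ assms] *[OF BA _ assms(2,1)] by blast
qed

text \<open>
  The order of the measure algebra, expressed by representatives.
\<close>

definition le_ae :: "'a measure \<Rightarrow> 'a set \<Rightarrow> 'a set \<Rightarrow> bool" where
  "le_ae M A B \<longleftrightarrow> A - B \<in> null_sets M"

lemma le_ae_trans:
  "le_ae M A B \<Longrightarrow> le_ae M B C \<Longrightarrow> A \<in> sets M \<Longrightarrow> B \<in> sets M \<Longrightarrow> C \<in> sets M \<Longrightarrow> le_ae M A C"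
  unfolding le_ae_def by (rule null_sets_subset[OF null_sets.Un[of "A - B" M "B - C"]]) auto

lemma subset_le_ae: "A \<subseteq> B \<Longrightarrow> le_ae M A B"
  by (simp add: le_ae_def Diff_eq_empty_iff[THEN iffD2])

lemma sym_diff_null_iff:
  assumes "A \<in> sets M" "B \<in> sets M"
  shows "sym_diff A B \<in> null_sets M \<longleftrightarrow> le_ae M A B \<and> le_ae M B A"
  unfolding le_ae_def
  using assms null_sets_subset[of "sym_diff A B" M "A - B"] null_sets_subset[of "sym_diff A B" M "B - A"] by auto

lemma le_ae_AE:
  assumes "A \<in> sets M" "B \<in> sets M"
  shows "le_ae M A B \<longleftrightarrow> (AE x in M. x \<in> A \<longrightarrow> x \<in> B)"
proof -
  have "{x \<in> space M. \<not> (x \<in> A \<longrightarrow> x \<in> B)} = A - B" using sets.sets_into_space[OF assms(1)] by auto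
  then show ?thesis using assms
    by (subst AE_iff_null) (auto simp: le_ae_def)
qed

lemma set_class_UN2:
  assumes "A \<in> sets M" "B \<in> sets M"
    and sets: "\<And>A B. A \<in> sets M \<Longrightarrow> B \<in> sets M \<Longrightarrow> op A B \<in> sets M"
    and sub: "\<And>A B A' B'. sym_diff (op A B) (op A' B') \<subseteq> sym_diff A A' \<union> sym_diff B B'"
  shows "(\<Union>A'\<in>set_class M A. \<Union>B'\<in>set_class M B. set_class M (op A' B')) = set_class M (op A B)"
proof -
  have "set_class M (op A' B') = set_class M (op A B)"
    if "A' \<in> set_class M A" "B' \<in> set_class M B" for A' B'
  proof -
    have 1: "A' \<in> sets M" "B' \<in> sets M" "sym_diff A A' \<in> null_sets M" "sym_diff B B' \<in> null_sets M"
      using that by (auto simp: set_class_def)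
    have "sym_diff (op A B) (op A' B') \<in> null_sets M"
      by (rule null_sets_subset[OF null_sets.Un[OF 1(3,4)] _ sub]) (use 1 assms in auto)
    then show ?thesis using set_class_eq_iff[of "op A B" M "op A' B'"] 1 assms by auto
  qed
  moreover have "A \<in> set_class M A" "B \<in> set_class M B" using assms by (auto simp: set_class_def)
  ultimately show ?thesis by blast
qed

lemma measure_algebra_class:
  assumes "A \<in> sets M" "B \<in> sets M"
  shows bjoin_class: "bjoin (measure_algebra M) (set_class M A) (set_class M B) = set_class M (A \<union> B)"
    and bmeet_class: "bmeet (measure_algebra M) (set_class M A) (set_class M B) = set_class M (A \<inter> B)"
    and bcompl_class: "bcompl (measure_algebra M) (set_class M A) = set_class M (space M - A)"
proof -
  show "bjoin (measure_algebra M) (set_class M A) (set_class M B) = set_class M (A \<union> B)"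
    unfolding measure_algebra_def balgebra.simps by (rule set_class_UN2) (use assms in auto)
  show "bmeet (measure_algebra M) (set_class M A) (set_class M B) = set_class M (A \<inter> B)"
    unfolding measure_algebra_def balgebra.simps by (rule set_class_UN2) (use assms in auto)
  have "(\<Union>A'\<in>set_class M A. \<Union>B'\<in>set_class M A. set_class M (space M - A')) = set_class M (space M - A)"
    by (rule set_class_UN2) (use assms in auto)
  moreover have "A \<in> set_class M A" using assms by (auto simp: set_class_def)
  ultimately show "bcompl (measure_algebra M) (set_class M A) = set_class M (space M - A)"
    unfolding measure_algebra_def balgebra.simps by (auto split: if_split_asm)
qed

lemma ble_class:
  assumes "A \<in> sets M" "B \<in> sets M"
  shows "ble (measure_algebra M) (set_class M A) (set_class M B) \<longleftrightarrow> le_ae M A B"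
proof -
  have "sym_diff (A \<union> B) B = A - B" by auto
  then show ?thesis
    using assms bjoin_class[OF assms] set_class_eq_iff[of "A \<union> B" M B] by (simp add: ble_def le_ae_def)
qed

text \<open>
  Dedekind completeness of the measure algebra in terms of sets: every family, of whatever
  cardinality, has an essential supremum. The whole space provides the upper bound that Dedekind
  completeness asks for.
\<close>

lemma localizable_esup:
  assumes "localizable M" "\<S> \<subseteq> sets M"
  obtains E where "E \<in> sets M" "\<forall>A\<in>\<S>. le_ae M A E"
    "\<forall>B\<in>sets M. (\<forall>A\<in>\<S>. le_ae M A B) \<longrightarrow> le_ae M E B"
proof (cases "\<S> = {}")
  case True
  then show ?thesis by (intro that[of "{}"]) (auto intro: subset_le_ae)
next
  case False
  let ?A = "measure_algebra M"
  have car: "bcarrier ?A = set_class M ` sets M" by (simp add: measure_algebra_def)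
  let ?T = "set_class M ` \<S>"
  have "dedekind_complete ?A" using assms(1) by (simp add: localizable_def)
  from this[unfolded dedekind_complete_def, rule_format, of ?T]
  have sup: "?T \<subseteq> bcarrier ?A \<Longrightarrow> ?T \<noteq> {} \<and> (\<exists>u\<in>bcarrier ?A. \<forall>x\<in>?T. ble ?A x u) \<Longrightarrow>
    \<exists>s\<in>bcarrier ?A. (\<forall>x\<in>?T. ble ?A x s) \<and> (\<forall>u\<in>bcarrier ?A. (\<forall>x\<in>?T. ble ?A x u) \<longrightarrow> ble ?A s u)" .
  have "set_class M ` \<S> \<subseteq> bcarrier ?A" "set_class M ` \<S> \<noteq> {}" using assms(2) False car by auto
  moreover have "\<exists>u\<in>bcarrier ?A. \<forall>x\<in>set_class M ` \<S>. ble ?A x u"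
  proof (intro bexI ballI)
    fix x assume "x \<in> set_class M ` \<S>"
    then obtain A where "A \<in> sets M" "x = set_class M A" using assms(2) by auto
    then show "ble ?A x (set_class M (space M))"
      using sets.sets_into_space[of A M] by (simp add: ble_class subset_le_ae)
  qed (simp add: car)
  ultimately obtain s where s: "s \<in> bcarrier ?A" "\<forall>x\<in>set_class M ` \<S>. ble ?A x s"
    "\<forall>u\<in>bcarrier ?A. (\<forall>x\<in>set_class M ` \<S>. ble ?A x u) \<longrightarrow> ble ?A s u"
    using sup by blast
  then obtain E where E: "E \<in> sets M" "s = set_class M E" by (auto simp: car)
  show ?thesis
  proof (rule that[OF E(1)])
    show "\<forall>A\<in>\<S>. le_ae M A E"
    proof
      fix A assume "A \<in> \<S>"
      then show "le_ae M A E" using s(2) E assms(2) ble_class[of A M E] by blast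
    qed
    show "\<forall>B\<in>sets M. (\<forall>A\<in>\<S>. le_ae M A B) \<longrightarrow> le_ae M E B"
    proof (intro ballI impI)
      fix B assume B: "B \<in> sets M" "\<forall>A\<in>\<S>. le_ae M A B"
      then have "\<forall>x\<in>set_class M ` \<S>. ble ?A x (set_class M B)"
        using assms(2) ble_class[of _ M B] by blast
      then have "ble ?A s (set_class M B)" using s(3) B(1) by (auto simp: car)
      then show "le_ae M E B" using ble_class[of E M B] E B by simp
    qed
  qed
qed

lemma localizable_finite_subset:
  assumes "localizable M" "A \<in> sets M" "A \<notin> null_sets M"
  obtains C where "C \<in> sets M" "C \<subseteq> A" "C \<notin> null_sets M" "emeasure M C < \<infinity>"
proof (cases "emeasure M A = \<infinity>")
  case True
  with assms obtain C where "C\<in>sets M" "C \<subseteq> A" "0 < emeasure M C" "emeasure M C < \<infinity>"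
    unfolding localizable_def semifinite_measure_def by metis
  then show ?thesis by (intro that[of C]) (auto simp: null_sets_def)
next
  case False
  then show ?thesis using assms by (intro that[of A]) (auto simp: less_top)
qed

section \<open>Disjointness of supports in terms of the norm\<close>

text \<open>
  The pointwise estimate behind the case \<open>p = \<infinity>\<close>. If \<open>a\<close> and \<open>b\<close> enclose at most a right angle
  and \<open>u\<close> is the direction of \<open>a + b\<close>, then adding \<open>R u\<close> to \<open>a + b\<close> instead of \<open>a\<close> gains at
  least \<open>2 R \<langle>u, b\<rangle>\<close> in squared norm.
\<close>

lemma inner_shift:
  fixes a b :: "'k::real_inner"
  assumes "0 \<le> R" "0 \<le> inner a b" "a + b \<noteq> 0"
  shows "(norm (R *\<^sub>R sgn (a + b) + a))\<^sup>2 + 2 * R * inner (sgn (a + b)) b \<le> (norm (R *\<^sub>R sgn (a + b) + a + b))\<^sup>2"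
    and "norm (R *\<^sub>R sgn (a + b) + a + b) = R + norm (a + b)"
proof -
  let ?u = "sgn (a + b)"
  have "norm (a + b) *\<^sub>R ?u = a + b" using assms(3) by (simp add: sgn_div_norm)
  then have e: "R *\<^sub>R ?u + a + b = (R + norm (a + b)) *\<^sub>R ?u"
    by (simp add: scaleR_add_left add.assoc)
  have "norm ((R + norm (a + b)) *\<^sub>R ?u) = R + norm (a + b)"
    using assms(1,3) by (simp add: norm_sgn)
  then show "norm (R *\<^sub>R ?u + a + b) = R + norm (a + b)" unfolding e .
  have "(norm (R *\<^sub>R ?u + a + b))\<^sup>2 = (norm (R *\<^sub>R ?u + a))\<^sup>2 + 2 * R * inner ?u b + (norm b)\<^sup>2 + 2 * inner a b"
    unfolding power2_norm_eq_inner by (simp add: inner_add_left inner_add_right inner_commute)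
  moreover have "0 \<le> (norm b)\<^sup>2" by simp
  ultimately show "(norm (R *\<^sub>R ?u + a))\<^sup>2 + 2 * R * inner ?u b \<le> (norm (R *\<^sub>R ?u + a + b))\<^sup>2"
    using assms(2) by linarith
qed

context lp_scalar begin

definition disj :: "('a \<Rightarrow> 'k) set \<Rightarrow> ('a \<Rightarrow> 'k) set \<Rightarrow> bool" where
  "disj F G \<longleftrightarrow> L0_mult M F G = nul"

lemma disj_class:
  "f \<in> borel_measurable M \<Longrightarrow> g \<in> borel_measurable M \<Longrightarrow> disj (cl f) (cl g) \<longleftrightarrow> (AE x in M. f x = 0 \<or> g x = 0)"
  by (simp add: disj_def ae_class_eq_iff)

text \<open>
  Suppose that on a set of positive measure \<open>f\<close> and \<open>g\<close> are nonzero and enclose at most a right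
  angle. Let \<open>u\<close> be the direction of \<open>f + g\<close>, let \<open>A\<close> be a non-null part where the inner
  products of \<open>u\<close> with \<open>f\<close> and \<open>g\<close> are at least \<open>\<epsilon>\<close>, and put \<open>h = R u\<close> on \<open>A\<close> and \<open>h = 0\<close>
  elsewhere. If \<open>R\<close> exceeds the norms of \<open>f\<close> and \<open>g\<close>, then the norm of \<open>h + f + g\<close> is at least
  \<open>R\<close> and strictly larger than those of \<open>h + f\<close> and \<open>h + g\<close>: on \<open>A\<close> by \<open>inner_shift\<close>, and
  elsewhere because \<open>h\<close> vanishes there.
\<close>

lemma Linf_half_disjoint:
  fixes f g :: "'a \<Rightarrow> 'k"
  assumes p: "p = \<infinity>" and f: "f \<in> lpf" and g: "g \<in> lpf"
    and crit: "\<And>h. h \<in> lpf \<Longrightarrow> lp_norm p M (\<lambda>x. h x + f x + g x) \<le>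
        max (lp_norm p M (\<lambda>x. h x + f x)) (lp_norm p M (\<lambda>x. h x + g x))"
  shows "AE x in M. f x = 0 \<or> g x = 0 \<or> inner (f x) (g x) < 0"
proof -
  note [measurable] = lpf_measurable[OF f] lpf_measurable[OF g]
  define u where "u x = inverse (norm (f x + g x)) *\<^sub>R (f x + g x)" for x
  have u_sgn: "u x = sgn (f x + g x)" for x by (simp add: u_def sgn_div_norm)
  have [measurable]: "u \<in> borel_measurable M" unfolding u_def by measurable
  define A where "A n = {x \<in> space M. f x \<noteq> 0 \<and> g x \<noteq> 0 \<and> 0 \<le> inner (f x) (g x) \<and>
     1 / real (Suc n) \<le> inner (u x) (f x) \<and> 1 / real (Suc n) \<le> inner (u x) (g x)}" for n
  have A_sets [measurable]: "A n \<in> sets M" for n unfolding A_def by measurable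
  have null: "A n \<in> null_sets M" for n
  proof (rule ccontr)
    assume nn: "A n \<notin> null_sets M"
    define \<epsilon> where "\<epsilon> = 1 / real (Suc n)"
    have \<epsilon>: "0 < \<epsilon>" by (simp add: \<epsilon>_def)
    define s where "s = lp_norm p M f + lp_norm p M g"
    have s: "0 \<le> s" "lp_norm p M f \<le> s" "lp_norm p M g \<le> s" by (auto simp: s_def)
    define R where "R = s + 1"
    have R: "0 \<le> R" "s < R" using s by (auto simp: R_def)
    define h where "h x = (indicator (A n) x * R) *\<^sub>R u x" for x
    have [measurable]: "h \<in> borel_measurable M" unfolding h_def by measurable
    have "norm (h x) \<le> R" for x
      using R by (auto simp: h_def u_sgn norm_sgn indicator_def)
    then have h: "h \<in> lpf" by (subst Linf_in_lpf_iff[OF p]) auto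
    note hf = lpf_add[OF h f] and hg = lpf_add[OF h g] and hfg = lpf_add[OF lpf_add[OF h f] g]
    define m where "m = lp_norm p M (\<lambda>x. h x + f x + g x)"
    have m0: "0 \<le> m" by (simp add: m_def)
    have m: "AE x in M. norm (h x + f x + g x) \<le> m"
      by (rule Linf_norm_le_iff[OF p hfg m0, THEN iffD1]) (simp add: m_def)
    have fg: "AE x in M. norm (f x) \<le> s" "AE x in M. norm (g x) \<le> s"
      using Linf_norm_le_iff[OF p f s(1)] Linf_norm_le_iff[OF p g s(1)] s by auto
    have onA: "norm (h x + f x + g x) = R + norm (f x + g x)"
       "(norm (h x + f x))\<^sup>2 \<le> (norm (h x + f x + g x))\<^sup>2 - 2 * R * \<epsilon>"
       "(norm (h x + g x))\<^sup>2 \<le> (norm (h x + f x + g x))\<^sup>2 - 2 * R * \<epsilon>" if "x \<in> A n" for x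
    proof -
      have i: "0 \<le> inner (f x) (g x)" "0 \<le> inner (g x) (f x)" and
        e: "\<epsilon> \<le> inner (sgn (f x + g x)) (f x)" "\<epsilon> \<le> inner (sgn (f x + g x)) (g x)"
        using that by (auto simp: A_def u_sgn \<epsilon>_def inner_commute)
      have nz: "f x + g x \<noteq> 0" using e \<epsilon> by auto
      have nz': "g x + f x \<noteq> 0" using nz by (simp add: add.commute)
      have hx: "h x = R *\<^sub>R sgn (f x + g x)" using that by (simp add: h_def u_sgn)
      have Re: "2 * R * \<epsilon> \<le> 2 * R * inner (sgn (f x + g x)) (f x)" "2 * R * \<epsilon> \<le> 2 * R * inner (sgn (f x + g x)) (g x)"
        using e R by (auto intro: mult_left_mono)
      show "norm (h x + f x + g x) = R + norm (f x + g x)"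
        unfolding hx by (rule inner_shift(2)[OF R(1) i(1) nz])
      show "(norm (h x + f x))\<^sup>2 \<le> (norm (h x + f x + g x))\<^sup>2 - 2 * R * \<epsilon>"
        using inner_shift(1)[OF R(1) i(1) nz] Re unfolding hx by linarith
      have c: "h x + g x + f x = h x + f x + g x" by simp
      have k: "(norm (h x + g x))\<^sup>2 + 2 * R * inner (sgn (f x + g x)) (f x) \<le> (norm (h x + g x + f x))\<^sup>2"
        using inner_shift(1)[OF R(1) i(2) nz'] unfolding hx by (simp only: add.commute[of "g x" "f x"])
      show "(norm (h x + g x))\<^sup>2 \<le> (norm (h x + f x + g x))\<^sup>2 - 2 * R * \<epsilon>"
        using k Re unfolding c by linarith
    qed
    have "R \<le> m"
    proof (rule ccontr)
      assume "\<not> R \<le> m"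
      have "AE x in M. x \<notin> A n"
        using m
      proof eventually_elim
        case (elim x)
        then show ?case using onA(1)[of x] \<open>\<not> R \<le> m\<close> norm_ge_zero[of "f x + g x"] by linarith
      qed
      then have "A n \<in> null_sets M" using AE_iff_null_sets[OF A_sets] by blast
      with nn show False ..
    qed
    define m' where "m' = sqrt (max (m\<^sup>2 - 2 * R * \<epsilon>) (s\<^sup>2))"
    have bound: "norm (h x + k) \<le> m'" if "norm (h x + f x + g x) \<le> m" "norm k \<le> s"
       "x \<in> A n \<Longrightarrow> (norm (h x + k))\<^sup>2 \<le> (norm (h x + f x + g x))\<^sup>2 - 2 * R * \<epsilon>" for x k
    proof -
      have "(norm (h x + k))\<^sup>2 \<le> max (m\<^sup>2 - 2 * R * \<epsilon>) (s\<^sup>2)"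
      proof (cases "x \<in> A n")
        case True
        moreover have "(norm (h x + f x + g x))\<^sup>2 \<le> m\<^sup>2" using that(1) by (intro power_mono) auto
        ultimately show ?thesis using that(3) by auto
      next
        case False
        then have "h x = 0" by (simp add: h_def)
        moreover have "(norm k)\<^sup>2 \<le> s\<^sup>2" using that(2) by (intro power_mono) auto
        ultimately show ?thesis by simp
      qed
      then show ?thesis unfolding m'_def by (rule real_le_rsqrt)
    qed
    have m': "0 \<le> m'" by (simp add: m'_def le_max_iff_disj)
    have "AE x in M. norm (h x + f x) \<le> m'"
      using m fg(1) by eventually_elim (rule bound, auto intro: onA(2))
    moreover have "AE x in M. norm (h x + g x) \<le> m'"
      using m fg(2) by eventually_elim (rule bound, auto intro: onA(3))
    ultimately have "m \<le> m'"
      using crit[OF h] Linf_norm_le_iff[OF p hf m'] Linf_norm_le_iff[OF p hg m'] by (simp add: m_def)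
    then have "m\<^sup>2 \<le> m'\<^sup>2" using m0 by (intro power_mono)
    also have "m'\<^sup>2 = max (m\<^sup>2 - 2 * R * \<epsilon>) (s\<^sup>2)" unfolding m'_def by (simp add: le_max_iff_disj)
    also have "\<dots> < m\<^sup>2"
    proof -
      have "0 < R * \<epsilon>" using s \<epsilon> by (simp add: R_def)
      moreover have "s\<^sup>2 < m\<^sup>2" using \<open>R \<le> m\<close> s by (intro power_strict_mono) (auto simp: R_def)
      ultimately show ?thesis by simp
    qed
    finally show False by simp
  qed
  have "AE x in M. \<forall>n. x \<notin> A n" unfolding AE_all_countable using null by (auto intro: AE_not_in)
  then show ?thesis
  proof (rule AE_mp[OF _ AE_I2], intro impI)
    fix x assume x: "x \<in> space M" "\<forall>n. x \<notin> A n"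
    show "f x = 0 \<or> g x = 0 \<or> inner (f x) (g x) < 0"
    proof (rule ccontr)
      assume "\<not> ?thesis"
      then have c: "f x \<noteq> 0" "g x \<noteq> 0" "0 \<le> inner (f x) (g x)" by auto
      have pos: "0 < inner (f x + g x) (f x)" "0 < inner (f x + g x) (g x)"
        using c by (auto simp: inner_left_distrib inner_commute[of "g x" "f x"] intro: add_pos_nonneg add_nonneg_pos)
      then have "f x + g x \<noteq> 0" by auto
      then have "0 < inner (u x) (f x)" "0 < inner (u x) (g x)" using pos by (auto simp: u_def)
      then have "0 < min (inner (u x) (f x)) (inner (u x) (g x))" by simp
      then obtain n where "1 / real (Suc n) < min (inner (u x) (f x)) (inner (u x) (g x))"
        by (rule nat_approx_posE)
      then have "1 / real (Suc n) \<le> inner (u x) (f x)" "1 / real (Suc n) \<le> inner (u x) (g x)" by linarith+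
      then have "x \<in> A n" using x c by (simp add: A_def del: of_nat_Suc)
      with x show False by blast
    qed
  qed
qed

text \<open>
  The inner products of \<open>f\<close> with \<open>g\<close> and with \<open>-g\<close> cannot both be negative.
\<close>

lemma Linf_disjoint:
  assumes p: "p = \<infinity>" and F: "F \<in> V" and G: "G \<in> V"
    and crit: "\<And>H c. H \<in> V \<Longrightarrow> c = 1 \<or> c = -1 \<Longrightarrow> nrm (H \<oplus> F \<oplus> c \<cdot> G) \<le> max (nrm (H \<oplus> F)) (nrm (H \<oplus> c \<cdot> G))"
  shows "disj F G"
proof -
  obtain f where f: "f \<in> lpf" "F = cl f" using F by (rule LpE)
  obtain g where g: "g \<in> lpf" "G = cl g" using G by (rule LpE)
  have half: "AE x in M. f x = 0 \<or> c * g x = 0 \<or> inner (f x) (c * g x) < 0" if c: "c = 1 \<or> c = -1" for c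
  proof (rule Linf_half_disjoint[OF p f(1) lpf_scale[OF g(1)]])
    fix h :: "'a \<Rightarrow> 'k" assume h: "h \<in> lpf"
    have [measurable]: "h \<in> borel_measurable M" "f \<in> borel_measurable M" "g \<in> borel_measurable M"
      using h f g by auto
    show "lp_norm p M (\<lambda>x. h x + f x + c * g x) \<le>
        max (lp_norm p M (\<lambda>x. h x + f x)) (lp_norm p M (\<lambda>x. h x + c * g x))"
      using crit[of "cl h" c] h c f g by (simp only: in_Lp_iff) (simp add: nrm_class)
  qed
  have "AE x in M. f x = 0 \<or> g x = 0"
    using half[of 1, simplified] half[of "-1", simplified] by eventually_elim auto
  then show ?thesis using f g by (simp add: disj_class)
qed

text \<open>
  The two sides of Clarkson's inequality for \<open>f\<close> and \<open>g\<close> have the same finite integral, so that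
  the pointwise inequality is an equality almost everywhere.
\<close>

lemma finite_disjoint:
  assumes p: "p \<noteq> \<infinity>" "p \<noteq> 2" and F: "F \<in> V" and G: "G \<in> V"
    and split: "lp_split (nrm (F \<oplus> G)) (nrm F) (nrm G)" "lp_split (nrm (F \<ominus> G)) (nrm F) (nrm G)"
  shows "disj F G"
proof -
  obtain f where f: "f \<in> lpf" "F = cl f" using F by (rule LpE)
  obtain g where g: "g \<in> lpf" "G = cl g" using G by (rule LpE)
  note [measurable] = lpf_measurable[OF f(1)] lpf_measurable[OF g(1)]
  define q where "q = enn2real p"
  have q: "1 \<le> q" using p_ge_1[OF p(1)] by (simp add: q_def)
  have "q \<noteq> 2"
  proof
    assume "q = 2"
    then have "p = ennreal 2" unfolding q_def using p(1) by (metis ennreal_enn2real infinity_ennreal_def less_top)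
    with p(2) show False by simp
  qed
  define I where "I h = (\<integral>\<^sup>+x. ennreal (norm (h x) powr q) \<partial>M)" for h :: "'a \<Rightarrow> 'k"
  have I: "I h = ennreal (lp_norm p M h powr q)" if "h \<in> lpf" for h
    using lp_norm_powr[OF p(1) that] by (simp add: I_def q_def)
  define \<phi> where "\<phi> x = ennreal (norm (f x + g x) powr q + norm (f x - g x) powr q)" for x
  define \<psi> where "\<psi> x = ennreal (2 * (norm (f x) powr q + norm (g x) powr q))" for x
  have [measurable]: "\<phi> \<in> borel_measurable M" "\<psi> \<in> borel_measurable M" unfolding \<phi>_def \<psi>_def by measurable
  have diff: "(\<lambda>x. f x - g x) \<in> lpf" using lpf_add[OF f(1) lpf_scale[OF g(1), of "-1"]] by simp
  have "integral\<^sup>N M \<phi> = I (\<lambda>x. f x + g x) + I (\<lambda>x. f x - g x)"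
    unfolding \<phi>_def I_def by (simp add: nn_integral_add)
  also have "\<dots> = ennreal (2 * (lp_norm p M f powr q + lp_norm p M g powr q))"
    unfolding I[OF lpf_add[OF f(1) g(1)]] I[OF diff] using split p(1) f g
    by (simp add: lp_split_def nrm_class q_def ennreal_plus[symmetric] del: ennreal_plus)
  finally have \<phi>: "integral\<^sup>N M \<phi> = \<dots>" .
  have "integral\<^sup>N M \<psi> = 2 * (I f + I g)"
    unfolding \<psi>_def I_def by (simp add: nn_integral_add nn_integral_cmult ennreal_mult')
  also have "\<dots> = ennreal (2 * (lp_norm p M f powr q + lp_norm p M g powr q))"
    unfolding I[OF f(1)] I[OF g(1)] by (simp add: ennreal_mult')
  finally have \<psi>: "integral\<^sup>N M \<psi> = \<dots>" .
  have eq_AE: "AE x in M. b x \<le> a x" if "integral\<^sup>N M a = integral\<^sup>N M b" "integral\<^sup>N M a \<noteq> \<infinity>"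
     "\<And>x. a x \<le> b x" and [measurable]: "a \<in> borel_measurable M" "b \<in> borel_measurable M" for a b :: "'a \<Rightarrow> ennreal"
  proof -
    have "(\<integral>\<^sup>+x. b x - a x \<partial>M) = 0"
      using that by (subst nn_integral_diff) auto
    then have "AE x in M. b x - a x = 0" by (subst (asm) nn_integral_0_iff_AE) auto
    then show ?thesis by eventually_elim (simp add: diff_eq_0_iff_ennreal)
  qed
  have "AE x in M. f x = 0 \<or> g x = 0"
  proof (cases "q < 2")
    case True
    have le: "norm (f x + g x) powr q + norm (f x - g x) powr q \<le> 2 * (norm (f x) powr q + norm (g x) powr q)" for x
      using clarkson_strict(1)[of q "f x" "g x"] q True
      by (cases "f x = 0 \<or> g x = 0") auto
    have "AE x in M. \<psi> x \<le> \<phi> x"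
    proof (rule eq_AE)
      show "\<phi> x \<le> \<psi> x" for x using le[of x] unfolding \<phi>_def \<psi>_def by (rule ennreal_leI)
    qed (auto simp: \<phi> \<psi>)
    then show ?thesis
    proof eventually_elim
      case (elim x)
      then have "2 * (norm (f x) powr q + norm (g x) powr q) \<le> norm (f x + g x) powr q + norm (f x - g x) powr q"
        unfolding \<phi>_def \<psi>_def by (subst (asm) ennreal_le_iff) auto
      then show ?case using clarkson_strict(1)[of q "f x" "g x"] q True by fastforce
    qed
  next
    case False
    then have q2: "2 < q" using \<open>q \<noteq> 2\<close> by simp
    have le: "2 * (norm (f x) powr q + norm (g x) powr q) \<le> norm (f x + g x) powr q + norm (f x - g x) powr q" for x
      using clarkson_strict(2)[of q "f x" "g x"] q2
      by (cases "f x = 0 \<or> g x = 0") auto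
    have "AE x in M. \<phi> x \<le> \<psi> x"
    proof (rule eq_AE)
      show "\<psi> x \<le> \<phi> x" for x using le[of x] unfolding \<phi>_def \<psi>_def by (rule ennreal_leI)
    qed (auto simp: \<phi> \<psi>)
    then show ?thesis
    proof eventually_elim
      case (elim x)
      then have "norm (f x + g x) powr q + norm (f x - g x) powr q \<le> 2 * (norm (f x) powr q + norm (g x) powr q)"
        unfolding \<phi>_def \<psi>_def by (subst (asm) ennreal_le_iff) auto
      then show ?case using clarkson_strict(2)[of q "f x" "g x"] q2 by fastforce
    qed
  qed
  then show ?thesis using f g by (simp add: disj_class)
qed

section \<open>\<open>L\<^sup>p\<close>-projections are multiplication operators\<close>

text \<open>
  For \<open>p = \<infinity>\<close>, decompose \<open>H = X + Y\<close> into its parts in the range and in the kernel of \<open>P\<close>. The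
  norms of \<open>H + F + G\<close>, \<open>H + F\<close> and \<open>H + G\<close> are the maxima of the norms of \<open>X + F\<close> and \<open>Y + G\<close>,
  of \<open>X + F\<close> and \<open>Y\<close>, and of \<open>X\<close> and \<open>Y + G\<close>, which yields the criterion for disjointness.
\<close>

lemma split_disjoint_ranges:
  assumes "p \<noteq> 2" and P: "Lp_projection p (Lp_space p M) P"
    and FG: "F \<in> V" "P F = F" "G \<in> V" "P G = nul"
  shows "disj F G"
proof -
  have Pv: "P \<in> vectors B" and split: "\<And>X. X \<in> V \<Longrightarrow> lp_split (nrm X) (nrm (P X)) (nrm (X \<ominus> P X))"
    and idem: "\<And>X. X \<in> V \<Longrightarrow> P (P X) = P X"
    using P unfolding Lp_projection_iff by blast+
  have sp: "lp_split (nrm (X \<oplus> Y)) (nrm X) (nrm Y)" if "X \<in> V" "P X = X" "Y \<in> V" "P Y = nul" for X Y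
  proof -
    have PX: "P (X \<oplus> Y) = X" using that by (simp add: opD(3)[OF Pv])
    have "(X \<oplus> Y) \<ominus> X = Y" using that(1,3) by - (erule LpE, erule LpE, simp)
    with split[of "X \<oplus> Y"] PX that show ?thesis by simp
  qed
  have PcG: "P (c \<cdot> G) = nul" for c using FG opD(4)[OF Pv FG(3), of c] by simp
  show ?thesis
  proof (cases "p = \<infinity>")
    case False
    have n: "nrm ((-1) \<cdot> G) = nrm G" using nrm_scale[OF FG(3), of "-1"] by simp
    show ?thesis
      using finite_disjoint[OF False assms(1) FG(1,3)] sp[OF FG] sp[OF FG(1,2) _ PcG[of "-1"]] FG n by simp
  next
    case True
    have mx: "nrm (X \<oplus> Y) = max (nrm X) (nrm Y)" if "X \<in> V" "P X = X" "Y \<in> V" "P Y = nul" for X Y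
      using sp[OF that] True unfolding lp_split_def by simp
    show ?thesis
    proof (rule Linf_disjoint[OF True FG(1,3)])
      fix H and c :: 'k assume H: "H \<in> V"
      define X where "X = P H"
      define Y where "Y = H \<ominus> P H"
      have PH: "P H \<in> V" using opD(1)[OF Pv H] .
      have X: "X \<in> V" "P X = X" "Y \<in> V" "P Y = nul"
        using H PH idem[OF H] by (simp_all add: X_def Y_def opD(3)[OF Pv] opD(4)[OF Pv])
      have HXY: "H = X \<oplus> Y"
        unfolding X_def Y_def using H PH by - (erule LpE, erule LpE, simp)
      define G' where "G' = c \<cdot> G"
      have G': "G' \<in> V" "P G' = nul" using FG PcG by (auto simp: G'_def)
      have e: "H \<oplus> F \<oplus> G' = (X \<oplus> F) \<oplus> (Y \<oplus> G')" "H \<oplus> F = (X \<oplus> F) \<oplus> Y" "H \<oplus> G' = X \<oplus> (Y \<oplus> G')"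
        unfolding HXY using X(1,3) FG(1) G'(1)
        by - (erule LpE, erule LpE, erule LpE, erule LpE, simp add: add_ac)+
      have XF: "X \<oplus> F \<in> V" "P (X \<oplus> F) = X \<oplus> F" and YG: "Y \<oplus> G' \<in> V" "P (Y \<oplus> G') = nul"
        using X FG G' by (auto simp: opD(3)[OF Pv])
      have "nrm (H \<oplus> F \<oplus> G') = max (nrm (X \<oplus> F)) (nrm (Y \<oplus> G'))"
        unfolding e(1) by (rule mx[OF XF YG])
      moreover have "nrm (H \<oplus> F) = max (nrm (X \<oplus> F)) (nrm Y)" "nrm (H \<oplus> G') = max (nrm X) (nrm (Y \<oplus> G'))"
        unfolding e(2,3) by (rule mx[OF XF X(3,4)], rule mx[OF X(1,2) YG])
      ultimately show "nrm (H \<oplus> F \<oplus> c \<cdot> G) \<le> max (nrm (H \<oplus> F)) (nrm (H \<oplus> c \<cdot> G))"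
        unfolding G'_def[symmetric] by linarith
    qed
  qed
qed

text \<open>
  \<open>E\<close> is the supremum of the supports of the functions in the range of \<open>P\<close>. These functions are
  supported in \<open>E\<close>, and a function in the kernel vanishes on \<open>E\<close>, because the complement of its
  support is an upper bound of all these supports.
\<close>

lemma disjoint_ranges_mult:
  assumes loc: "localizable M" and Pv: "P \<in> vectors B" and idem: "\<And>F. F \<in> V \<Longrightarrow> P (P F) = P F"
    and dis: "\<And>F G. F \<in> V \<Longrightarrow> P F = F \<Longrightarrow> G \<in> V \<Longrightarrow> P G = nul \<Longrightarrow> disj F G"
  obtains E where "E \<in> sets M" "\<forall>F\<in>V. P F = restr E F"
proof -
  define S where "S = {{x \<in> space M. f x \<noteq> 0} | f. f \<in> lpf \<and> P (cl f) = cl f}"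
  have supp: "{x \<in> space M. f x \<noteq> 0} \<in> sets M" if "f \<in> lpf" for f :: "'a \<Rightarrow> 'k"
    using lpf_measurable[OF that] by measurable
  then have "S \<subseteq> sets M" by (auto simp: S_def)
  from localizable_esup[OF loc this] obtain E where E: "E \<in> sets M" "\<forall>A\<in>S. le_ae M A E"
    "\<forall>B\<in>sets M. (\<forall>A\<in>S. le_ae M A B) \<longrightarrow> le_ae M E B" by metis
  show thesis
  proof (rule that[OF E(1)], intro ballI)
    fix F assume F: "F \<in> V"
    note PF = opD(1)[OF Pv F]
    obtain f where f: "f \<in> lpf" "P F = cl f" using PF by (rule LpE)
    have G: "F \<ominus> P F \<in> V" using F PF by simp
    obtain g where g: "g \<in> lpf" "F \<ominus> P F = cl g" using G by (rule LpE)
    have PG: "P (F \<ominus> P F) = nul" using F PF idem[OF F] by (simp add: opD(3)[OF Pv] opD(4)[OF Pv])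
    have fE: "le_ae M {x \<in> space M. f x \<noteq> 0} E"
      using f idem[OF F] E(2) by (auto simp: S_def)
    have "\<forall>A\<in>S. le_ae M A (space M - {x \<in> space M. g x \<noteq> 0})"
    proof
      fix A assume "A \<in> S"
      then obtain k where k: "k \<in> lpf" "P (cl k) = cl k" "A = {x \<in> space M. k x \<noteq> 0}" by (auto simp: S_def)
      have "disj (cl k) (cl g)" using dis[of "cl k" "cl g"] k PG g G by simp
      then have "AE x in M. k x = 0 \<or> g x = 0" using k g by (simp add: disj_class)
      then show "le_ae M A (space M - {x \<in> space M. g x \<noteq> 0})"
        using supp[OF k(1)] supp[OF g(1)] by (subst le_ae_AE) (auto simp: k(3))
    qed
    then have gE: "le_ae M E (space M - {x \<in> space M. g x \<noteq> 0})"
      using E(3) supp[OF g(1)] by blast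
    have "AE x in M. x \<in> {x \<in> space M. f x \<noteq> 0} \<longrightarrow> x \<in> E"
      using fE supp[OF f(1)] E(1) by (simp only: le_ae_AE)
    then have f_E: "AE x in M. indicator E x * f x = f x"
      by (rule AE_mp[OF _ AE_I2]) (auto simp: indicator_def)
    have "AE x in M. x \<in> E \<longrightarrow> x \<in> space M - {x \<in> space M. g x \<noteq> 0}"
      using gE supp[OF g(1)] E(1) by (subst (asm) le_ae_AE) auto
    then have g_E: "AE x in M. indicator E x * g x = 0"
      by (rule AE_mp[OF _ AE_I2]) (auto simp: indicator_def)
    have "restr E (cl f) = cl f" "restr E (cl g) = nul"
      using f(1) g(1) E(1) f_E g_E by (simp_all add: restr_class ae_class_eqI)
    then have "restr E (P F) = P F" "restr E (F \<ominus> P F) = nul"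
      by (simp_all only: f(2)[symmetric] g(2)[symmetric])
    moreover have "F = (F \<ominus> P F) \<oplus> P F" using F PF by simp
    ultimately show "P F = restr E F"
      using restr_linear(1)[OF E(1) G PF] PF by simp
  qed
qed

theorem Lp_projection_mult:
  assumes "p \<noteq> 2" "localizable M" "Lp_projection p (Lp_space p M) P"
  obtains E where "E \<in> sets M" "\<forall>F\<in>V. P F = restr E F"
proof (rule disjoint_ranges_mult[OF assms(2)])
  show "P \<in> vectors B" and "\<And>F. F \<in> V \<Longrightarrow> P (P F) = P F"
    using assms(3) unfolding Lp_projection_iff by blast+
qed (use split_disjoint_ranges[OF assms(1,3)] that in blast)+

lemma lp_split_restr:
  assumes "E \<in> sets M" "F \<in> V"
  shows "lp_split (nrm F) (nrm (restr E F)) (nrm (F \<ominus> restr E F))"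
proof -
  obtain f where f: "f \<in> lpf" "F = cl f" using assms(2) by (rule LpE)
  have E': "space M - E \<in> sets M" using assms by auto
  have e: "AE x in M. f x = indicator E x * f x + indicator (space M - E) x * f x"
    by (rule AE_I2) (simp add: indicator_def)
  have "lp_split (lp_norm p M (\<lambda>x. indicator E x * f x + indicator (space M - E) x * f x))
    (lp_norm p M (\<lambda>x. indicator E x * f x)) (lp_norm p M (\<lambda>x. indicator (space M - E) x * f x))"
    using f assms by (intro lp_split_disjoint lpf_indicator_mult) (auto simp: indicator_def)
  moreover have "nrm F = lp_norm p M (\<lambda>x. indicator E x * f x + indicator (space M - E) x * f x)"
    using f assms E' unfolding f(2) ae_class_eqI[OF e] by (subst nrm_class) auto
  ultimately show ?thesis unfolding restr_compl[OF assms] using f assms E' by (simp add: restr_class nrm_class)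
qed

lemma restr_Lp_projection: 
  assumes "E \<in> sets M" "P \<in> vectors B" "\<And>F. F \<in> V \<Longrightarrow> P F = restr E F"
  shows "Lp_projection p (Lp_space p M) P"
  unfolding Lp_projection_iff using assms by (simp add: restr_restr lp_split_restr)

lemma indicator_lpf:
  assumes "C \<in> sets M" "emeasure M C < \<infinity>"
  shows "(indicator C :: 'a \<Rightarrow> 'k) \<in> lpf"
proof (cases "p = \<infinity>")
  case True
  show ?thesis using assms(1) by (subst Linf_in_lpf_iff[OF True]) (auto intro!: exI[of _ 1] simp: indicator_def)
next
  case False
  have "(\<integral>\<^sup>+x. ennreal (norm (indicator C x :: 'k) powr enn2real p) \<partial>M) = (\<integral>\<^sup>+x. indicator C x \<partial>M)"
    by (intro nn_integral_cong) (auto simp: indicator_def)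
  then show ?thesis using False assms by (simp add: lpf_def lp_size_def)
qed

text \<open>
  Since the measure is semi-finite, the restriction operators determine the set: it can be
  tested on indicator functions of sets of finite measure, which belong to \<open>L\<^sup>p\<close>.
\<close>

lemma restr_le_ae:
  assumes "localizable M" "E \<in> sets M" "E' \<in> sets M"
    and "\<And>F. F \<in> V \<Longrightarrow> restr E F = restr (E' \<inter> E) F"
  shows "le_ae M E E'"
proof (rule ccontr)
  assume "\<not> le_ae M E E'"
  then have n: "E - E' \<in> sets M" "E - E' \<notin> null_sets M" using assms by (auto simp: le_ae_def)
  obtain C where C: "C \<in> sets M" "C \<subseteq> E - E'" "C \<notin> null_sets M" "emeasure M C < \<infinity>"
    using localizable_finite_subset[OF assms(1) n] by metis
  have "restr E (cl (indicator C) :: ('a \<Rightarrow> 'k) set) = restr (E' \<inter> E) (cl (indicator C))"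
    using indicator_lpf[OF C(1,4)] C(1) by (intro assms(4)) simp
  then have "AE x in M. indicator E x * indicator C x = (indicator (E' \<inter> E) x * indicator C x :: 'k)"
    using assms C by (simp add: restr_class ae_class_eq_iff)
  then have "AE x in M. x \<notin> C"
    by eventually_elim (use C(2) in \<open>auto simp: indicator_def split: if_splits\<close>)
  then show False using C AE_iff_null_sets by blast
qed

text \<open>
  The multiplier \<open>g\<close> satisfies \<open>g\<^sup>2 = g\<close> almost everywhere on every set of finite measure, and
  therefore almost everywhere.
\<close>

lemma mult_idempotent_restr:
  assumes "localizable M" "multiplication_operator p M P" "\<And>F. F \<in> V \<Longrightarrow> P (P F) = P F"
  obtains E where "E \<in> sets M" "\<forall>F\<in>V. P F = restr E F"
proof -
  obtain G where "G \<in> vectors (Lp_space \<infinity> M)" and P: "\<And>F. F \<in> V \<Longrightarrow> P F = L0_mult M G F" and Pv: "P \<in> vectors B"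
    using assms(2) by (auto simp: multiplication_operator_def)
  then have "G \<in> L0 M" by (simp add: Lp_space_simps)
  then obtain g where g [measurable]: "g \<in> borel_measurable M" and G: "G = cl g" by (rule L0_E)
  have N: "{x \<in> space M. g x * g x \<noteq> g x} \<in> sets M" by measurable
  have "{x \<in> space M. g x * g x \<noteq> g x} \<in> null_sets M"
  proof (rule ccontr)
    assume n: "\<not> ?thesis"
    obtain C where C: "C \<in> sets M" "C \<subseteq> {x \<in> space M. g x * g x \<noteq> g x}" "C \<notin> null_sets M" "emeasure M C < \<infinity>"
      by (rule localizable_finite_subset[OF assms(1) N n])
    have l: "cl (indicator C) \<in> V" using indicator_lpf[OF C(1,4)] C(1) by simp
    have "L0_mult M G (L0_mult M G (cl (indicator C))) = L0_mult M G (cl (indicator C))"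
      using P[OF l] assms(3)[OF l] P[OF opD(1)[OF Pv l]] by simp
    then have "AE x in M. g x * (g x * indicator C x) = (g x * indicator C x :: 'k)"
      using C G by (simp add: ae_class_eq_iff)
    then have "AE x in M. x \<notin> C"
      by eventually_elim (use C(2) in \<open>auto simp: indicator_def split: if_splits\<close>)
    then show False using C AE_iff_null_sets by blast
  qed
  then have "AE x in M. x \<notin> {x \<in> space M. g x * g x \<noteq> g x}" by (rule AE_not_in)
  then have ae: "AE x in M. g x = indicator {x \<in> space M. g x = 1} x"
    by (rule AE_mp[OF _ AE_I2]) (auto simp: indicator_def)
  have "{x \<in> space M. g x = 1} \<in> sets M" by measurable
  moreover have "P F = restr {x \<in> space M. g x = 1} F" if "F \<in> V" for F
    unfolding P[OF that] G restr_def ae_class_eqI[OF ae] ..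
  ultimately show thesis using that by blast
qed

lemma restr_multiplication_operator:
  assumes "E \<in> sets M" "P \<in> vectors B" "\<And>F. F \<in> V \<Longrightarrow> P F = restr E F"
  shows "multiplication_operator p M P"
proof -
  interpret inf: lp \<infinity> M by standard simp
  have "(indicator E :: 'a \<Rightarrow> 'k) \<in> inf.lpf"
    using assms(1) by (subst inf.Linf_in_lpf_iff) (auto intro!: exI[of _ 1] simp: indicator_def)
  then have "cl (indicator E :: 'a \<Rightarrow> 'k) \<in> vectors (Lp_space \<infinity> M)"
    using assms(1) by (subst inf.in_Lp_iff) auto
  then show ?thesis using assms unfolding multiplication_operator_def restr_def by blast
qed

end

section \<open>Isomorphisms of measure algebras\<close>

definition eq_ae :: "'a measure \<Rightarrow> 'a set \<Rightarrow> 'a set \<Rightarrow> bool" where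
  "eq_ae M A B \<longleftrightarrow> le_ae M A B \<and> le_ae M B A"

lemma eq_ae_AE:
  "A \<in> sets M \<Longrightarrow> B \<in> sets M \<Longrightarrow> eq_ae M A B \<longleftrightarrow> (AE x in M. x \<in> A \<longleftrightarrow> x \<in> B)"
  by (simp add: eq_ae_def le_ae_AE AE_conj_iff[symmetric] iff_conv_conj_imp[symmetric])

lemma null_sets_AE: "A \<in> sets M \<Longrightarrow> A \<in> null_sets M \<longleftrightarrow> (AE x in M. x \<notin> A)"
  using AE_iff_null_sets by blast

text \<open>
  A partial set automorphism in terms of representatives. An order isomorphism between Boolean
  algebras preserves all Boolean operations and all existing suprema, so that two monotone maps
  that are inverse to each other modulo null sets carry the whole structure.
\<close>

locale set_iso =
  fixes M :: "'a measure" and D D' :: "'a set" and \<Phi> \<Phi>' :: "'a set \<Rightarrow> 'a set"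
  assumes D [measurable]: "D \<in> sets M" and D' [measurable]: "D' \<in> sets M"
    and \<Phi>: "\<And>A. A \<in> sets M \<Longrightarrow> A \<subseteq> D' \<Longrightarrow> \<Phi> A \<in> sets M \<and> \<Phi> A \<subseteq> D"
    and \<Phi>': "\<And>A. A \<in> sets M \<Longrightarrow> A \<subseteq> D \<Longrightarrow> \<Phi>' A \<in> sets M \<and> \<Phi>' A \<subseteq> D'"
    and mono: "\<And>A B. A \<in> sets M \<Longrightarrow> A \<subseteq> D' \<Longrightarrow> B \<in> sets M \<Longrightarrow> B \<subseteq> D' \<Longrightarrow> le_ae M A B \<Longrightarrow> le_ae M (\<Phi> A) (\<Phi> B)"
    and mono': "\<And>A B. A \<in> sets M \<Longrightarrow> A \<subseteq> D \<Longrightarrow> B \<in> sets M \<Longrightarrow> B \<subseteq> D \<Longrightarrow> le_ae M A B \<Longrightarrow> le_ae M (\<Phi>' A) (\<Phi>' B)"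
    and inv': "\<And>A. A \<in> sets M \<Longrightarrow> A \<subseteq> D' \<Longrightarrow> eq_ae M (\<Phi>' (\<Phi> A)) A"
    and inv: "\<And>A. A \<in> sets M \<Longrightarrow> A \<subseteq> D \<Longrightarrow> eq_ae M (\<Phi> (\<Phi>' A)) A"
begin

lemma inverse_iso: "set_iso M D' D \<Phi>' \<Phi>"
  by standard (fact D D' \<Phi> \<Phi>' mono mono' inv inv')+

lemma \<Phi>_sets [measurable]: "A \<in> sets M \<Longrightarrow> A \<subseteq> D' \<Longrightarrow> \<Phi> A \<in> sets M"
  using \<Phi> by blast

lemma \<Phi>'_sets [measurable]: "A \<in> sets M \<Longrightarrow> A \<subseteq> D \<Longrightarrow> \<Phi>' A \<in> sets M"
  using \<Phi>' by blast

lemma AE_mono: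
  assumes "A \<in> sets M" "A \<subseteq> D'" "B \<in> sets M" "B \<subseteq> D'" "AE x in M. x \<in> A \<longrightarrow> x \<in> B"
  shows "AE x in M. x \<in> \<Phi> A \<longrightarrow> x \<in> \<Phi> B"
  using mono[OF assms(1-4)] assms by (simp add: le_ae_AE \<Phi>_sets)

lemma AE_cong:
  assumes "A \<in> sets M" "A \<subseteq> D'" "B \<in> sets M" "B \<subseteq> D'" "AE x in M. x \<in> A \<longleftrightarrow> x \<in> B"
  shows "AE x in M. x \<in> \<Phi> A \<longleftrightarrow> x \<in> \<Phi> B"
proof -
  have "AE x in M. x \<in> A \<longrightarrow> x \<in> B" "AE x in M. x \<in> B \<longrightarrow> x \<in> A" using assms(5) by (auto elim!: eventually_mono)
  then have "AE x in M. x \<in> \<Phi> A \<longrightarrow> x \<in> \<Phi> B" "AE x in M. x \<in> \<Phi> B \<longrightarrow> x \<in> \<Phi> A"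
    using assms by (simp_all add: AE_mono)
  then show ?thesis by eventually_elim blast
qed

lemma AE_inv: "A \<in> sets M \<Longrightarrow> A \<subseteq> D \<Longrightarrow> AE x in M. x \<in> \<Phi> (\<Phi>' A) \<longleftrightarrow> x \<in> A"
  using inv[of A] \<Phi>'[of A] \<Phi>[of "\<Phi>' A"] by (simp add: eq_ae_AE)

lemma AE_inv': "A \<in> sets M \<Longrightarrow> A \<subseteq> D' \<Longrightarrow> AE x in M. x \<in> \<Phi>' (\<Phi> A) \<longleftrightarrow> x \<in> A"
  using inv'[of A] \<Phi>[of A] \<Phi>'[of "\<Phi> A"] by (simp add: eq_ae_AE)

text \<open>
  \<open>\<Phi>\<close> and \<open>\<Phi>'\<close> are adjoint to each other on both sides, which is what the preservation of
  unions, intersections and complements rests on.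
\<close>

lemma galois:
  assumes "A \<in> sets M" "A \<subseteq> D'" "B \<in> sets M" "B \<subseteq> D"
  shows "(AE x in M. x \<in> \<Phi> A \<longrightarrow> x \<in> B) \<longleftrightarrow> (AE x in M. x \<in> A \<longrightarrow> x \<in> \<Phi>' B)"
    and "(AE x in M. x \<in> B \<longrightarrow> x \<in> \<Phi> A) \<longleftrightarrow> (AE x in M. x \<in> \<Phi>' B \<longrightarrow> x \<in> A)"
proof -
  interpret i: set_iso M D' D \<Phi>' \<Phi> by (rule inverse_iso)
  note A = \<Phi>[OF assms(1,2)] and B = \<Phi>'[OF assms(3,4)]
  show "(AE x in M. x \<in> \<Phi> A \<longrightarrow> x \<in> B) \<longleftrightarrow> (AE x in M. x \<in> A \<longrightarrow> x \<in> \<Phi>' B)"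
  proof
    assume "AE x in M. x \<in> \<Phi> A \<longrightarrow> x \<in> B"
    then have "AE x in M. x \<in> \<Phi>' (\<Phi> A) \<longrightarrow> x \<in> \<Phi>' B" using A assms by (intro i.AE_mono) auto
    with AE_inv'[OF assms(1,2)] show "AE x in M. x \<in> A \<longrightarrow> x \<in> \<Phi>' B" by eventually_elim blast
  next
    assume "AE x in M. x \<in> A \<longrightarrow> x \<in> \<Phi>' B"
    then have "AE x in M. x \<in> \<Phi> A \<longrightarrow> x \<in> \<Phi> (\<Phi>' B)" using B assms by (intro AE_mono) auto
    with AE_inv[OF assms(3,4)] show "AE x in M. x \<in> \<Phi> A \<longrightarrow> x \<in> B" by eventually_elim blast
  qed
  show "(AE x in M. x \<in> B \<longrightarrow> x \<in> \<Phi> A) \<longleftrightarrow> (AE x in M. x \<in> \<Phi>' B \<longrightarrow> x \<in> A)"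
  proof
    assume "AE x in M. x \<in> B \<longrightarrow> x \<in> \<Phi> A"
    then have "AE x in M. x \<in> \<Phi>' B \<longrightarrow> x \<in> \<Phi>' (\<Phi> A)" using A assms by (intro i.AE_mono) auto
    with AE_inv'[OF assms(1,2)] show "AE x in M. x \<in> \<Phi>' B \<longrightarrow> x \<in> A" by eventually_elim blast
  next
    assume "AE x in M. x \<in> \<Phi>' B \<longrightarrow> x \<in> A"
    then have "AE x in M. x \<in> \<Phi> (\<Phi>' B) \<longrightarrow> x \<in> \<Phi> A" using B assms by (intro AE_mono) auto
    with AE_inv[OF assms(3,4)] show "AE x in M. x \<in> B \<longrightarrow> x \<in> \<Phi> A" by eventually_elim blast
  qed
qed

lemma AE_UN:
  fixes A :: "'i::countable \<Rightarrow> 'a set"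
  assumes "\<And>i. A i \<in> sets M" "\<And>i. A i \<subseteq> D'"
  shows "AE x in M. x \<in> \<Phi> (\<Union>i. A i) \<longleftrightarrow> (\<exists>i. x \<in> \<Phi> (A i))"
proof -
  have U: "(\<Union>i. A i) \<in> sets M" "(\<Union>i. A i) \<subseteq> D'" using assms by auto
  have \<Phi>A: "\<And>i. \<Phi> (A i) \<in> sets M" "\<And>i. \<Phi> (A i) \<subseteq> D" using \<Phi>[OF assms] by auto
  have W: "(\<Union>i. \<Phi> (A i)) \<in> sets M" "(\<Union>i. \<Phi> (A i)) \<subseteq> D" using \<Phi>A by auto
  have "AE x in M. \<forall>i. x \<in> \<Phi> (A i) \<longrightarrow> x \<in> \<Phi> (\<Union>i. A i)"
    unfolding AE_all_countable by (intro allI AE_mono assms U AE_I2) blast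
  moreover have "AE x in M. \<forall>i. x \<in> A i \<longrightarrow> x \<in> \<Phi>' (\<Union>i. \<Phi> (A i))"
    unfolding AE_all_countable galois(1)[OF assms W, symmetric] by (intro allI AE_I2) blast
  then have "AE x in M. x \<in> (\<Union>i. A i) \<longrightarrow> x \<in> \<Phi>' (\<Union>i. \<Phi> (A i))" by eventually_elim blast
  then have "AE x in M. x \<in> \<Phi> (\<Union>i. A i) \<longrightarrow> x \<in> (\<Union>i. \<Phi> (A i))" unfolding galois(1)[OF U W] .
  ultimately show ?thesis by eventually_elim blast
qed

lemma AE_Un:
  assumes "A \<in> sets M" "A \<subseteq> D'" "B \<in> sets M" "B \<subseteq> D'"
  shows "AE x in M. x \<in> \<Phi> (A \<union> B) \<longleftrightarrow> x \<in> \<Phi> A \<or> x \<in> \<Phi> B"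
proof -
  have "(\<Union>b::bool. if b then A else B) = A \<union> B" by auto
  then show ?thesis using AE_UN[of "\<lambda>b::bool. if b then A else B"] assms
    by (auto simp: ex_bool_eq elim!: eventually_mono)
qed

lemma AE_Int:
  assumes "A \<in> sets M" "A \<subseteq> D'" "B \<in> sets M" "B \<subseteq> D'"
  shows "AE x in M. x \<in> \<Phi> (A \<inter> B) \<longleftrightarrow> x \<in> \<Phi> A \<and> x \<in> \<Phi> B"
proof -
  have I: "A \<inter> B \<in> sets M" "A \<inter> B \<subseteq> D'" using assms by auto
  have W: "\<Phi> A \<inter> \<Phi> B \<in> sets M" "\<Phi> A \<inter> \<Phi> B \<subseteq> D" using \<Phi>[OF assms(1,2)] \<Phi>[OF assms(3,4)] by auto
  have "AE x in M. x \<in> \<Phi> (A \<inter> B) \<longrightarrow> x \<in> \<Phi> A" "AE x in M. x \<in> \<Phi> (A \<inter> B) \<longrightarrow> x \<in> \<Phi> B"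
    by (intro AE_mono assms I AE_I2; blast)+
  moreover have "AE x in M. x \<in> \<Phi>' (\<Phi> A \<inter> \<Phi> B) \<longrightarrow> x \<in> A" "AE x in M. x \<in> \<Phi>' (\<Phi> A \<inter> \<Phi> B) \<longrightarrow> x \<in> B"
    using galois(2)[OF assms(1,2) W] galois(2)[OF assms(3,4) W] by simp_all
  then have "AE x in M. x \<in> \<Phi>' (\<Phi> A \<inter> \<Phi> B) \<longrightarrow> x \<in> A \<inter> B" by eventually_elim blast
  then have "AE x in M. x \<in> \<Phi> A \<inter> \<Phi> B \<longrightarrow> x \<in> \<Phi> (A \<inter> B)" unfolding galois(2)[OF I W] .
  ultimately show ?thesis by eventually_elim blast
qed

lemma AE_empty: "AE x in M. x \<notin> \<Phi> {}"
proof -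
  have "AE x in M. x \<in> \<Phi> {} \<longrightarrow> x \<in> {}" by (subst galois(1)) (auto intro: AE_I2)
  then show ?thesis by simp
qed

lemma AE_full: "AE x in M. x \<in> \<Phi> D' \<longleftrightarrow> x \<in> D"
proof -
  have "AE x in M. x \<in> D \<longrightarrow> x \<in> \<Phi> D'" by (subst galois(2)) (use \<Phi>'[of D] D D' in \<open>auto intro!: AE_I2\<close>)
  then show ?thesis using \<Phi>[of D'] D' by (auto elim!: eventually_mono)
qed

lemma AE_compl:
  assumes "A \<in> sets M" "A \<subseteq> D'"
  shows "AE x in M. x \<in> \<Phi> (D' - A) \<longleftrightarrow> x \<in> D \<and> x \<notin> \<Phi> A"
proof -
  have C: "D' - A \<in> sets M" "D' - A \<subseteq> D'" using assms D' by auto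
  have e: "A \<union> (D' - A) = D'" "A \<inter> (D' - A) = {}" using assms by auto
  show ?thesis using AE_Un[OF assms C, unfolded e] AE_Int[OF assms C, unfolded e] AE_empty AE_full
    by eventually_elim blast
qed

lemma null_iff:
  assumes "A \<in> sets M" "A \<subseteq> D'"
  shows "(AE x in M. x \<notin> \<Phi> A) \<longleftrightarrow> (AE x in M. x \<notin> A)"
proof -
  interpret i: set_iso M D' D \<Phi>' \<Phi> by (rule inverse_iso)
  have E: "\<Phi>' {} \<in> sets M" "\<Phi>' {} \<subseteq> D'" using \<Phi>'[of "{}"] by auto
  have "(AE x in M. x \<notin> \<Phi> A) \<longleftrightarrow> (AE x in M. x \<in> \<Phi> A \<longrightarrow> x \<in> {})" by simp
  also have "\<dots> \<longleftrightarrow> (AE x in M. x \<in> A \<longrightarrow> x \<in> \<Phi>' {})" by (rule galois) (use assms in auto)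
  also have "\<dots> \<longleftrightarrow> (AE x in M. x \<notin> A)"
    using i.AE_empty by (intro iffI; elim AE_mp[OF i.AE_empty[THEN AE_mp]] AE_mp) (auto intro: AE_I2)
  finally show ?thesis .
qed

end

text \<open>
  From left to right, inclusion is the equation \<open>A \<union> B = B\<close> in the measure algebra and is
  therefore preserved and reflected by the isomorphism. From right to left, the isomorphism of
  classes is obtained by applying \<open>\<Phi>\<close> to an arbitrary representative.
\<close>

lemma partial_set_automorphism_iff_set_iso:
  "partial_set_automorphism M D D' \<Phi> \<Phi>' \<longleftrightarrow> set_iso M D D' \<Phi> \<Phi>'"
proof
  have res: "sets (restrict_space M E) = {A \<in> sets M. A \<subseteq> E}" if "E \<in> sets M" for E
    using that by (auto simp: sets_restrict_space_iff)
  have le_res: "le_ae (restrict_space M E) A B \<longleftrightarrow> le_ae M A B"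
    if "E \<in> sets M" "A \<subseteq> E" for E A B
    unfolding le_ae_def null_sets_restrict_space[OF that(1)] using that by auto
  have car: "bcarrier (measure_algebra N) = set_class N ` sets N" for N :: "'a measure"
    by (simp add: measure_algebra_def)
  { assume ps: "partial_set_automorphism M D D' \<Phi> \<Phi>'"
    let ?R = "restrict_space M D" and ?R' = "restrict_space M D'"
    let ?A = "measure_algebra ?R" and ?A' = "measure_algebra ?R'"
    from ps obtain h where D: "D \<in> sets M" "D' \<in> sets M"
      and \<Phi>: "\<And>C. C \<in> sets ?R' \<Longrightarrow> \<Phi> C \<in> sets ?R" and \<Phi>': "\<And>C. C \<in> sets ?R \<Longrightarrow> \<Phi>' C \<in> sets ?R'"
      and h: "balgebra_iso ?A' ?A h"
      and h1: "\<And>C. C \<in> sets ?R' \<Longrightarrow> h (set_class ?R' C) = set_class ?R (\<Phi> C)"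
      and h2: "\<And>C. C \<in> sets ?R \<Longrightarrow> inv_into (bcarrier ?A') h (set_class ?R C) = set_class ?R' (\<Phi>' C)"
      unfolding partial_set_automorphism_def by (auto simp: Pi_iff)
    have bij: "bij_betw h (bcarrier ?A') (bcarrier ?A)"
      and join: "\<And>x y. x \<in> bcarrier ?A' \<Longrightarrow> y \<in> bcarrier ?A' \<Longrightarrow> h (bjoin ?A' x y) = bjoin ?A (h x) (h y)"
      using h by (auto simp: balgebra_iso_def)
    have cl: "set_class ?R' C \<in> bcarrier ?A'" if "C \<in> sets ?R'" for C using that by (simp add: car)
    have le: "le_ae ?R' A B \<longleftrightarrow> le_ae ?R (\<Phi> A) (\<Phi> B)" if AB: "A \<in> sets ?R'" "B \<in> sets ?R'" for A B
    proof -
      have "le_ae ?R' A B \<longleftrightarrow> set_class ?R' (A \<union> B) = set_class ?R' B"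
        using AB by (simp add: ble_class[symmetric] ble_def bjoin_class)
      also have "\<dots> \<longleftrightarrow> h (set_class ?R' (A \<union> B)) = h (set_class ?R' B)"
        using AB bij by (auto simp: bij_betw_def inj_on_eq_iff cl)
      also have "h (set_class ?R' (A \<union> B)) = bjoin ?A (h (set_class ?R' A)) (h (set_class ?R' B))"
        using AB by (simp add: bjoin_class[symmetric] join cl)
      also have "(\<dots> = h (set_class ?R' B)) \<longleftrightarrow> le_ae ?R (\<Phi> A) (\<Phi> B)"
        using AB \<Phi> by (simp add: h1 ble_def[symmetric] ble_class)
      finally show ?thesis .
    qed
    have eq: "eq_ae ?R A B \<longleftrightarrow> set_class ?R A = set_class ?R B" if "A \<in> sets ?R" "B \<in> sets ?R" for A B
      using that by (simp add: eq_ae_def set_class_eq_iff sym_diff_null_iff)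
    have eq': "eq_ae ?R' A B \<longleftrightarrow> set_class ?R' A = set_class ?R' B" if "A \<in> sets ?R'" "B \<in> sets ?R'" for A B
      using that by (simp add: eq_ae_def set_class_eq_iff sym_diff_null_iff)
    have i: "eq_ae ?R (\<Phi> (\<Phi>' C)) C" if C: "C \<in> sets ?R" for C
    proof -
      have "set_class ?R C \<in> h ` bcarrier ?A'" using C bij by (auto simp: bij_betw_def car)
      then have "set_class ?R (\<Phi> (\<Phi>' C)) = set_class ?R C"
        using h1[OF \<Phi>'[OF C]] h2[OF C] f_inv_into_f[of "set_class ?R C" h "bcarrier ?A'"] by simp
      then show ?thesis using C \<Phi> \<Phi>' by (simp add: eq)
    qed
    have i': "eq_ae ?R' (\<Phi>' (\<Phi> C)) C" if C: "C \<in> sets ?R'" for C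
      using i[OF \<Phi>[OF C]] C \<Phi> \<Phi>' by (simp add: eq_ae_def le)
    have le': "le_ae ?R' (\<Phi>' A) (\<Phi>' B)" if "A \<in> sets ?R" "B \<in> sets ?R" "le_ae ?R A B" for A B
      using that i[OF that(1)] i[OF that(2)] \<Phi> \<Phi>' unfolding eq_ae_def le[OF \<Phi>'[OF that(1)] \<Phi>'[OF that(2)]]
      by (meson le_ae_trans)
    note r = res[OF D(1)] res[OF D(2)]
    show "set_iso M D D' \<Phi> \<Phi>'"
    proof
      show "\<Phi> A \<in> sets M \<and> \<Phi> A \<subseteq> D" if "A \<in> sets M" "A \<subseteq> D'" for A using \<Phi>[of A] that unfolding r by blast
      show "\<Phi>' A \<in> sets M \<and> \<Phi>' A \<subseteq> D'" if "A \<in> sets M" "A \<subseteq> D" for A using \<Phi>'[of A] that unfolding r by blast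
      show "le_ae M (\<Phi> A) (\<Phi> B)" if "A \<in> sets M" "A \<subseteq> D'" "B \<in> sets M" "B \<subseteq> D'" "le_ae M A B" for A B
        using le[of A B] \<Phi>[of A] that D by (simp add: r le_res)
      show "le_ae M (\<Phi>' A) (\<Phi>' B)" if "A \<in> sets M" "A \<subseteq> D" "B \<in> sets M" "B \<subseteq> D" "le_ae M A B" for A B
        using le'[of A B] \<Phi>'[of A] that D by (simp add: r le_res)
      show "eq_ae M (\<Phi>' (\<Phi> A)) A" if "A \<in> sets M" "A \<subseteq> D'" for A
        using i'[of A] \<Phi>[of A] \<Phi>'[of "\<Phi> A"] that D by (simp add: r eq_ae_def le_res)
      show "eq_ae M (\<Phi> (\<Phi>' A)) A" if "A \<in> sets M" "A \<subseteq> D" for A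
        using i[of A] \<Phi>'[of A] \<Phi>[of "\<Phi>' A"] that D by (simp add: r eq_ae_def le_res)
    qed (use D in auto) }
  { assume "set_iso M D D' \<Phi> \<Phi>'"
    then interpret set_iso M D D' \<Phi> \<Phi>' .
    let ?R = "restrict_space M D" and ?R' = "restrict_space M D'"
    let ?A = "measure_algebra ?R" and ?A' = "measure_algebra ?R'"
    note r = res[OF D] res[OF D']
    have eq: "set_class ?R A = set_class ?R B \<longleftrightarrow> (AE x in M. x \<in> A \<longleftrightarrow> x \<in> B)" if "A \<in> sets ?R" "B \<in> sets ?R" for A B
      using that D by (simp add: set_class_eq_iff sym_diff_null_iff r le_res eq_ae_def[symmetric] eq_ae_AE)
    have eq': "set_class ?R' A = set_class ?R' B \<longleftrightarrow> (AE x in M. x \<in> A \<longleftrightarrow> x \<in> B)" if "A \<in> sets ?R'" "B \<in> sets ?R'" for A B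
      using that D' by (simp add: set_class_eq_iff sym_diff_null_iff r le_res eq_ae_def[symmetric] eq_ae_AE)
    have \<Phi>r: "\<Phi> C \<in> sets ?R" if "C \<in> sets ?R'" for C using \<Phi>[of C] that unfolding r by blast
    have \<Phi>r': "\<Phi>' C \<in> sets ?R'" if "C \<in> sets ?R" for C using \<Phi>'[of C] that unfolding r by blast
    define h where "h X = set_class ?R (\<Phi> (SOME C. C \<in> sets ?R' \<and> set_class ?R' C = X))" for X
    have h: "h (set_class ?R' C) = set_class ?R (\<Phi> C)" if C: "C \<in> sets ?R'" for C
    proof -
      define C' where "C' = (SOME C'. C' \<in> sets ?R' \<and> set_class ?R' C' = set_class ?R' C)"
      have C': "C' \<in> sets ?R'" "set_class ?R' C' = set_class ?R' C"
        using someI[of "\<lambda>C'. C' \<in> sets ?R' \<and> set_class ?R' C' = set_class ?R' C" C] C by (auto simp: C'_def)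
      have "AE x in M. x \<in> \<Phi> C' \<longleftrightarrow> x \<in> \<Phi> C"
        by (rule AE_cong) (use C' C eq'[OF C'(1) C] in \<open>auto simp: r\<close>)
      then show ?thesis unfolding h_def C'_def[symmetric] using C C' \<Phi>r by (simp add: eq)
    qed
    have inj: "inj_on h (bcarrier ?A')"
    proof (rule inj_onI)
      fix X Y assume "X \<in> bcarrier ?A'" "Y \<in> bcarrier ?A'" and hXY: "h X = h Y"
      then obtain A B where AB: "A \<in> sets ?R'" "B \<in> sets ?R'" "X = set_class ?R' A" "Y = set_class ?R' B"
        by (auto simp: car)
      then have e: "AE x in M. x \<in> \<Phi> A \<longleftrightarrow> x \<in> \<Phi> B" using hXY \<Phi>r by (simp add: h eq)
      have "AE x in M. x \<in> \<Phi>' (\<Phi> A) \<longleftrightarrow> x \<in> \<Phi>' (\<Phi> B)"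
        by (rule set_iso.AE_cong[OF inverse_iso _ _ _ _ e]) (use AB \<Phi> in \<open>auto simp: r\<close>)
      moreover have "AE x in M. x \<in> \<Phi>' (\<Phi> A) \<longleftrightarrow> x \<in> A" "AE x in M. x \<in> \<Phi>' (\<Phi> B) \<longleftrightarrow> x \<in> B"
        using AB by (auto simp: r intro!: AE_inv')
      ultimately have "AE x in M. x \<in> A \<longleftrightarrow> x \<in> B" by eventually_elim blast
      then show "X = Y" using AB by (simp add: eq')
    qed
    have hinv: "h (set_class ?R' (\<Phi>' C)) = set_class ?R C" if "C \<in> sets ?R" for C
      using that \<Phi>r \<Phi>r' AE_inv[of C] by (simp add: h eq) (simp add: r)
    have surj: "h ` bcarrier ?A' = bcarrier ?A"
    proof
      show "h ` bcarrier ?A' \<subseteq> bcarrier ?A" using \<Phi>r by (auto simp: car h)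
      show "bcarrier ?A \<subseteq> h ` bcarrier ?A'"
      proof
        fix Y assume "Y \<in> bcarrier ?A"
        then obtain C where C: "C \<in> sets ?R" "Y = set_class ?R C" by (auto simp: car)
        then have "Y = h (set_class ?R' (\<Phi>' C))" by (simp add: hinv)
        then show "Y \<in> h ` bcarrier ?A'" using C \<Phi>r' by (auto simp: car)
      qed
    qed
    have iso: "balgebra_iso ?A' ?A h"
      unfolding balgebra_iso_def
    proof (intro conjI ballI)
      show "bij_betw h (bcarrier ?A') (bcarrier ?A)" using inj surj by (simp add: bij_betw_def)
      fix X Y assume "X \<in> bcarrier ?A'" "Y \<in> bcarrier ?A'"
      then obtain A B where AB: "A \<in> sets ?R'" "B \<in> sets ?R'" "X = set_class ?R' A" "Y = set_class ?R' B"
        by (auto simp: car)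
      note u = AE_Un[of A B] AE_Int[of A B]
      have \<Phi>AB: "\<Phi> A \<in> sets ?R" "\<Phi> B \<in> sets ?R" "\<Phi> (A \<union> B) \<in> sets ?R" "\<Phi> (A \<inter> B) \<in> sets ?R"
        using AB \<Phi>r by auto
      show "h (bjoin ?A' X Y) = bjoin ?A (h X) (h Y)"
        using AB \<Phi>AB u by (simp add: bjoin_class h eq) (simp add: r)
      show "h (bmeet ?A' X Y) = bmeet ?A (h X) (h Y)"
        using AB \<Phi>AB u by (simp add: bmeet_class h eq) (simp add: r)
    next
      fix X assume "X \<in> bcarrier ?A'"
      then obtain A where A: "A \<in> sets ?R'" "X = set_class ?R' A" by (auto simp: car)
      have c: "D' - A \<in> sets ?R'" "D - \<Phi> A \<in> sets ?R" using A \<Phi>r[of A] D D' by (auto simp: r)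
      have "h (set_class ?R' (D' - A)) = set_class ?R (D - \<Phi> A)"
        using c \<Phi>r[OF c(1)] AE_compl[of A] A by (simp add: h eq) (simp add: r)
      then show "h (bcompl ?A' X) = bcompl ?A (h X)"
        using A \<Phi>r[of A] D D' by (simp add: bcompl_class[OF A(1) A(1)] bcompl_class[of "\<Phi> A" _ "\<Phi> A"] h)
    qed
    show "partial_set_automorphism M D D' \<Phi> \<Phi>'"
      unfolding partial_set_automorphism_def
    proof (intro conjI exI[of _ h] ballI iso h)
      fix C assume C: "C \<in> sets ?R"
      have "set_class ?R' (\<Phi>' C) \<in> bcarrier ?A'" using \<Phi>r'[OF C] by (simp add: car)
      then show "inv_into (bcarrier ?A') h (set_class ?R C) = set_class ?R' (\<Phi>' C)"
        using inv_into_f_f[OF inj, of "set_class ?R' (\<Phi>' C)"] hinv[OF C] by simp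
    qed (use D D' \<Phi>r \<Phi>r' in auto) }
qed

section \<open>Transport of functions along an isomorphism\<close>

context set_iso begin

text \<open>
  \<open>rel f g\<close> means that \<open>g\<close> is a representative of \<open>T\<^sub>\<Phi> f\<close>. Describing this by preimages of Borel
  sets rather than by a formula for \<open>g\<close> makes it symmetric in \<open>\<Phi>\<close> and \<open>\<Phi>'\<close> and easy to combine
  with Borel operations.
\<close>

definition rel :: "('a \<Rightarrow> 'k::{real_normed_field,euclidean_space}) \<Rightarrow> ('a \<Rightarrow> 'k) \<Rightarrow> bool" where
  "rel f g \<longleftrightarrow> f \<in> borel_measurable M \<and> g \<in> borel_measurable M \<and> (AE x in M. x \<notin> D \<longrightarrow> g x = 0) \<and>
     (\<forall>U\<in>sets borel. AE x in M. x \<in> \<Phi> {x \<in> D'. f x \<in> U} \<longleftrightarrow> x \<in> D \<and> g x \<in> U)"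

lemma vimage_sets:
  assumes "f \<in> M \<rightarrow>\<^sub>M N" "X \<in> sets N"
  shows "{x \<in> D'. f x \<in> X} \<in> sets M"
proof -
  have "{x \<in> D'. f x \<in> X} = D' \<inter> (f -` X \<inter> space M)" using sets.sets_into_space[OF D'] by auto
  then show ?thesis using assms D' by (auto intro: measurable_sets)
qed

text \<open>
  The sets \<open>X\<close> with this property form a \<open>\<sigma>\<close>-algebra, because \<open>\<Phi>\<close> preserves complements and
  countable unions, and it contains the sets that restrict a single coordinate.
\<close>

lemma rel_joint:
  fixes f g :: "'i \<Rightarrow> 'a \<Rightarrow> 'k::{real_normed_field,euclidean_space}"
  assumes rel: "\<And>i. rel (f i) (g i)" and X: "X \<in> sets (Pi\<^sub>M UNIV (\<lambda>_::'i. borel))"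
  shows "AE x in M. x \<in> \<Phi> {x \<in> D'. (\<lambda>i. f i x) \<in> X} \<longleftrightarrow> x \<in> D \<and> (\<lambda>i. g i x) \<in> X"
proof -
  have m: "(\<lambda>x i. f i x) \<in> M \<rightarrow>\<^sub>M Pi\<^sub>M UNIV (\<lambda>_::'i. borel)"
    by (rule measurable_abs_UNIV) (use rel in \<open>simp add: rel_def\<close>)
  let ?G = "{{s \<in> \<Pi>\<^sub>E i\<in>UNIV. space (borel :: 'k measure). s i \<in> A} | i A. i \<in> (UNIV :: 'i set) \<and> A \<in> sets (borel :: 'k measure)}"
  have eq: "sets (Pi\<^sub>M UNIV (\<lambda>_::'i. borel :: 'k measure)) = sigma_sets (\<Pi>\<^sub>E i\<in>UNIV. space borel) ?G"
    by (rule sets_PiM_single)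
  have S: "{x \<in> D'. (\<lambda>i. f i x) \<in> Y} \<in> sets M" if "Y \<in> sigma_sets (\<Pi>\<^sub>E i\<in>UNIV. space borel) ?G" for Y
    using vimage_sets[OF m, of Y] that unfolding eq by blast
  show ?thesis
    using X unfolding eq
  proof (induction rule: sigma_sets.induct)
    case (Basic Y)
    then obtain i A where "A \<in> sets borel" "Y = {s. s i \<in> A}" by auto
    then show ?case using rel[of i] by (simp add: rel_def)
  next
    case Empty
    show ?case using AE_empty by simp
  next
    case (Compl Y)
    have e: "{x \<in> D'. (\<lambda>i. f i x) \<in> (\<Pi>\<^sub>E i\<in>UNIV. space borel) - Y} = D' - {x \<in> D'. (\<lambda>i. f i x) \<in> Y}"
      by auto
    have "AE x in M. x \<in> \<Phi> (D' - {x \<in> D'. (\<lambda>i. f i x) \<in> Y}) \<longleftrightarrow> x \<in> D \<and> x \<notin> \<Phi> {x \<in> D'. (\<lambda>i. f i x) \<in> Y}"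
      by (rule AE_compl) (use S[OF Compl.hyps] in auto)
    with Compl.IH show ?case unfolding e by eventually_elim auto
  next
    case (Union Y)
    have e: "{x \<in> D'. (\<lambda>i. f i x) \<in> (\<Union>n. Y n)} = (\<Union>n. {x \<in> D'. (\<lambda>i. f i x) \<in> Y n})"
      by auto
    have "AE x in M. x \<in> \<Phi> (\<Union>n. {x \<in> D'. (\<lambda>i. f i x) \<in> Y n}) \<longleftrightarrow> (\<exists>n. x \<in> \<Phi> {x \<in> D'. (\<lambda>i. f i x) \<in> Y n})"
      by (rule AE_UN) (use S[OF Union.hyps] in auto)
    moreover have "AE x in M. \<forall>n. x \<in> \<Phi> {x \<in> D'. (\<lambda>i. f i x) \<in> Y n} \<longleftrightarrow> x \<in> D \<and> (\<lambda>i. g i x) \<in> Y n"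
      unfolding AE_all_countable using Union.IH by blast
    ultimately show ?case unfolding e by eventually_elim auto
  qed
qed

text \<open>
  The exceptional sets correspond to each other under \<open>\<Phi>\<close>, which preserves null sets in both
  directions.
\<close>

lemma rel_AE:
  fixes f g :: "'i \<Rightarrow> 'a \<Rightarrow> 'k::{real_normed_field,euclidean_space}"
  assumes rel: "\<And>i. rel (f i) (g i)" and X: "Measurable.pred (Pi\<^sub>M UNIV (\<lambda>_::'i. borel)) X"
  shows "(AE x in M. x \<in> D' \<longrightarrow> X (\<lambda>i. f i x)) \<longleftrightarrow> (AE x in M. x \<in> D \<longrightarrow> X (\<lambda>i. g i x))"
proof -
  let ?X = "{s \<in> space (Pi\<^sub>M UNIV (\<lambda>_::'i. borel :: 'k measure)). \<not> X s}"
  have sp: "space (Pi\<^sub>M UNIV (\<lambda>_::'i. borel :: 'k measure)) = UNIV" by (simp add: space_PiM)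
  have Xs: "?X \<in> sets (Pi\<^sub>M UNIV (\<lambda>_. borel))" using X by measurable
  have m: "(\<lambda>x i. f i x) \<in> M \<rightarrow>\<^sub>M Pi\<^sub>M UNIV (\<lambda>_::'i. borel)"
    by (rule measurable_abs_UNIV) (use rel in \<open>simp add: rel_def\<close>)
  let ?A = "{x \<in> D'. (\<lambda>i. f i x) \<in> ?X}"
  have j: "AE x in M. x \<in> \<Phi> ?A \<longleftrightarrow> x \<in> D \<and> (\<lambda>i. g i x) \<in> ?X" by (rule rel_joint[OF rel Xs])
  have "(AE x in M. x \<in> D' \<longrightarrow> X (\<lambda>i. f i x)) \<longleftrightarrow> (AE x in M. x \<notin> ?A)" by (simp add: sp)
  also have "\<dots> \<longleftrightarrow> (AE x in M. x \<notin> \<Phi> ?A)"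
    by (rule null_iff[symmetric, OF vimage_sets[OF m Xs]]) auto
  also have "\<dots> \<longleftrightarrow> (AE x in M. x \<in> D \<longrightarrow> X (\<lambda>i. g i x))"
    by (rule eventually_subst) (use j in \<open>eventually_elim, auto simp: sp\<close>)
  finally show ?thesis .
qed

text \<open>
  Every Borel operation on families of functions commutes with the transport; sums, multiples
  and limits of sequences are the cases of interest.
\<close>

lemma rel_map:
  fixes f g :: "'i \<Rightarrow> 'a \<Rightarrow> 'k::{real_normed_field,euclidean_space}" and h :: "('i \<Rightarrow> 'k) \<Rightarrow> 'k"
  assumes rel: "\<And>i. rel (f i) (g i)" and h: "h \<in> borel_measurable (Pi\<^sub>M UNIV (\<lambda>_::'i. borel :: 'k measure))"
    and f': "\<And>x. x \<in> D' \<Longrightarrow> f' x = h (\<lambda>i. f i x)" "f' \<in> borel_measurable M"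
    and g': "AE x in M. x \<in> D \<longrightarrow> g' x = h (\<lambda>i. g i x)" "AE x in M. x \<notin> D \<longrightarrow> g' x = 0" "g' \<in> borel_measurable M"
  shows "rel f' g'"
  unfolding rel_def
proof (intro conjI ballI f' g')
  fix U :: "'k set" assume U: "U \<in> sets borel"
  let ?X = "h -` U \<inter> space (Pi\<^sub>M UNIV (\<lambda>_::'i. borel :: 'k measure))"
  have X: "?X \<in> sets (Pi\<^sub>M UNIV (\<lambda>_. borel))" using h U by (rule measurable_sets)
  have sp: "space (Pi\<^sub>M UNIV (\<lambda>_::'i. borel :: 'k measure)) = UNIV" by (simp add: space_PiM)
  have "{x \<in> D'. f' x \<in> U} = {x \<in> D'. (\<lambda>i. f i x) \<in> ?X}" using f' by (auto simp: sp)
  then have "AE x in M. x \<in> \<Phi> {x \<in> D'. f' x \<in> U} \<longleftrightarrow> x \<in> D \<and> (\<lambda>i. g i x) \<in> ?X"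
    using rel_joint[where f = f and g = g, OF rel X] by simp
  with g'(1) show "AE x in M. x \<in> \<Phi> {x \<in> D'. f' x \<in> U} \<longleftrightarrow> x \<in> D \<and> g' x \<in> U"
    by eventually_elim (auto simp: sp)
qed

lemma rel_measurable: "rel f g \<Longrightarrow> f \<in> borel_measurable M" "rel f g \<Longrightarrow> g \<in> borel_measurable M"
  and rel_off: "rel f g \<Longrightarrow> AE x in M. x \<notin> D \<longrightarrow> g x = 0"
  by (auto simp: rel_def)

lemma rel_add:
  fixes f g :: "'a \<Rightarrow> 'k::{real_normed_field,euclidean_space}"
  assumes "rel f g" "rel f' g'"
  shows "rel (\<lambda>x. f x + f' x) (\<lambda>x. g x + g' x)"
proof (rule rel_map[where f = "\<lambda>b. if b then f else f'" and g = "\<lambda>b. if b then g else g'" and h = "\<lambda>s. s True + s False"])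
  show "AE x in M. x \<notin> D \<longrightarrow> g x + g' x = 0"
    using rel_off[OF assms(1)] rel_off[OF assms(2)] by eventually_elim simp
qed (use assms in \<open>auto simp: rel_def\<close>)

lemma rel_scale:
  fixes f g :: "'a \<Rightarrow> 'k::{real_normed_field,euclidean_space}"
  assumes "rel f g"
  shows "rel (\<lambda>x. c * f x) (\<lambda>x. c * g x)"
proof (rule rel_map[where f = "\<lambda>_::unit. f" and g = "\<lambda>_. g" and h = "\<lambda>s. c * s ()"])
  show "AE x in M. x \<notin> D \<longrightarrow> c * g x = 0"
    using rel_off[OF assms(1)] by eventually_elim simp
qed (use assms in \<open>auto simp: rel_def\<close>)

lemma rel_unique:
  fixes f g :: "'a \<Rightarrow> 'k::{real_normed_field,euclidean_space}"
  assumes "rel f g" "rel f' g'" and "AE x in M. x \<in> D' \<longrightarrow> f x = f' x"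
  shows "AE x in M. g x = g' x"
proof -
  have [measurable]: "(\<lambda>s. s b) \<in> borel_measurable (Pi\<^sub>M UNIV (\<lambda>_::bool. borel :: 'k measure))" for b
    by (rule measurable_component_singleton) simp
  have "Measurable.pred (Pi\<^sub>M UNIV (\<lambda>_::bool. borel :: 'k measure)) (\<lambda>s. s True = s False)"
    unfolding pred_def by (rule measurable_equality_set) measurable
  moreover have "rel (if b then f else f') (if b then g else g')" for b using assms by simp
  ultimately have "AE x in M. x \<in> D \<longrightarrow> g x = g' x"
    using rel_AE[of "\<lambda>b. if b then f else f'" "\<lambda>b. if b then g else g'" "\<lambda>s. s True = s False"] assms
    by simp
  with rel_off[OF assms(1)] rel_off[OF assms(2)] show ?thesis by eventually_elim metis
qed

lemma rel_indicator:
  assumes "C \<in> sets M"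
  shows "rel (indicator C :: 'a \<Rightarrow> 'k::{real_normed_field,euclidean_space}) (indicator (\<Phi> (C \<inter> D')))"
  unfolding rel_def
proof (intro conjI ballI)
  have C: "C \<inter> D' \<in> sets M" "C \<inter> D' \<subseteq> D'" using assms by auto
  note \<Phi>C = \<Phi>[OF C]
  show "(indicator C :: 'a \<Rightarrow> 'k) \<in> borel_measurable M" using assms by simp
  show "(indicator (\<Phi> (C \<inter> D')) :: 'a \<Rightarrow> 'k) \<in> borel_measurable M"
    using \<Phi>C by (intro borel_measurable_indicator) auto
  show "AE x in M. x \<notin> D \<longrightarrow> (indicator (\<Phi> (C \<inter> D')) x :: 'k) = 0"
    using \<Phi>C by (auto simp: indicator_def)
  fix U :: "'k set"
  have c: "AE x in M. x \<in> \<Phi> (D' - (C \<inter> D')) \<longleftrightarrow> x \<in> D \<and> x \<notin> \<Phi> (C \<inter> D')" by (rule AE_compl[OF C])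
  have "{x \<in> D'. (indicator C x :: 'k) \<in> U} =
      (if 1 \<in> U then if 0 \<in> U then D' else C \<inter> D' else if 0 \<in> U then D' - (C \<inter> D') else {})"
    by (auto simp: indicator_def split: if_splits)
  then show "AE x in M. x \<in> \<Phi> {x \<in> D'. (indicator C x :: 'k) \<in> U} \<longleftrightarrow>
      x \<in> D \<and> (indicator (\<Phi> (C \<inter> D')) x :: 'k) \<in> U"
    using c AE_full AE_empty \<Phi>C by (auto simp: indicator_def elim!: eventually_mono)
qed

lemma rel_zero: "rel (\<lambda>x. 0 :: 'k::{real_normed_field,euclidean_space}) (\<lambda>x. 0)"
  using rel_scale[OF rel_indicator[OF D], of 0] by simp

lemma rel_sum:
  assumes "finite Y" "\<And>y. y \<in> Y \<Longrightarrow> rel (f y) (g y :: 'a \<Rightarrow> 'k::{real_normed_field,euclidean_space})"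
  shows "rel (\<lambda>x. \<Sum>y\<in>Y. f y x) (\<lambda>x. \<Sum>y\<in>Y. g y x)"
  using assms by (induction Y rule: finite_induct) (auto intro: rel_zero rel_add)

text \<open>
  Convergence is a measurable property of the sequence that consists of the limit, at index \<open>0\<close>,
  and of the given functions, shifted by one.
\<close>

lemma rel_limit:
  fixes f g :: "nat \<Rightarrow> 'a \<Rightarrow> 'k::{real_normed_field,euclidean_space}"
  assumes "\<And>n. rel (f n) (g n)" "rel f' g'" "AE x in M. x \<in> D' \<longrightarrow> (\<lambda>n. f n x) \<longlonglongrightarrow> f' x"
  shows "AE x in M. (\<lambda>n. g n x) \<longlonglongrightarrow> g' x"
proof -
  have [measurable]: "Measurable.pred (Pi\<^sub>M UNIV (\<lambda>_::nat. borel :: 'k measure)) (\<lambda>s. (\<lambda>n. s (Suc n)) \<longlonglongrightarrow> s 0)"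
  proof -
    have comp [measurable]: "(\<lambda>s. s n) \<in> borel_measurable (Pi\<^sub>M UNIV (\<lambda>_::nat. borel :: 'k measure))" for n
      by (rule measurable_component_singleton) simp
    have e: "(\<lambda>n. s (Suc n)) \<longlonglongrightarrow> s 0 \<longleftrightarrow> Cauchy (\<lambda>n. s (Suc n)) \<and> lim (\<lambda>n. s (Suc n)) = s 0" for s :: "nat \<Rightarrow> 'k"
      using convergent_eq_Cauchy[of "\<lambda>n. s (Suc n)"] by (auto simp: limI dest: LIMSEQ_imp_Cauchy)
    have [measurable]: "Measurable.pred (Pi\<^sub>M UNIV (\<lambda>_::nat. borel :: 'k measure)) (\<lambda>s. Cauchy (\<lambda>n. s (Suc n)))"
      unfolding pred_def by (rule sets_Collect_Cauchy) measurable
    have [measurable]: "Measurable.pred (Pi\<^sub>M UNIV (\<lambda>_::nat. borel :: 'k measure)) (\<lambda>s. lim (\<lambda>n. s (Suc n)) = s 0)"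
      unfolding pred_def by (rule measurable_equality_set) measurable
    show ?thesis unfolding e by measurable
  qed
  have r: "rel (case n of 0 \<Rightarrow> f' | Suc n \<Rightarrow> f n) (case n of 0 \<Rightarrow> g' | Suc n \<Rightarrow> g n)" for n
    using assms by (cases n) auto
  have "AE x in M. x \<in> D \<longrightarrow> (\<lambda>n. g n x) \<longlonglongrightarrow> g' x"
    using rel_AE[where f = "\<lambda>n. case n of 0 \<Rightarrow> f' | Suc n \<Rightarrow> f n" and g = "\<lambda>n. case n of 0 \<Rightarrow> g' | Suc n \<Rightarrow> g n",
      OF r, of "\<lambda>s. (\<lambda>n. s (Suc n)) \<longlonglongrightarrow> s 0"] assms(3) by simp
  moreover have "AE x in M. \<forall>n. x \<notin> D \<longrightarrow> g n x = 0"
    unfolding AE_all_countable using rel_off[OF assms(1)] by blast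
  ultimately show ?thesis using rel_off[OF assms(2)] by eventually_elim (auto intro: tendsto_eq_intros)
qed

lemma rel_simple_approx:
  fixes f :: "'a \<Rightarrow> 'k::{real_normed_field,euclidean_space}"
  assumes "f \<in> borel_measurable M"
  obtains Y :: "nat \<Rightarrow> 'k set" and C :: "nat \<Rightarrow> 'k \<Rightarrow> 'a set" where
    "\<forall>n. finite (Y n)" "\<forall>n y. C n y \<in> sets M"
    "\<forall>x\<in>space M. (\<lambda>n. \<Sum>y\<in>Y n. y * indicator (C n y) x) \<longlonglongrightarrow> f x"
proof -
  obtain F where F: "\<And>i. simple_function M (F i)" "\<And>x. x \<in> space M \<Longrightarrow> (\<lambda>i. F i x) \<longlonglongrightarrow> f x"
    using borel_measurable_implies_sequence_metric[OF assms, of 0] by blast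
  have e: "(\<Sum>y\<in>F i ` space M. y * indicator (F i -` {y} \<inter> space M) x) = F i x" if "x \<in> space M" for i x
  proof -
    have "(\<Sum>y\<in>F i ` space M. y * indicator (F i -` {y} \<inter> space M) x) = (\<Sum>y\<in>F i ` space M. if y = F i x then y else 0)"
      using that by (intro sum.cong) (auto simp: indicator_def)
    also have "\<dots> = F i x" using that F(1)[of i] by (simp add: simple_function_def sum.delta')
    finally show ?thesis .
  qed
  show ?thesis
  proof (rule that[of "\<lambda>i. F i ` space M" "\<lambda>i y. F i -` {y} \<inter> space M"])
    show "\<forall>n. finite (F n ` space M)" using F(1) by (simp add: simple_function_def)
    show "\<forall>n y. F n -` {y} \<inter> space M \<in> sets M" using simple_functionD(2)[OF F(1)] by blast
    show "\<forall>x\<in>space M. (\<lambda>n. \<Sum>y\<in>F n ` space M. y * indicator (F n -` {y} \<inter> space M) x) \<longlonglongrightarrow> f x"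
      using F(2) by (simp add: e)
  qed
qed

lemma rel_simple:
  fixes Y :: "'k::{real_normed_field,euclidean_space} set"
  assumes "finite Y" "\<And>y. C y \<in> sets M"
  shows "rel (\<lambda>x. \<Sum>y\<in>Y. y * indicator (C y) x) (\<lambda>x. \<Sum>y\<in>Y. y * indicator (\<Phi> (C y \<inter> D')) x)"
  using assms by (intro rel_sum rel_scale rel_indicator)

text \<open>
  Images of simple functions are explicit, and the image of a limit is the limit of the images.
  Where the latter do not converge, \<open>lim\<close> returns some value, but it is a Borel function on all
  sequences.
\<close>

lemma rel_ex:
  fixes f :: "'a \<Rightarrow> 'k::{real_normed_field,euclidean_space}"
  assumes [measurable]: "f \<in> borel_measurable M"
  shows "\<exists>g. rel f g"
proof -
  obtain Y :: "nat \<Rightarrow> 'k set" and C where YC': "\<forall>n. finite (Y n)" "\<forall>n y. C n y \<in> sets M"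
    "\<forall>x\<in>space M. (\<lambda>n. \<Sum>y\<in>Y n. y * indicator (C n y) x) \<longlonglongrightarrow> f x"
    by (rule rel_simple_approx[OF assms])
  note YC = YC'[rule_format]
  define fn where "fn n x = (\<Sum>y\<in>Y n. y * indicator (C n y) x)" for n x
  define gn where "gn n x = (\<Sum>y\<in>Y n. y * indicator (\<Phi> (C n y \<inter> D')) x)" for n x
  have r: "rel (fn n) (gn n)" for n
    unfolding fn_def[abs_def] gn_def[abs_def] by (rule rel_simple) (use YC in auto)
  have [measurable]: "gn n \<in> borel_measurable M" for n using r rel_measurable by blast
  define g where "g x = (if x \<in> D then lim (\<lambda>n. gn n x) else 0)" for x
  have "rel f g"
  proof (rule rel_map[OF r, where h = "\<lambda>s. lim s"])
    show "lim \<in> borel_measurable (Pi\<^sub>M UNIV (\<lambda>_::nat. borel :: 'k measure))" by measurable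
    show "f x = lim (\<lambda>i. fn i x)" if "x \<in> D'" for x
      using YC(3)[of x] that sets.sets_into_space[OF D'] unfolding fn_def by (auto intro: limI[symmetric])
    show "g \<in> borel_measurable M" unfolding g_def by measurable
  qed (auto simp: g_def)
  then show ?thesis by blast
qed

text \<open>
  \<open>T\<^sub>\<Phi>\<close> is determined by its values on simple functions because it is sequentially continuous.
\<close>

lemma rel_is_T:
  fixes S :: "('a \<Rightarrow> 'k::{real_normed_field,euclidean_space}) set \<Rightarrow> ('a \<Rightarrow> 'k) set"
  assumes S: "is_T\<^sub>\<Phi> M D' \<Phi> S" and fg: "rel f g"
  shows "S (ae_class M f) = ae_class M g"
proof -
  have S: "S \<in> L0 M \<rightarrow> L0 M" "\<And>F G. F \<in> L0 M \<Longrightarrow> G \<in> L0 M \<Longrightarrow> S (L0_add M F G) = L0_add M (S F) (S G)"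
    "\<And>c F. F \<in> L0 M \<Longrightarrow> S (L0_scale M c F) = L0_scale M c (S F)"
    "\<And>C. C \<in> sets M \<Longrightarrow> S (ae_class M (indicator C)) = ae_class M (indicator (\<Phi> (C \<inter> D')))"
    "\<And>F G. (\<And>n. F n \<in> L0 M) \<Longrightarrow> G \<in> L0 M \<Longrightarrow> L0_tendsto M F G \<Longrightarrow> L0_tendsto M (\<lambda>n. S (F n)) (S G)"
    using S unfolding is_T\<^sub>\<Phi>_def by blast+
  have [measurable]: "f \<in> borel_measurable M" "g \<in> borel_measurable M" using fg rel_measurable by blast+
  have \<Phi>C [measurable]: "\<Phi> (C \<inter> D') \<in> sets M" if "C \<in> sets M" for C using \<Phi>[of "C \<inter> D'"] that by auto
  have simple: "S (ae_class M (\<lambda>x. \<Sum>y\<in>Y. y * indicator (C y) x)) = ae_class M (\<lambda>x. \<Sum>y\<in>Y. y * indicator (\<Phi> (C y \<inter> D')) x)"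
    if "finite Y" and [measurable]: "\<And>y. C y \<in> sets M" for Y :: "'k set" and C
    using that(1)
  proof (induction Y rule: finite_induct)
    case empty
    have "S (L0_scale M 0 (ae_class M (\<lambda>x. 0))) = L0_scale M 0 (S (ae_class M (\<lambda>x. 0)))" by (rule S) simp
    moreover have "S (ae_class M (\<lambda>x. 0)) \<in> L0 M" by (rule funcset_mem[OF S(1)]) simp
    then obtain k where "k \<in> borel_measurable M" "S (ae_class M (\<lambda>x. 0)) = ae_class M k"
      by (rule L0_E)
    ultimately show ?case by simp
  next
    case (insert y Y)
    have "S (ae_class M (\<lambda>x. \<Sum>y\<in>insert y Y. y * indicator (C y) x))
      = S (L0_add M (L0_scale M y (ae_class M (indicator (C y)))) (ae_class M (\<lambda>x. \<Sum>y\<in>Y. y * indicator (C y) x)))"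
      unfolding sum.insert[OF insert.hyps] by (simp del: sum_mult_indicator)
    also have "\<dots> = L0_add M (L0_scale M y (ae_class M (indicator (\<Phi> (C y \<inter> D')))))
        (ae_class M (\<lambda>x. \<Sum>y\<in>Y. y * indicator (\<Phi> (C y \<inter> D')) x))"
      by (subst S(2)) (simp_all add: insert.IH S(3,4) del: L0_scale_class sum_mult_indicator, simp)
    also have "\<dots> = ae_class M (\<lambda>x. \<Sum>y\<in>insert y Y. y * indicator (\<Phi> (C y \<inter> D')) x)"
      unfolding sum.insert[OF insert.hyps] by (simp del: sum_mult_indicator)
    finally show ?case .
  qed
  obtain Y :: "nat \<Rightarrow> 'k set" and C where YC': "\<forall>n. finite (Y n)" "\<forall>n y. C n y \<in> sets M"
    "\<forall>x\<in>space M. (\<lambda>n. \<Sum>y\<in>Y n. y * indicator (C n y) x) \<longlonglongrightarrow> f x"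
    by (rule rel_simple_approx[OF \<open>f \<in> borel_measurable M\<close>])
  note YC = YC'[rule_format]
  note [measurable] = YC(2)
  define fn where "fn n x = (\<Sum>y\<in>Y n. y * indicator (C n y) x)" for n x
  define gn where "gn n x = (\<Sum>y\<in>Y n. y * indicator (\<Phi> (C n y \<inter> D')) x)" for n x
  have r: "rel (fn n) (gn n)" for n
    unfolding fn_def[abs_def] gn_def[abs_def] by (rule rel_simple) (use YC in auto)
  have fg_n [measurable]: "fn n \<in> borel_measurable M" "gn n \<in> borel_measurable M" for n using r rel_measurable by blast+
  have Sfn: "S (ae_class M (fn n)) = ae_class M (gn n)" for n
    unfolding fn_def[abs_def] gn_def[abs_def] by (rule simple) (use YC in auto)
  have "L0_tendsto M (\<lambda>n. ae_class M (fn n)) (ae_class M f)"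
    unfolding L0_tendsto_def
    by (intro exI[of _ fn] exI[of _ f]) (auto intro!: ae_class_self AE_I2 YC(3) simp: fn_def[abs_def])
  then have "L0_tendsto M (\<lambda>n. S (ae_class M (fn n))) (S (ae_class M f))" by (intro S(5)) auto
  then obtain kn k where kn: "\<And>n. kn n \<in> ae_class M (gn n)" and k: "k \<in> S (ae_class M f)"
    and lim: "AE x in M. (\<lambda>n. kn n x) \<longlonglongrightarrow> k x"
    unfolding L0_tendsto_def Sfn by blast
  have "S (ae_class M f) \<in> L0 M" by (rule funcset_mem[OF S(1)]) simp
  then obtain k' where k' [measurable]: "k' \<in> borel_measurable M" and Sf: "S (ae_class M f) = ae_class M k'"
    by (rule L0_E)
  have "AE x in M. \<forall>n. gn n x = kn n x" unfolding AE_all_countable using kn by (auto simp: ae_class_def)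
  moreover have "AE x in M. (\<lambda>n. gn n x) \<longlonglongrightarrow> g x"
    by (rule rel_limit[OF r fg]) (auto intro!: AE_I2 YC(3) simp: fn_def)
  moreover have "AE x in M. k' x = k x" using k unfolding Sf by (simp add: ae_class_def)
  ultimately have "AE x in M. k' x = g x" using lim
  proof eventually_elim
    case (elim x)
    then have "(\<lambda>n. gn n x) = (\<lambda>n. kn n x)" by auto
    with elim show ?case using LIMSEQ_unique by metis
  qed
  then show ?thesis unfolding Sf by (rule ae_class_eqI)
qed

lemma ex_is_T: "\<exists>S :: ('a \<Rightarrow> 'k::{real_normed_field,euclidean_space}) set \<Rightarrow> ('a \<Rightarrow> 'k) set. is_T\<^sub>\<Phi> M D' \<Phi> S"
proof -
  define S where "S F = ae_class M (SOME g. \<exists>f\<in>F. rel f g)" for F :: "('a \<Rightarrow> 'k) set"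
  have S: "S (ae_class M f) = ae_class M g" if fg: "rel f g" for f g :: "'a \<Rightarrow> 'k"
  proof -
    have "\<exists>g. \<exists>f'\<in>ae_class M f. rel f' g" using fg ae_class_self rel_measurable by blast
    from someI_ex[OF this] obtain f' where f': "f' \<in> ae_class M f" "rel f' (SOME g. \<exists>f'\<in>ae_class M f. rel f' g)"
      by blast
    have "AE x in M. (SOME g. \<exists>f'\<in>ae_class M f. rel f' g) x = g x"
      by (rule rel_unique[OF f'(2) fg]) (use f'(1) in \<open>auto simp: ae_class_def elim!: eventually_mono\<close>)
    then show ?thesis unfolding S_def by (rule ae_class_eqI)
  qed
  have ex: "\<exists>f g. rel f g \<and> F = ae_class M f" if "F \<in> L0 M" for F :: "('a \<Rightarrow> 'k) set"
    using that by (rule L0_E) (use rel_ex in blast)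
  have "is_T\<^sub>\<Phi> M D' \<Phi> S"
    unfolding is_T\<^sub>\<Phi>_def
  proof (intro conjI ballI allI impI Pi_I)
    fix F :: "('a \<Rightarrow> 'k) set" assume F: "F \<in> L0 M"
    then obtain f g where fg: "rel f g" "F = ae_class M f" using ex by blast
    then show "S F \<in> L0 M" using S[OF fg(1)] rel_measurable(2)[OF fg(1)] by simp
    show "S (L0_scale M c F) = L0_scale M c (S F)" for c
      using fg S[OF fg(1)] S[OF rel_scale[OF fg(1), of c]] rel_measurable[OF fg(1)] by simp
    fix G :: "('a \<Rightarrow> 'k) set" assume "G \<in> L0 M"
    then obtain f' g' where fg': "rel f' g'" "G = ae_class M f'" using ex by blast
    show "S (L0_add M F G) = L0_add M (S F) (S G)"
      using fg fg' S[OF fg(1)] S[OF fg'(1)] S[OF rel_add[OF fg(1) fg'(1)]]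
        rel_measurable[OF fg(1)] rel_measurable[OF fg'(1)] by simp
  next
    fix C assume "C \<in> sets M"
    then show "S (ae_class M (indicator C)) = ae_class M (indicator (\<Phi> (C \<inter> D')))"
      by (intro S rel_indicator)
  next
    fix F G assume *: "(\<forall>n. F n \<in> L0 M) \<and> G \<in> L0 M \<and> L0_tendsto M F (G :: ('a \<Rightarrow> 'k) set)"
    then obtain f g where f: "\<And>n. f n \<in> F n" and g: "g \<in> G" and lim: "AE x in M. (\<lambda>n. f n x) \<longlonglongrightarrow> g x"
      unfolding L0_tendsto_def by blast
    have mem: "k \<in> borel_measurable M \<and> H = ae_class M k" if "k \<in> H" "H \<in> L0 M" for k and H :: "('a \<Rightarrow> 'k) set"
      using that by (auto elim!: L0_E simp: ae_class_def intro!: ae_class_eqI[unfolded ae_class_def])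
    have f': "\<And>n. f n \<in> borel_measurable M" "\<And>n. F n = ae_class M (f n)" using mem f * by blast+
    have g': "g \<in> borel_measurable M" "G = ae_class M g" using mem g * by blast+
    obtain fn where fn: "\<And>n. rel (f n) (fn n)" using rel_ex[OF f'(1)] by metis
    obtain gn where gn: "rel g gn" using rel_ex[OF g'(1)] by metis
    have "AE x in M. (\<lambda>n. fn n x) \<longlonglongrightarrow> gn x"
      by (rule rel_limit[OF fn gn]) (use lim in \<open>auto elim!: eventually_mono\<close>)
    then show "L0_tendsto M (\<lambda>n. S (F n)) (S G)"
      unfolding L0_tendsto_def f'(2) g'(2) S[OF fn] S[OF gn] using rel_measurable(2)[OF fn] rel_measurable(2)[OF gn]
      by (intro exI[of _ fn] exI[of _ gn]) (auto intro: ae_class_self)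
  qed
  then show ?thesis by blast
qed

end

section \<open>Gluing of locally defined functions\<close>

lemma SUP_rat_below: "(SUP q::rat. if of_rat q < r then ereal (of_rat q) else -\<infinity>) = ereal r"
proof (rule antisym)
  show "(SUP q::rat. if of_rat q < r then ereal (of_rat q) else -\<infinity>) \<le> ereal r"
    by (rule SUP_least) auto
  show "ereal r \<le> (SUP q::rat. if of_rat q < r then ereal (of_rat q) else -\<infinity>)"
  proof (rule dense_le)
    fix y assume y: "y < ereal r"
    obtain s where s: "y \<le> ereal s" "s < r"
    proof (cases y)
      case (real s) then show ?thesis using y that[of s] by simp
    next
      case MInf then show ?thesis using that[of "r - 1"] by simp
    qed (use y in auto)
    obtain q where q: "s < of_rat q" "of_rat q < r" using of_rat_dense[OF s(2)] by blast
    have "y \<le> ereal (of_rat q)" using s(1) q(1) by (metis ereal_less_eq(3) less_imp_le order_trans)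
    also have "\<dots> \<le> (SUP q::rat. if of_rat q < r then ereal (of_rat q) else -\<infinity>)"
      by (rule SUP_upper2[of q]) (use q in auto)
    finally show "y \<le> (SUP q::rat. if of_rat q < r then ereal (of_rat q) else -\<infinity>)" .
  qed
qed

text \<open>
  The sets \<open>{f > q}\<close> of the glued function, for rational \<open>q\<close>, are the essential suprema of the
  corresponding sets of the pieces. By compatibility, the other pieces contribute nothing to
  their intersection with \<open>A\<close>.
\<close>

lemma glue_real:
  fixes \<phi> :: "'a set \<Rightarrow> 'a \<Rightarrow> real"
  assumes loc: "localizable M" and \<A>: "\<A> \<subseteq> sets M" and \<phi>: "\<And>A. A \<in> \<A> \<Longrightarrow> \<phi> A \<in> borel_measurable M"
    and comp: "\<And>A B. A \<in> \<A> \<Longrightarrow> B \<in> \<A> \<Longrightarrow> AE x in M. x \<in> A \<inter> B \<longrightarrow> \<phi> A x = \<phi> B x"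
  shows "\<exists>f\<in>borel_measurable M. \<forall>A\<in>\<A>. AE x in M. x \<in> A \<longrightarrow> f x = \<phi> A x"
proof -
  define S where "S q = {{x \<in> A. of_rat q < \<phi> A x} | A. A \<in> \<A>}" for q
  have cut: "{x \<in> A. of_rat q < \<phi> A x} \<in> sets M" if "A \<in> \<A>" for A q
  proof -
    have A: "A \<in> sets M" using that \<A> by auto
    have "{x \<in> A. of_rat q < \<phi> A x} = A \<inter> {x \<in> space M. of_rat q < \<phi> A x}" using sets.sets_into_space[OF A] by auto
    then show ?thesis using A \<phi>[OF that] by simp
  qed
  have "\<exists>E. E \<in> sets M \<and> (\<forall>A\<in>S q. le_ae M A E) \<and> (\<forall>B\<in>sets M. (\<forall>A\<in>S q. le_ae M A B) \<longrightarrow> le_ae M E B)" for q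
  proof -
    have "S q \<subseteq> sets M" using cut by (auto simp: S_def)
    from localizable_esup[OF loc this] show ?thesis by metis
  qed
  then obtain E where E: "\<And>q. E q \<in> sets M" "\<And>q A. A \<in> S q \<Longrightarrow> le_ae M A (E q)"
    "\<And>q B. B \<in> sets M \<Longrightarrow> (\<forall>A\<in>S q. le_ae M A B) \<Longrightarrow> le_ae M (E q) B" by metis
  define f where "f x = real_of_ereal (SUP q::rat. if x \<in> E q then ereal (of_rat q) else -\<infinity>)" for x
  have "f \<in> borel_measurable M" unfolding f_def using E(1) by measurable
  moreover have "AE x in M. x \<in> A \<longrightarrow> f x = \<phi> A x" if A: "A \<in> \<A>" for A
  proof -
    have "AE x in M. x \<in> A \<longrightarrow> (x \<in> E q \<longleftrightarrow> of_rat q < \<phi> A x)" for q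
    proof -
      have c: "A - {x \<in> A. of_rat q < \<phi> A x} \<in> sets M" using cut[OF A] A \<A> by auto
      have "le_ae M (E q) (space M - (A - {x \<in> A. of_rat q < \<phi> A x}))"
      proof (rule E(3))
        show "\<forall>X\<in>S q. le_ae M X (space M - (A - {x \<in> A. of_rat q < \<phi> A x}))"
        proof
          fix X assume "X \<in> S q"
          then obtain B where B: "B \<in> \<A>" "X = {x \<in> B. of_rat q < \<phi> B x}" by (auto simp: S_def)
          have "AE x in M. x \<in> X \<longrightarrow> x \<in> space M - (A - {x \<in> A. of_rat q < \<phi> A x})"
            using comp[OF A B(1)] AE_space by eventually_elim (auto simp: B)
          then show "le_ae M X (space M - (A - {x \<in> A. of_rat q < \<phi> A x}))"
            using c cut[OF B(1)] by (subst le_ae_AE) (auto simp: B(2))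
        qed
      qed (use c in auto)
      then have "AE x in M. x \<in> E q \<longrightarrow> x \<in> space M - (A - {x \<in> A. of_rat q < \<phi> A x})"
        using c E(1) by (subst (asm) le_ae_AE) auto
      moreover have "le_ae M {x \<in> A. of_rat q < \<phi> A x} (E q)" using A by (intro E(2)) (auto simp: S_def)
      then have "AE x in M. x \<in> {x \<in> A. of_rat q < \<phi> A x} \<longrightarrow> x \<in> E q"
        using cut[OF A] E(1) by (subst (asm) le_ae_AE) auto
      ultimately show ?thesis by eventually_elim blast
    qed
    then have "AE x in M. \<forall>q. x \<in> A \<longrightarrow> (x \<in> E q \<longleftrightarrow> of_rat q < \<phi> A x)" unfolding AE_all_countable by blast
    then show ?thesis
    proof eventually_elim
      case (elim x)
      show ?case
      proof
        assume "x \<in> A"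
        then have "(\<lambda>q. if x \<in> E q then ereal (of_rat q) else -\<infinity>) = (\<lambda>q. if of_rat q < \<phi> A x then ereal (of_rat q) else -\<infinity>)"
          using elim by auto
        then show "f x = \<phi> A x" unfolding f_def by (simp only: SUP_rat_below real_of_ereal.simps)
      qed
    qed
  qed
  ultimately show ?thesis by blast
qed

lemma glue:
  fixes \<phi> :: "'a set \<Rightarrow> 'a \<Rightarrow> 'k::euclidean_space"
  assumes loc: "localizable M" and \<A>: "\<A> \<subseteq> sets M" and \<phi>: "\<And>A. A \<in> \<A> \<Longrightarrow> \<phi> A \<in> borel_measurable M"
    and comp: "\<And>A B. A \<in> \<A> \<Longrightarrow> B \<in> \<A> \<Longrightarrow> AE x in M. x \<in> A \<inter> B \<longrightarrow> \<phi> A x = \<phi> B x"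
  shows "\<exists>f\<in>borel_measurable M. \<forall>A\<in>\<A>. AE x in M. x \<in> A \<longrightarrow> f x = \<phi> A x"
proof -
  have "\<exists>f\<in>borel_measurable M. \<forall>A\<in>\<A>. AE x in M. x \<in> A \<longrightarrow> f x = inner (\<phi> A x) b" for b
  proof (rule glue_real[OF loc \<A>])
    show "(\<lambda>x. inner (\<phi> A x) b) \<in> borel_measurable M" if "A \<in> \<A>" for A using \<phi>[OF that] by simp
    show "AE x in M. x \<in> A \<inter> B \<longrightarrow> inner (\<phi> A x) b = inner (\<phi> B x) b" if "A \<in> \<A>" "B \<in> \<A>" for A B
      using comp[OF that] by eventually_elim simp
  qed
  then obtain f where f: "\<And>b. f b \<in> borel_measurable M"
    "\<And>b A. A \<in> \<A> \<Longrightarrow> AE x in M. x \<in> A \<longrightarrow> f b x = inner (\<phi> A x) b" by metis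
  have "(\<lambda>x. \<Sum>b\<in>Basis. f b x *\<^sub>R b) \<in> borel_measurable M" using f(1) by measurable
  moreover have "AE x in M. x \<in> A \<longrightarrow> (\<Sum>b\<in>Basis. f b x *\<^sub>R b) = \<phi> A x" if "A \<in> \<A>" for A
  proof -
    have "AE x in M. \<forall>b\<in>Basis. x \<in> A \<longrightarrow> f b x = inner (\<phi> A x) b"
      by (rule AE_finite_allI) (use f(2)[OF that] in auto)
    then show ?thesis by eventually_elim (simp add: euclidean_representation)
  qed
  ultimately show ?thesis by (intro bexI[of _ "\<lambda>x. \<Sum>b\<in>Basis. f b x *\<^sub>R b"] ballI)
qed

section \<open>The Radon-Nikodym derivative of the transported measure\<close>

lemma AE_eq_on_of_integrals_eq:
  fixes f g :: "'a \<Rightarrow> ennreal"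
  assumes [measurable]: "f \<in> borel_measurable M" "g \<in> borel_measurable M" "B \<in> sets M"
    and eq: "\<And>C. C \<in> sets M \<Longrightarrow> C \<subseteq> B \<Longrightarrow> (\<integral>\<^sup>+x. f x * indicator C x \<partial>M) = (\<integral>\<^sup>+x. g x * indicator C x \<partial>M)"
    and fin: "(\<integral>\<^sup>+x. f x * indicator B x \<partial>M) \<noteq> \<infinity>"
  shows "AE x in M. x \<in> B \<longrightarrow> f x = g x"
proof -
  have "density M (\<lambda>x. f x * indicator B x) = density M (\<lambda>x. g x * indicator B x)"
  proof (rule measure_eqI)
    fix A assume "A \<in> sets (density M (\<lambda>x. f x * indicator B x))"
    then have A [measurable]: "A \<in> sets M" by simp
    have "(\<lambda>x. h x * indicator B x * indicator A x) = (\<lambda>x. h x * (indicator (A \<inter> B) x :: ennreal))" for h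
      by (auto simp: indicator_def)
    then show "emeasure (density M (\<lambda>x. f x * indicator B x)) A = emeasure (density M (\<lambda>x. g x * indicator B x)) A"
      using eq[of "A \<inter> B"] by (simp add: emeasure_density)
  qed simp
  then have "AE x in M. f x * indicator B x = g x * indicator B x"
    using fin by (subst (asm) finite_density_unique) auto
  then show ?thesis by eventually_elim (auto simp: indicator_def)
qed

text \<open>
  A countable union of members of the ideal attains the supremum. If it is finite, the remaining
  part of \<open>C\<close> is a null set, for otherwise a further member of the ideal would exceed the
  supremum.
\<close>

lemma emeasure_SUP_ideal:
  assumes I: "\<I> \<subseteq> sets K" "\<And>A B. A \<in> \<I> \<Longrightarrow> B \<in> \<I> \<Longrightarrow> A \<union> B \<in> \<I>" "{} \<in> \<I>"
    and dense: "\<And>C. C \<in> sets K \<Longrightarrow> emeasure K C \<noteq> 0 \<Longrightarrow> \<exists>B\<in>\<I>. B \<subseteq> C \<and> emeasure K B \<noteq> 0"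
    and C: "C \<in> sets K"
  shows "emeasure K C = (SUP B\<in>{B \<in> \<I>. B \<subseteq> C}. emeasure K B)"
proof (rule antisym)
  let ?s = "SUP B\<in>{B \<in> \<I>. B \<subseteq> C}. emeasure K B"
  have le: "emeasure K B \<le> ?s" if "B \<in> \<I>" "B \<subseteq> C" for B using that by (intro SUP_upper) auto
  show "?s \<le> emeasure K C" using C by (intro SUP_least emeasure_mono) auto
  have ne: "{B \<in> \<I>. B \<subseteq> C} \<noteq> {}" using I(3) by auto
  obtain b where b: "\<And>n. b n \<in> emeasure K ` {B \<in> \<I>. B \<subseteq> C}" "?s = (SUP n::nat. b n)"
    using ennreal_Sup_countable_SUP[of "emeasure K ` {B \<in> \<I>. B \<subseteq> C}"] ne by blast
  then have "\<forall>n. \<exists>B. B \<in> \<I> \<and> B \<subseteq> C \<and> b n = emeasure K B" by (auto simp: image_iff)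
  then obtain B where B: "\<And>n. B n \<in> \<I>" "\<And>n. B n \<subseteq> C" "\<And>n. b n = emeasure K (B n)" by metis
  define U where "U n = (\<Union>i\<le>n. B i)" for n :: nat
  have U: "U n \<in> \<I>" "U n \<subseteq> C" for n
  proof -
    show "U n \<in> \<I>" by (induction n) (auto simp: U_def atMost_Suc intro: B I)
    show "U n \<subseteq> C" using B by (auto simp: U_def)
  qed
  have inc: "incseq U" by (auto simp: U_def incseq_def) (meson atMost_iff order_trans)
  have Us: "U n \<in> sets K" for n using U I by auto
  have W: "emeasure K (\<Union>n. U n) = (SUP n. emeasure K (U n))"
    using inc Us by (intro SUP_emeasure_incseq[symmetric]) auto
  have Ws: "(\<Union>n. U n) \<in> sets K" using Us by auto
  have "emeasure K (\<Union>n. U n) = ?s"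
  proof (rule antisym)
    show "emeasure K (\<Union>n. U n) \<le> ?s" unfolding W by (intro SUP_least le U)
    show "?s \<le> emeasure K (\<Union>n. U n)" unfolding b(2)
    proof (rule SUP_least)
      fix n
      have "B n \<subseteq> (\<Union>n. U n)" by (auto simp: U_def)
      then show "b n \<le> emeasure K (\<Union>n. U n)" unfolding B(3) by (intro emeasure_mono Ws)
    qed
  qed
  show "emeasure K C \<le> ?s"
  proof (cases "?s = \<infinity>")
    case False
    have "emeasure K (C - (\<Union>n. U n)) = 0"
    proof (rule ccontr)
      assume "emeasure K (C - (\<Union>n. U n)) \<noteq> 0"
      then obtain X where X: "X \<in> \<I>" "X \<subseteq> C - (\<Union>n. U n)" "emeasure K X \<noteq> 0"
        using dense[of "C - (\<Union>n. U n)"] C Ws by blast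
      have "emeasure K (U n) + emeasure K X \<le> ?s" for n
      proof -
        have "emeasure K (U n \<union> X) \<le> ?s" using U X by (intro le I) auto
        moreover have "emeasure K (U n \<union> X) = emeasure K (U n) + emeasure K X"
          using Us X I(1) by (intro plus_emeasure[symmetric]) auto
        ultimately show ?thesis by simp
      qed
      then have "(SUP n. emeasure K (U n) + emeasure K X) \<le> ?s" by (rule SUP_least)
      moreover have "(SUP n. emeasure K (U n) + emeasure K X) = (SUP n. emeasure K (U n)) + emeasure K X"
        by (intro ennreal_SUP_add_left) auto
      ultimately have "?s + emeasure K X \<le> ?s" using W \<open>emeasure K (\<Union>n. U n) = ?s\<close> by simp
      then show False using False X(3) ennreal_add_left_cancel_le[of ?s "emeasure K X" 0] by simp
    qed
    then have "emeasure K C = emeasure K (\<Union>n. U n)"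
      using emeasure_Diff_null_set[of "C - (\<Union>n. U n)" K C] C Ws U(2)
      by (simp add: null_sets_def double_diff UN_least)
    then show ?thesis using \<open>emeasure K (\<Union>n. U n) = ?s\<close> by simp
  next
    case True
    show ?thesis unfolding True by simp
  qed
qed

text \<open>
  Without a countable cover by sets of finite measure, two measures may differ although they
  agree on an ideal that generates the \<open>\<sigma>\<close>-algebra. They cannot differ if the ideal is dense for
  both of them.
\<close>

lemma measure_eq_ideal:
  assumes "sets K = sets L" "\<I> \<subseteq> sets K" "\<And>A B. A \<in> \<I> \<Longrightarrow> B \<in> \<I> \<Longrightarrow> A \<union> B \<in> \<I>" "{} \<in> \<I>"
    and "\<And>C. C \<in> sets K \<Longrightarrow> emeasure K C \<noteq> 0 \<Longrightarrow> \<exists>B\<in>\<I>. B \<subseteq> C \<and> emeasure K B \<noteq> 0"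
    and "\<And>C. C \<in> sets K \<Longrightarrow> emeasure L C \<noteq> 0 \<Longrightarrow> \<exists>B\<in>\<I>. B \<subseteq> C \<and> emeasure L B \<noteq> 0"
    and "\<And>B. B \<in> \<I> \<Longrightarrow> emeasure K B = emeasure L B"
  shows "K = L"
proof (rule measure_eqI[OF assms(1)])
  fix C assume C: "C \<in> sets K"
  have "emeasure K C = (SUP B\<in>{B \<in> \<I>. B \<subseteq> C}. emeasure K B)"
    using assms(2-5) C by (rule emeasure_SUP_ideal)
  also have "\<dots> = (SUP B\<in>{B \<in> \<I>. B \<subseteq> C}. emeasure L B)" using assms(7) by (intro SUP_cong) auto
  also have "\<dots> = emeasure L C"
    using assms C by (intro emeasure_SUP_ideal[symmetric]) auto
  finally show "emeasure K C = emeasure L C" .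
qed

context set_iso begin

lemma emeasure_\<Phi>'_cong:
  assumes "A \<in> sets M" "A \<subseteq> D" "B \<in> sets M" "B \<subseteq> D" "AE x in M. x \<in> A \<longleftrightarrow> x \<in> B"
  shows "emeasure M (\<Phi>' A) = emeasure M (\<Phi>' B)"
  using set_iso.AE_cong[OF inverse_iso assms] \<Phi>'[OF assms(1,2)] \<Phi>'[OF assms(3,4)]
  by (intro emeasure_eq_AE) auto

text \<open>
  The images of disjoint sets are disjoint modulo null sets only, so that they are replaced by a
  disjoint sequence first.
\<close>

lemma suminf_\<Phi>':
  fixes A :: "nat \<Rightarrow> 'a set"
  assumes A: "\<And>i. A i \<in> sets M" "\<And>i. A i \<subseteq> D" and disj: "disjoint_family A"
  shows "(\<Sum>i. emeasure M (\<Phi>' (A i))) = emeasure M (\<Phi>' (\<Union>i. A i))"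
proof -
  interpret i: set_iso M D' D \<Phi>' \<Phi> by (rule inverse_iso)
  have s: "\<Phi>' (A i) \<in> sets M" for i using A \<Phi>' by blast
  have "(\<Union>i. A i) \<in> sets M" "(\<Union>i. A i) \<subseteq> D" using A by auto
  then have sU: "\<Phi>' (\<Union>i. A i) \<in> sets M" by (rule \<Phi>'_sets)
  let ?B = "disjointed (\<lambda>i. \<Phi>' (A i))"
  have "range ?B \<subseteq> sets M" by (rule sets.range_disjointed_sets) (use s in auto)
  then have B: "?B i \<in> sets M" for i by auto
  have d: "AE x in M. \<forall>j. \<forall>i. i \<noteq> j \<longrightarrow> \<not> (x \<in> \<Phi>' (A i) \<and> x \<in> \<Phi>' (A j))"
    unfolding AE_all_countable
  proof (intro allI)
    fix j i
    show "AE x in M. i \<noteq> j \<longrightarrow> \<not> (x \<in> \<Phi>' (A i) \<and> x \<in> \<Phi>' (A j))"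
    proof (cases "i = j")
      case False
      then have "A i \<inter> A j = {}" using disj by (auto simp: disjoint_family_on_def)
      then have "AE x in M. x \<in> \<Phi>' {} \<longleftrightarrow> x \<in> \<Phi>' (A i) \<and> x \<in> \<Phi>' (A j)" using i.AE_Int[OF A A, of i j] by simp
      with i.AE_empty show ?thesis by eventually_elim blast
    qed simp
  qed
  have "emeasure M (\<Phi>' (A i)) = emeasure M (?B i)" for i
  proof (rule emeasure_eq_AE[OF _ s B])
    show "AE x in M. x \<in> \<Phi>' (A i) \<longleftrightarrow> x \<in> ?B i"
      using d
    proof eventually_elim
      case (elim x)
      have "x \<in> \<Phi>' (A i) \<Longrightarrow> j < i \<Longrightarrow> x \<notin> \<Phi>' (A j)" for j
        using elim[THEN spec, of j, THEN spec, of i] by simp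
      then show ?case by (auto simp: disjointed_def)
    qed
  qed
  then have "(\<Sum>i. emeasure M (\<Phi>' (A i))) = (\<Sum>i. emeasure M (?B i))" by simp
  also have "\<dots> = emeasure M (\<Union>i. ?B i)" using B by (intro suminf_emeasure disjoint_family_disjointed) auto
  also have "\<dots> = emeasure M (\<Phi>' (\<Union>i. A i))"
  proof (rule emeasure_eq_AE)
    show "AE x in M. x \<in> (\<Union>i. ?B i) \<longleftrightarrow> x \<in> \<Phi>' (\<Union>i. A i)"
      using i.AE_UN[OF A] unfolding UN_disjointed_eq by eventually_elim auto
  qed (use B sU in auto)
  finally show ?thesis .
qed

lemma emeasure_\<Phi>'_empty: "emeasure M (\<Phi>' {}) = 0"
proof -
  interpret i: set_iso M D' D \<Phi>' \<Phi> by (rule inverse_iso)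
  have "\<Phi>' {} \<in> sets M" using \<Phi>'[of "{}"] by simp
  then have "\<Phi>' {} \<in> null_sets M" using i.AE_empty by (simp add: null_sets_AE)
  then show ?thesis by auto
qed

text \<open>
  The transported measure as a measure on the whole space, where it can be compared with
  densities with respect to \<open>M\<close>.
\<close>

definition pullback :: "'a measure" where
  "pullback = measure_of (space M) (sets M) (\<lambda>C. emeasure M (\<Phi>' (C \<inter> D)))"

lemma pullback_sets [simp, measurable_cong]: "sets pullback = sets M"
  and pullback_space [simp]: "space pullback = space M"
  by (simp_all add: pullback_def)

lemma emeasure_pullback:
  assumes "C \<in> sets M"
  shows "emeasure pullback C = emeasure M (\<Phi>' (C \<inter> D))"
  unfolding pullback_def
proof (rule emeasure_measure_of_sigma)
  show "sigma_algebra (space M) (sets M)" by (rule sets.sigma_algebra_axioms)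
  show "positive (sets M) (\<lambda>C. emeasure M (\<Phi>' (C \<inter> D)))" by (simp add: positive_def emeasure_\<Phi>'_empty)
  show "countably_additive (sets M) (\<lambda>C. emeasure M (\<Phi>' (C \<inter> D)))"
  proof (rule countably_additiveI)
    fix A :: "nat \<Rightarrow> 'a set" assume A: "range A \<subseteq> sets M" "disjoint_family A"
    have "(\<Sum>i. emeasure M (\<Phi>' (A i \<inter> D))) = emeasure M (\<Phi>' (\<Union>i. A i \<inter> D))"
      by (rule suminf_\<Phi>') (use A in \<open>auto simp: disjoint_family_on_def\<close>)
    then show "(\<Sum>i. emeasure M (\<Phi>' (A i \<inter> D))) = emeasure M (\<Phi>' (\<Union> (range A) \<inter> D))"
      by (simp add: Int_UN_distrib2 UN_simps)
  qed
qed fact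

lemma transported_sets: "sets (transported_measure M D \<Phi>') = sets (restrict_space M D)"
proof -
  have "sets (restrict_space M D) \<subseteq> Pow D" by (auto simp: sets_restrict_space_iff)
  then show ?thesis unfolding transported_measure_def
    using sets.sigma_sets_eq[of "restrict_space M D"] by simp
qed

lemma emeasure_transported:
  assumes "C \<in> sets M" "C \<subseteq> D"
  shows "emeasure (transported_measure M D \<Phi>') C = emeasure M (\<Phi>' C)"
  unfolding transported_measure_def
proof (rule emeasure_measure_of_sigma)
  show "sigma_algebra D (sets (restrict_space M D))"
    using sets.sigma_algebra_axioms[of "restrict_space M D"] by simp
  show "positive (sets (restrict_space M D)) (\<lambda>C. emeasure M (\<Phi>' C))" by (simp add: positive_def emeasure_\<Phi>'_empty)
  show "countably_additive (sets (restrict_space M D)) (\<lambda>C. emeasure M (\<Phi>' C))"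
    by (rule countably_additiveI, rule suminf_\<Phi>') (auto simp: sets_restrict_space_iff image_subset_iff)
qed (use assms in \<open>simp add: sets_restrict_space_iff\<close>)

text \<open>
  On these sets, \<open>M\<close> and the transported measure are both finite, and the classical
  Radon-Nikodym theorem applies.
\<close>

definition small :: "'a set set" where
  "small = {B \<in> sets M. B \<subseteq> D \<and> emeasure M B < \<infinity> \<and> emeasure M (\<Phi>' B) < \<infinity>}"

text \<open>
  Choose a subset of finite measure in \<open>D\<close>, then a subset of finite measure of its image in
  \<open>D'\<close>, and return to \<open>D\<close>.
\<close>

lemma small_dense:
  assumes loc: "localizable M" and C: "C \<in> sets M" "C \<subseteq> D" "C \<notin> null_sets M"
  obtains B where "B \<in> small" "B \<subseteq> C" "B \<notin> null_sets M"
proof -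
  interpret i: set_iso M D' D \<Phi>' \<Phi> by (rule inverse_iso)
  obtain B1 where B1: "B1 \<in> sets M" "B1 \<subseteq> C" "B1 \<notin> null_sets M" "emeasure M B1 < \<infinity>"
    by (rule localizable_finite_subset[OF loc C(1,3)])
  have B1D: "B1 \<subseteq> D" using B1 C by auto
  note P1 = \<Phi>'[OF B1(1) B1D]
  have "\<Phi>' B1 \<notin> null_sets M"
    using B1 P1 i.null_iff[OF B1(1) B1D] by (simp add: null_sets_AE)
  then obtain C2 where C2: "C2 \<in> sets M" "C2 \<subseteq> \<Phi>' B1" "C2 \<notin> null_sets M" "emeasure M C2 < \<infinity>"
    by (rule localizable_finite_subset[OF loc P1[THEN conjunct1]])
  have C2D: "C2 \<subseteq> D'" using C2 P1 by auto
  note P2 = \<Phi>[OF C2(1) C2D]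
  have e: "AE x in M. x \<in> \<Phi> C2 \<longleftrightarrow> x \<in> \<Phi> C2 \<inter> B1"
  proof -
    have "AE x in M. x \<in> \<Phi> C2 \<longrightarrow> x \<in> B1"
      by (subst galois(1)) (use C2 C2D B1 B1D in auto)
    then show ?thesis by eventually_elim blast
  qed
  show thesis
  proof (rule that)
    have s: "\<Phi> C2 \<inter> B1 \<in> sets M" "\<Phi> C2 \<inter> B1 \<subseteq> D" using P2 B1 by auto
    have "emeasure M (\<Phi>' (\<Phi> C2 \<inter> B1)) = emeasure M (\<Phi>' (\<Phi> C2))"
      by (rule emeasure_\<Phi>'_cong[symmetric]) (use s P2 e in auto)
    also have "\<dots> = emeasure M C2"
      using AE_inv'[OF C2(1) C2D] C2(1) P2 \<Phi>'[of "\<Phi> C2"] by (intro emeasure_eq_AE) auto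
    finally have "emeasure M (\<Phi>' (\<Phi> C2 \<inter> B1)) < \<infinity>" using C2 by simp
    moreover have "emeasure M (\<Phi> C2 \<inter> B1) < \<infinity>"
      using emeasure_mono[of "\<Phi> C2 \<inter> B1" B1 M] B1 by (auto intro: le_less_trans)
    ultimately show "\<Phi> C2 \<inter> B1 \<in> small" using s by (simp add: small_def)
    show "\<Phi> C2 \<inter> B1 \<subseteq> C" using B1 by auto
    have "\<Phi> C2 \<notin> null_sets M" using null_iff[OF C2(1) C2D] C2 P2 by (simp add: null_sets_AE)
    show "\<Phi> C2 \<inter> B1 \<notin> null_sets M"
    proof
      assume "\<Phi> C2 \<inter> B1 \<in> null_sets M"
      then have "AE x in M. x \<notin> \<Phi> C2 \<inter> B1" by (rule AE_not_in)
      with e have "AE x in M. x \<notin> \<Phi> C2" by eventually_elim blast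
      with \<open>\<Phi> C2 \<notin> null_sets M\<close> P2 show False by (simp add: null_sets_AE)
    qed
  qed
qed

lemma small_closed:
  "A \<in> small \<Longrightarrow> B \<in> small \<Longrightarrow> A \<union> B \<in> small" "{} \<in> small"
  "A \<in> small \<Longrightarrow> C \<in> sets M \<Longrightarrow> C \<subseteq> A \<Longrightarrow> C \<in> small"
proof -
  interpret i: set_iso M D' D \<Phi>' \<Phi> by (rule inverse_iso)
  show "{} \<in> small" by (simp add: small_def emeasure_\<Phi>'_empty)
  { assume A: "A \<in> small" and B: "B \<in> small"
    have s: "A \<in> sets M" "A \<subseteq> D" "B \<in> sets M" "B \<subseteq> D" using A B by (auto simp: small_def)
    have "emeasure M (\<Phi>' (A \<union> B)) = emeasure M (\<Phi>' A \<union> \<Phi>' B)"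
      using i.AE_Un[OF s] s by (intro emeasure_eq_AE) auto
    also have "\<dots> \<le> emeasure M (\<Phi>' A) + emeasure M (\<Phi>' B)" using s by (intro emeasure_subadditive) auto
    also have "\<dots> < \<infinity>" using A B by (simp add: small_def)
    finally have 1: "emeasure M (\<Phi>' (A \<union> B)) < \<infinity>" .
    have "emeasure M (A \<union> B) \<le> emeasure M A + emeasure M B" using s by (intro emeasure_subadditive) auto
    also have "\<dots> < \<infinity>" using A B by (simp add: small_def)
    finally show "A \<union> B \<in> small" using 1 s by (simp add: small_def) }
  { assume A: "A \<in> small" and C: "C \<in> sets M" "C \<subseteq> A"
    have s: "A \<in> sets M" "A \<subseteq> D" "C \<subseteq> D" using A C by (auto simp: small_def)
    have "emeasure M (\<Phi>' C) \<le> emeasure M (\<Phi>' A)"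
      using i.AE_mono[of C A] C s by (intro emeasure_mono_AE) auto
    moreover have "emeasure M C \<le> emeasure M A" using C s by (intro emeasure_mono) auto
    ultimately show "C \<in> small" using A C s by (auto simp: small_def intro: le_less_trans) }
qed

lemma density_small:
  assumes B: "B \<in> small"
  shows "\<exists>f \<in> borel_measurable M. (\<forall>x. 0 \<le> f x) \<and>
    (\<forall>C\<in>sets M. C \<subseteq> B \<longrightarrow> (\<integral>\<^sup>+x. ennreal (f x) * indicator C x \<partial>M) = emeasure M (\<Phi>' C))"
proof -
  interpret i: set_iso M D' D \<Phi>' \<Phi> by (rule inverse_iso)
  have B': "B \<in> sets M" "B \<subseteq> D" "emeasure M B < \<infinity>" "emeasure M (\<Phi>' B) < \<infinity>" using B by (auto simp: small_def)
  note [measurable] = B'(1)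
  let ?\<mu> = "density M (indicator B)" and ?\<nu> = "density pullback (indicator B)"
  have \<mu>: "emeasure ?\<mu> C = emeasure M (B \<inter> C)" if "C \<in> sets M" for C
  proof -
    have "emeasure ?\<mu> C = (\<integral>\<^sup>+x. indicator B x * indicator C x \<partial>M)"
      using that by (intro emeasure_density) auto
    also have "\<dots> = (\<integral>\<^sup>+x. indicator (B \<inter> C) x \<partial>M)"
      by (intro nn_integral_cong) (auto simp: indicator_def)
    also have "\<dots> = emeasure M (B \<inter> C)" using that by (intro nn_integral_indicator) simp
    finally show ?thesis .
  qed
  have \<nu>: "emeasure ?\<nu> C = emeasure M (\<Phi>' (B \<inter> C))" if C: "C \<in> sets M" for C
  proof -
    have "emeasure ?\<nu> C = (\<integral>\<^sup>+x. indicator B x * indicator C x \<partial>pullback)"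
      using C B' by (intro emeasure_density) auto
    also have "\<dots> = (\<integral>\<^sup>+x. indicator (B \<inter> C) x \<partial>pullback)"
      by (intro nn_integral_cong) (auto simp: indicator_def)
    also have "\<dots> = emeasure pullback (B \<inter> C)" using C B' by (intro nn_integral_indicator) simp
    also have "\<dots> = emeasure M (\<Phi>' (B \<inter> C))" using C B' by (subst emeasure_pullback) (auto intro!: arg_cong[where f = "\<lambda>X. emeasure M (\<Phi>' X)"])
    finally show ?thesis .
  qed
  interpret \<mu>: finite_measure ?\<mu>
    by standard (use B' sets.sets_into_space[OF B'(1)] in \<open>simp add: \<mu> Int_absorb2 less_top[symmetric]\<close>)
  have fin: "finite_measure ?\<nu>"
    by standard (use B' sets.sets_into_space[OF B'(1)] in \<open>simp add: \<nu> Int_absorb2 less_top[symmetric]\<close>)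
  have ac: "absolutely_continuous ?\<mu> ?\<nu>"
    unfolding absolutely_continuous_def
  proof
    fix C assume "C \<in> null_sets ?\<mu>"
    then have C: "C \<in> sets M" "B \<inter> C \<in> null_sets M" using \<mu>[of C] B' by (auto simp: null_sets_def)
    have s: "B \<inter> C \<in> sets M" "B \<inter> C \<subseteq> D" using C B' by auto
    have "\<Phi>' (B \<inter> C) \<in> null_sets M"
      using C i.null_iff[OF s] \<Phi>'[OF s] s by (simp add: null_sets_AE)
    then show "C \<in> null_sets ?\<nu>" using C \<nu>[of C] by (auto simp: null_sets_def)
  qed
  obtain f where f: "f \<in> borel_measurable ?\<mu>" "density ?\<mu> f = ?\<nu>"
    using \<mu>.Radon_Nikodym_finite_measure[OF fin _ ac] by auto
  then have f' [measurable]: "f \<in> borel_measurable M" by simp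
  have int: "(\<integral>\<^sup>+x. f x * indicator C x \<partial>M) = emeasure M (\<Phi>' C)" if C: "C \<in> sets M" "C \<subseteq> B" for C
  proof -
    have "emeasure M (\<Phi>' C) = emeasure ?\<nu> C" using \<nu>[OF C(1)] C(2) by (simp add: Int_absorb1)
    also have "\<dots> = emeasure (density M (\<lambda>x. indicator B x * f x)) C"
      unfolding f(2)[symmetric] by (subst density_density_eq) auto
    also have "\<dots> = (\<integral>\<^sup>+x. f x * indicator C x \<partial>M)"
      using C by (subst emeasure_density) (auto intro!: nn_integral_cong simp: indicator_def)
    finally show ?thesis by simp
  qed
  have "AE x in M. f x * indicator B x \<noteq> \<infinity>"
    using int[OF B'(1)] B' by (intro nn_integral_PInf_AE) auto
  then have "(\<integral>\<^sup>+x. ennreal (enn2real (f x)) * indicator C x \<partial>M) = emeasure M (\<Phi>' C)"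
    if C: "C \<in> sets M" "C \<subseteq> B" for C
    unfolding int[OF C, symmetric]
    by (intro nn_integral_cong_AE, eventually_elim) (use C in \<open>auto simp: indicator_def less_top\<close>)
  then show ?thesis by (intro bexI[of _ "\<lambda>x. enn2real (f x)"]) auto
qed

text \<open>
  The derivative that enters the weights of spatial partial isometries, as a real-valued
  function on the whole space.
\<close>

definition rho :: "'a \<Rightarrow> real" where
  "rho x = (if x \<in> D then enn2real (RN_deriv (restrict_space M D) (transported_measure M D \<Phi>') x) else 0)"

lemma rho_measurable [measurable]: "rho \<in> borel_measurable M"
proof -
  have "(\<lambda>x. enn2real (RN_deriv (restrict_space M D) (transported_measure M D \<Phi>') x)) \<in> borel_measurable (restrict_space M D)"
    by measurable
  then have "(\<lambda>x. indicator D x *\<^sub>R enn2real (RN_deriv (restrict_space M D) (transported_measure M D \<Phi>') x)) \<in> borel_measurable M"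
    using D by (subst (asm) borel_measurable_restrict_space_iff) auto
  moreover have "rho = (\<lambda>x. indicator D x *\<^sub>R enn2real (RN_deriv (restrict_space M D) (transported_measure M D \<Phi>') x))"
    by (auto simp: rho_def indicator_def)
  ultimately show ?thesis by simp
qed

lemma rho_nonneg [simp]: "0 \<le> rho x"
  by (simp add: rho_def)

text \<open>
  By uniqueness of densities, the derivatives on small sets agree on overlaps, and they can be
  glued because \<open>M\<close> is localizable. The glued density defines a measure that agrees with the
  transported measure on small sets, which are dense for both.
\<close>

lemma ex_density:
  assumes loc: "localizable M"
  shows "\<exists>f \<in> borel_measurable (restrict_space M D). density (restrict_space M D) f = transported_measure M D \<Phi>'"
proof -
  interpret i: set_iso M D' D \<Phi>' \<Phi> by (rule inverse_iso)
  obtain \<phi> where \<phi>: "\<And>B. B \<in> small \<Longrightarrow> \<phi> B \<in> borel_measurable M" "\<And>B x. B \<in> small \<Longrightarrow> 0 \<le> \<phi> B x"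
    "\<And>B C. B \<in> small \<Longrightarrow> C \<in> sets M \<Longrightarrow> C \<subseteq> B \<Longrightarrow> (\<integral>\<^sup>+x. ennreal (\<phi> B x) * indicator C x \<partial>M) = emeasure M (\<Phi>' C)"
    using density_small by metis
  have small: "B \<in> sets M" "B \<subseteq> D" "emeasure M (\<Phi>' B) < \<infinity>" if "B \<in> small" for B using that by (auto simp: small_def)
  have "\<exists>f\<in>borel_measurable M. \<forall>A\<in>small. AE x in M. x \<in> A \<longrightarrow> f x = \<phi> A x"
  proof (rule glue[OF loc])
    fix A B assume AB: "A \<in> small" "B \<in> small"
    then have I: "A \<inter> B \<in> small" using small_closed(3)[OF AB(1), of "A \<inter> B"] small(1) by auto
    have "AE x in M. x \<in> A \<inter> B \<longrightarrow> ennreal (\<phi> A x) = ennreal (\<phi> B x)"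
    proof (rule AE_eq_on_of_integrals_eq)
      show "(\<integral>\<^sup>+x. ennreal (\<phi> A x) * indicator (A \<inter> B) x \<partial>M) \<noteq> \<infinity>"
        using \<phi>(3)[OF AB(1), of "A \<inter> B"] small[OF I] by simp
    qed (use \<phi> AB small in auto)
    then show "AE x in M. x \<in> A \<inter> B \<longrightarrow> \<phi> A x = \<phi> B x"
      by eventually_elim (use \<phi>(2) AB in auto)
  qed (use \<phi> small in auto)
  then obtain f where f [measurable]: "f \<in> borel_measurable M" and fA: "\<And>A. A \<in> small \<Longrightarrow> AE x in M. x \<in> A \<longrightarrow> f x = \<phi> A x"
    by blast
  have fB: "(\<integral>\<^sup>+x. ennreal (f x) * indicator B x \<partial>M) = emeasure M (\<Phi>' B)" if B: "B \<in> small" for B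
  proof -
    have "(\<integral>\<^sup>+x. ennreal (f x) * indicator B x \<partial>M) = (\<integral>\<^sup>+x. ennreal (\<phi> B x) * indicator B x \<partial>M)"
      using fA[OF B] by (intro nn_integral_cong_AE) (auto elim!: eventually_mono simp: indicator_def)
    then show ?thesis using \<phi>(3)[OF B, of B] small[OF B] by simp
  qed
  let ?K = "density M (\<lambda>x. ennreal (f x) * indicator D x)"
  have K: "emeasure ?K C = (\<integral>\<^sup>+x. ennreal (f x) * indicator (C \<inter> D) x \<partial>M)" if "C \<in> sets M" for C
    using that by (subst emeasure_density) (auto intro!: nn_integral_cong simp: indicator_def)
  have N: "emeasure M (\<Phi>' C) \<noteq> 0 \<longleftrightarrow> C \<notin> null_sets M" if "C \<in> sets M" "C \<subseteq> D" for C
    using i.null_iff[OF that] \<Phi>'[OF that] that by (auto simp: null_sets_AE[symmetric] null_sets_def)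
  have KB: "emeasure ?K B = emeasure pullback B" if B: "B \<in> small" for B
    using K[of B] fB[OF B] small[OF B] by (simp add: emeasure_pullback Int_absorb2)
  have dense: "\<exists>B\<in>small. B \<subseteq> C \<and> emeasure M (\<Phi>' B) \<noteq> 0" if C: "C \<in> sets M" "C \<inter> D \<notin> null_sets M" for C
  proof -
    obtain B where "B \<in> small" "B \<subseteq> C \<inter> D" "B \<notin> null_sets M"
      by (rule small_dense[OF loc _ _ C(2)]) (use C in auto)
    then show ?thesis using N[of B] small[of B] by blast
  qed
  have "?K = pullback"
  proof (rule measure_eq_ideal[where \<I> = small])
    show "\<exists>B\<in>small. B \<subseteq> C \<and> emeasure ?K B \<noteq> 0" if C: "C \<in> sets ?K" "emeasure ?K C \<noteq> 0" for C
    proof -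
      have "C \<inter> D \<notin> null_sets M"
      proof
        assume "C \<inter> D \<in> null_sets M"
        then have "AE x in M. x \<notin> C \<inter> D" by (rule AE_not_in)
        then have "(\<integral>\<^sup>+x. ennreal (f x) * indicator (C \<inter> D) x \<partial>M) = (\<integral>\<^sup>+x. 0 \<partial>M)"
          by (intro nn_integral_cong_AE) (auto elim!: eventually_mono)
        then show False using C K[of C] by simp
      qed
      then obtain B where B: "B\<in>small" "B \<subseteq> C" "emeasure M (\<Phi>' B) \<noteq> 0" using dense[of C] C by auto
      then show ?thesis using K[of B] fB[OF B(1)] small[OF B(1)] by (intro bexI[of _ B]) (auto simp: Int_absorb2)
    qed
    show "\<exists>B\<in>small. B \<subseteq> C \<and> emeasure pullback B \<noteq> 0" if C: "C \<in> sets ?K" "emeasure pullback C \<noteq> 0" for C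
    proof -
      have "C \<inter> D \<notin> null_sets M" using C N[of "C \<inter> D"] emeasure_pullback[of C] by auto
      then obtain B where B: "B\<in>small" "B \<subseteq> C" "emeasure M (\<Phi>' B) \<noteq> 0" using dense[of C] C by auto
      then show ?thesis using small[OF B(1)] emeasure_pullback[of B] by (intro bexI[of _ B]) (auto simp: Int_absorb2)
    qed
    show "small \<subseteq> sets ?K" using small(1) by auto
    show "emeasure ?K B = emeasure pullback B" if "B \<in> small" for B by (rule KB[OF that])
    show "A \<union> B \<in> small" if "A \<in> small" "B \<in> small" for A B by (rule small_closed(1)[OF that])
    show "{} \<in> small" by (rule small_closed(2))
  qed simp
  have "density (restrict_space M D) (\<lambda>x. ennreal (f x)) = transported_measure M D \<Phi>'"
  proof (rule measure_eqI)
    show "sets (density (restrict_space M D) (\<lambda>x. ennreal (f x))) = sets (transported_measure M D \<Phi>')"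
      by (simp add: transported_sets)
    fix C assume "C \<in> sets (density (restrict_space M D) (\<lambda>x. ennreal (f x)))"
    then have Cr: "C \<in> sets (restrict_space M D)" by simp
    then have C: "C \<in> sets M" "C \<subseteq> D" using D by (auto simp: sets_restrict_space_iff)
    have "emeasure (density (restrict_space M D) (\<lambda>x. ennreal (f x))) C
       = (\<integral>\<^sup>+x. ennreal (f x) * indicator C x \<partial>restrict_space M D)"
      using Cr by (subst emeasure_density) (auto intro: measurable_restrict_space1)
    also have "\<dots> = (\<integral>\<^sup>+x. ennreal (f x) * indicator (C \<inter> D) x \<partial>M)"
      using D C by (subst nn_integral_restrict_space) (auto intro!: nn_integral_cong simp: indicator_def)
    also have "\<dots> = emeasure M (\<Phi>' C)"
      using K[OF C(1)] \<open>?K = pullback\<close> emeasure_pullback[OF C(1)] C by (simp add: Int_absorb2)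
    finally show "emeasure (density (restrict_space M D) (\<lambda>x. ennreal (f x))) C = emeasure (transported_measure M D \<Phi>') C"
      using C by (simp add: emeasure_transported)
  qed
  moreover have "(\<lambda>x. ennreal (f x)) \<in> borel_measurable (restrict_space M D)" by (intro measurable_restrict_space1) simp
  ultimately show ?thesis by blast
qed

text \<open>
  If the derivative were infinite on a non-null set, it would be so on a non-null small set,
  whose transported measure is finite. The set where it vanishes is a null set of the
  transported measure, and \<open>\<Phi>'\<close> reflects null sets.
\<close>

lemma rho:
  assumes loc: "localizable M"
  shows rho_pos: "AE x in M. x \<in> D \<longrightarrow> 0 < rho x"
    and rho_integral: "\<And>C. C \<in> sets M \<Longrightarrow> C \<subseteq> D \<Longrightarrow> (\<integral>\<^sup>+x. ennreal (rho x) * indicator C x \<partial>M) = emeasure M (\<Phi>' C)"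
proof -
  interpret i: set_iso M D' D \<Phi>' \<Phi> by (rule inverse_iso)
  let ?R = "restrict_space M D"
  define r where "r = RN_deriv ?R (transported_measure M D \<Phi>')"
  obtain f where "f \<in> borel_measurable ?R" "density ?R f = transported_measure M D \<Phi>'"
    using ex_density[OF loc] by blast
  then have r: "density ?R r = transported_measure M D \<Phi>'" unfolding r_def by (rule RN_derivI)
  have rm [measurable]: "r \<in> borel_measurable ?R" unfolding r_def by simp
  have r_int: "(\<integral>\<^sup>+x. r x * indicator C x \<partial>?R) = emeasure M (\<Phi>' C)" if "C \<in> sets M" "C \<subseteq> D" for C
  proof -
    have "C \<in> sets ?R" using that D by (simp add: sets_restrict_space_iff)
    then have "emeasure (density ?R r) C = (\<integral>\<^sup>+x. r x * indicator C x \<partial>?R)" using rm by (intro emeasure_density)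
    then show ?thesis unfolding r emeasure_transported[OF that] by simp
  qed
  have lev: "{x \<in> D. r x = c} \<in> sets M" for c
  proof -
    have "{x \<in> space ?R. r x = c} \<in> sets ?R" by measurable
    then show ?thesis using D by (simp add: sets_restrict_space_iff)
  qed
  have int_lev: "(\<integral>\<^sup>+x. r x * indicator B x \<partial>?R) = c * emeasure M B" if B: "B \<in> sets M" "B \<subseteq> {x \<in> D. r x = c}" for B c
  proof -
    have "(\<integral>\<^sup>+x. r x * indicator B x \<partial>?R) = (\<integral>\<^sup>+x. c * indicator B x \<partial>?R)"
      using B by (intro nn_integral_cong) (auto simp: indicator_def)
    also have "\<dots> = c * emeasure ?R B"
      using B D by (intro nn_integral_cmult_indicator) (auto simp: sets_restrict_space_iff)
    also have "emeasure ?R B = emeasure M B" using B D by (intro emeasure_restrict_space) auto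
    finally show ?thesis .
  qed
  have "{x \<in> D. r x = \<infinity>} \<in> null_sets M"
  proof (rule ccontr)
    assume n: "{x \<in> D. r x = \<infinity>} \<notin> null_sets M"
    obtain B where B: "B \<in> small" "B \<subseteq> {x \<in> D. r x = \<infinity>}" "B \<notin> null_sets M"
      by (rule small_dense[OF loc lev _ n]) auto
    then have "B \<in> sets M" "B \<subseteq> D" "emeasure M (\<Phi>' B) < \<infinity>" by (auto simp: small_def)
    with int_lev[of B \<infinity>] r_int[of B] B show False by (auto simp: ennreal_top_mult null_sets_def)
  qed
  then have fin: "AE x in M. x \<notin> {x \<in> D. r x = \<infinity>}" by (rule AE_not_in)
  have "{x \<in> D. r x = 0} \<in> null_sets M"
  proof -
    have "emeasure M (\<Phi>' {x \<in> D. r x = 0}) = 0"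
      using int_lev[OF lev subset_refl, of 0] r_int[OF lev, of 0] by auto
    then have "\<Phi>' {x \<in> D. r x = 0} \<in> null_sets M" using \<Phi>'[OF lev, of 0] by (auto simp: null_sets_def)
    then show ?thesis using i.null_iff[OF lev, of 0] \<Phi>'[OF lev, of 0] lev[of 0] by (simp add: null_sets_AE)
  qed
  then have pos: "AE x in M. x \<notin> {x \<in> D. r x = 0}" by (rule AE_not_in)
  show "AE x in M. x \<in> D \<longrightarrow> 0 < rho x"
    using fin pos by eventually_elim (auto simp: rho_def r_def[symmetric] enn2real_positive_iff less_top zero_less_iff_neq_zero)
  fix C assume C: "C \<in> sets M" "C \<subseteq> D"
  have "(\<integral>\<^sup>+x. ennreal (rho x) * indicator C x \<partial>M) = (\<integral>\<^sup>+x. r x * indicator C x * indicator D x \<partial>M)"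
    using fin by (intro nn_integral_cong_AE, eventually_elim) (use C in \<open>auto simp: rho_def r_def[symmetric] indicator_def less_top\<close>)
  also have "\<dots> = emeasure M (\<Phi>' C)" using D by (subst nn_integral_restrict_space[symmetric]) (auto simp: r_int[OF C])
  finally show "(\<integral>\<^sup>+x. ennreal (rho x) * indicator C x \<partial>M) = emeasure M (\<Phi>' C)" .
qed

text \<open>
  Integrals over small sets suffice to recognize the derivative, because every non-null subset
  of \<open>D\<close> contains a non-null small set.
\<close>

lemma rho_unique:
  assumes loc: "localizable M" and w [measurable]: "w \<in> borel_measurable M" and nn: "\<And>x. 0 \<le> w x"
    and int: "\<And>B. B \<in> small \<Longrightarrow> (\<integral>\<^sup>+x. ennreal (w x) * indicator B x \<partial>M) = emeasure M (\<Phi>' B)"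
  shows "AE x in M. x \<in> D \<longrightarrow> w x = rho x"
proof -
  have N: "{x \<in> D. w x \<noteq> rho x} \<in> sets M"
  proof -
    have "{x \<in> D. w x \<noteq> rho x} = D \<inter> {x \<in> space M. w x \<noteq> rho x}" using sets.sets_into_space[OF D] by auto
    then show ?thesis by simp
  qed
  have "{x \<in> D. w x \<noteq> rho x} \<in> null_sets M"
  proof (rule ccontr)
    assume n: "{x \<in> D. w x \<noteq> rho x} \<notin> null_sets M"
    obtain B where B: "B \<in> small" "B \<subseteq> {x \<in> D. w x \<noteq> rho x}" "B \<notin> null_sets M"
      by (rule small_dense[OF loc N _ n]) auto
    have Bs: "B \<in> sets M" "B \<subseteq> D" "emeasure M (\<Phi>' B) < \<infinity>" using B(1) by (auto simp: small_def)
    have "AE x in M. x \<in> B \<longrightarrow> ennreal (w x) = ennreal (rho x)"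
    proof (rule AE_eq_on_of_integrals_eq)
      fix C assume C: "C \<in> sets M" "C \<subseteq> B"
      then show "(\<integral>\<^sup>+x. ennreal (w x) * indicator C x \<partial>M) = (\<integral>\<^sup>+x. ennreal (rho x) * indicator C x \<partial>M)"
        using int[OF small_closed(3)[OF B(1) C]] rho_integral[OF loc, of C] Bs by auto
    qed (use Bs int[OF B(1)] in auto)
    then have "AE x in M. x \<notin> B" by eventually_elim (use B(2) nn in auto)
    then show False using B(3) Bs by (simp add: null_sets_AE)
  qed
  then have "AE x in M. x \<notin> {x \<in> D. w x \<noteq> rho x}" by (rule AE_not_in)
  then show ?thesis by eventually_elim auto
qed

text \<open>
  Change of variables: \<open>g\<close> has the same distribution with respect to the transported measure as
  \<open>f\<close> has with respect to the restriction of \<open>M\<close> to \<open>D'\<close>.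
\<close>

lemma rel_nn_integral:
  fixes f g :: "'a \<Rightarrow> 'k::{real_normed_field,euclidean_space}"
  assumes loc: "localizable M" and fg: "rel f g" and h [measurable]: "h \<in> borel_measurable borel"
  shows "(\<integral>\<^sup>+x. ennreal (rho x) * indicator D x * h (g x) \<partial>M) = (\<integral>\<^sup>+x. indicator D' x * h (f x) \<partial>M)"
proof -
  note [measurable] = rel_measurable[OF fg]
  let ?K = "density M (\<lambda>x. ennreal (rho x) * indicator D x)" and ?L = "density M (\<lambda>x. indicator D' x)"
  have "distr ?K borel g = distr ?L borel f"
  proof (rule measure_eqI)
    fix U assume "U \<in> sets (distr ?K borel g)"
    then have U [measurable]: "U \<in> sets borel" by simp
    let ?A = "{x \<in> D'. f x \<in> U}" and ?B = "{x \<in> D. g x \<in> U}"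
    have A: "?A \<in> sets M" by (rule vimage_sets[OF _ U]) simp
    have B: "?B \<in> sets M" by (rule set_iso.vimage_sets[OF inverse_iso _ U]) simp
    have eq: "AE x in M. x \<in> \<Phi> ?A \<longleftrightarrow> x \<in> ?B" using fg U by (auto simp: rel_def)
    have "emeasure (distr ?K borel g) U = (\<integral>\<^sup>+x. ennreal (rho x) * indicator D x * indicator (g -` U \<inter> space M) x \<partial>M)"
      by (subst emeasure_distr) (auto simp: emeasure_density)
    also have "\<dots> = (\<integral>\<^sup>+x. ennreal (rho x) * indicator ?B x \<partial>M)"
      by (intro nn_integral_cong) (auto simp: indicator_def)
    also have "\<dots> = emeasure M (\<Phi>' ?B)" using B by (intro rho_integral[OF loc]) auto
    also have "\<dots> = emeasure M (\<Phi>' (\<Phi> ?A))"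
      using A B \<Phi>[OF A] eq by (intro emeasure_\<Phi>'_cong) (auto elim!: eventually_mono)
    also have "\<dots> = emeasure M ?A"
      using AE_inv'[OF A] A \<Phi>[OF A] \<Phi>'[of "\<Phi> ?A"] by (intro emeasure_eq_AE) auto
    also have "\<dots> = (\<integral>\<^sup>+x. indicator ?A x \<partial>M)" using A by simp
    also have "\<dots> = (\<integral>\<^sup>+x. indicator D' x * indicator (f -` U \<inter> space M) x \<partial>M)"
      by (intro nn_integral_cong) (auto simp: indicator_def)
    also have "\<dots> = emeasure (distr ?L borel f) U"
      by (subst emeasure_distr) (auto simp: emeasure_density)
    finally show "emeasure (distr ?K borel g) U = emeasure (distr ?L borel f) U" .
  qed simp
  then have "(\<integral>\<^sup>+y. h y \<partial>distr ?K borel g) = (\<integral>\<^sup>+y. h y \<partial>distr ?L borel f)" by simp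
  then show ?thesis by (simp add: nn_integral_distr nn_integral_density)
qed

end

section \<open>Density of simple functions\<close>

context lp_scalar begin

lemma simple_sum:
  fixes s :: "'a \<Rightarrow> 'k"
  assumes s: "simple_function M s" "s \<in> lpf"
  obtains Y C where "finite Y" "\<forall>y\<in>Y. C y \<in> sets M \<and> (indicator (C y) :: 'a \<Rightarrow> 'k) \<in> lpf"
    "\<forall>x\<in>space M. s x = (\<Sum>y\<in>Y. y * indicator (C y) x)"
proof -
  let ?Y = "s ` space M - {0}" and ?C = "\<lambda>y. s -` {y} \<inter> space M"
  have f: "finite ?Y" using s(1) by (simp add: simple_function_def)
  have "(indicator (?C y) :: 'a \<Rightarrow> 'k) \<in> lpf" if "y \<in> ?Y" for y
  proof (rule lpf_mono[OF lpf_scale[OF s(2), of "inverse y"]])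
    show "(indicator (?C y) :: 'a \<Rightarrow> 'k) \<in> borel_measurable M" using simple_functionD(2)[OF s(1)] by (intro borel_measurable_indicator)
    show "AE x in M. norm (indicator (?C y) x :: 'k) \<le> norm (inverse y * s x)"
      using that by (intro AE_I2) (auto simp: indicator_def)
  qed
  moreover have "s x = (\<Sum>y\<in>?Y. y * indicator (?C y) x)" if "x \<in> space M" for x
  proof -
    have "(\<Sum>y\<in>?Y. y * indicator (?C y) x) = (\<Sum>y\<in>?Y. if y = s x then y else 0)"
      using that by (intro sum.cong) (auto simp: indicator_def)
    also have "\<dots> = s x" using that f by (simp add: sum.delta')
    finally show ?thesis by simp
  qed
  ultimately show thesis
    using f simple_functionD(2)[OF s(1)] by (intro that[of ?Y ?C]) blast+
qed

lemma simple_approx_finite: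
  assumes p: "p \<noteq> \<infinity>" and f: "(f :: 'a \<Rightarrow> 'k) \<in> lpf" and \<epsilon>: "0 < \<epsilon>"
  shows "\<exists>s. simple_function M s \<and> s \<in> lpf \<and> lp_norm p M (\<lambda>x. f x - s x) < \<epsilon>"
proof -
  note [measurable] = lpf_measurable[OF f]
  let ?q = "enn2real p"
  have q: "1 \<le> ?q" by (rule p_ge_1[OF p])
  obtain s where s': "\<forall>i. simple_function M (s i)" "\<forall>x\<in>space M. (\<lambda>i. s i x) \<longlonglongrightarrow> f x"
    "\<forall>i. \<forall>x\<in>space M. dist (s i x) 0 \<le> 2 * dist (f x) 0"
    using borel_measurable_implies_sequence_metric[OF lpf_measurable[OF f], of 0] by blast
  note s = s'[rule_format]
  have [measurable]: "s i \<in> borel_measurable M" for i using s(1) by (rule borel_measurable_simple_function)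
  have sl: "s i \<in> lpf" for i
    using s(3)[of _ i] by (intro lpf_mono[OF lpf_scale[OF f, of 2]]) (auto simp: norm_mult)
  have dl: "(\<lambda>x. f x - s i x) \<in> lpf" for i using lpf_add[OF f lpf_scale[OF sl[of i], of "-1"]] by simp
  have "(\<lambda>i. \<integral>\<^sup>+x. ennreal (norm (f x - s i x) powr ?q) \<partial>M) \<longlonglongrightarrow> (\<integral>\<^sup>+x. 0 \<partial>M)"
  proof (rule nn_integral_dominated_convergence[where w = "\<lambda>x. ennreal ((3 * norm (f x)) powr ?q)"])
    show "AE x in M. ennreal (norm (f x - s i x) powr ?q) \<le> ennreal ((3 * norm (f x)) powr ?q)" for i
    proof (rule AE_I2)
      fix x assume "x \<in> space M"
      then have "norm (f x - s i x) \<le> 3 * norm (f x)"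
        using s(3)[of x i] norm_triangle_ineq4[of "f x" "s i x"] by simp
      then show "ennreal (norm (f x - s i x) powr ?q) \<le> ennreal ((3 * norm (f x)) powr ?q)"
        using q by (intro ennreal_leI powr_mono2) auto
    qed
    have "(\<integral>\<^sup>+x. ennreal ((3 * norm (f x)) powr ?q) \<partial>M) = (\<integral>\<^sup>+x. ennreal (3 powr ?q) * ennreal (norm (f x) powr ?q) \<partial>M)"
      by (simp add: powr_mult ennreal_mult')
    also have "\<dots> = ennreal (3 powr ?q) * ennreal (lp_norm p M f powr ?q)"
      by (subst nn_integral_cmult) (auto simp: lp_norm_powr[OF p f])
    also have "\<dots> < \<infinity>" by (simp add: ennreal_mult_less_top)
    finally show "(\<integral>\<^sup>+x. ennreal ((3 * norm (f x)) powr ?q) \<partial>M) < \<infinity>" .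
    show "AE x in M. (\<lambda>i. ennreal (norm (f x - s i x) powr ?q)) \<longlonglongrightarrow> 0"
    proof (rule AE_I2)
      fix x assume "x \<in> space M"
      then have "(\<lambda>i. f x - s i x) \<longlonglongrightarrow> f x - f x" by (intro tendsto_intros s)
      then have "(\<lambda>i. norm (f x - s i x)) \<longlonglongrightarrow> 0" by (simp add: tendsto_norm_zero)
      then have "(\<lambda>i. norm (f x - s i x) powr ?q) \<longlonglongrightarrow> 0 powr ?q"
        using q by (intro tendsto_powr') auto
      then show "(\<lambda>i. ennreal (norm (f x - s i x) powr ?q)) \<longlonglongrightarrow> 0"
        using q by (simp add: tendsto_ennrealI flip: ennreal_0)
    qed
  qed auto
  then have "(\<lambda>i. ennreal (lp_norm p M (\<lambda>x. f x - s i x) powr ?q)) \<longlonglongrightarrow> 0"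
    by (simp add: lp_norm_powr[OF p dl])
  moreover have "0 < ennreal (\<epsilon> powr ?q)" using \<epsilon> by simp
  ultimately have "eventually (\<lambda>i. ennreal (lp_norm p M (\<lambda>x. f x - s i x) powr ?q) < ennreal (\<epsilon> powr ?q)) sequentially"
    by (rule order_tendstoD(2))
  then obtain i where "ennreal (lp_norm p M (\<lambda>x. f x - s i x) powr ?q) < ennreal (\<epsilon> powr ?q)"
    by (auto simp: eventually_sequentially)
  then have "lp_norm p M (\<lambda>x. f x - s i x) powr ?q < \<epsilon> powr ?q" by (simp add: ennreal_less_iff)
  then have "lp_norm p M (\<lambda>x. f x - s i x) < \<epsilon>"
    using q \<epsilon> powr_mono2[of ?q \<epsilon> "lp_norm p M (\<lambda>x. f x - s i x)"] by fastforce
  then show ?thesis using s(1) sl by blast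
qed

text \<open>
  Rounding all coordinates to multiples of \<open>1 / n\<close> leaves only finitely many values, as \<open>f\<close> is
  essentially bounded.
\<close>

lemma simple_approx_infinite:
  assumes p: "p = \<infinity>" and f: "(f :: 'a \<Rightarrow> 'k) \<in> lpf" and \<epsilon>: "0 < \<epsilon>"
  shows "\<exists>s. simple_function M s \<and> s \<in> lpf \<and> lp_norm p M (\<lambda>x. f x - s x) < \<epsilon>"
proof -
  note fm [measurable] = lpf_measurable[OF f]
  obtain r where r: "AE x in M. norm (f x) \<le> r" using f Linf_in_lpf_iff[OF p fm] by auto
  define f0 where "f0 x = (if norm (f x) \<le> r then f x else 0)" for x
  have [measurable]: "f0 \<in> borel_measurable M" unfolding f0_def by measurable
  have f0: "norm (f0 x) \<le> \<bar>r\<bar>" for x by (auto simp: f0_def)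
  obtain n :: nat where n: "real DIM('k) / \<epsilon> < real n" using reals_Archimedean2 by blast
  have n0: "0 < real n" using n \<epsilon> by (smt (verit) divide_nonneg_pos of_nat_0_le_iff)
  define s where "s x = (\<Sum>b\<in>Basis. (of_int \<lfloor>real n * inner (f0 x) b\<rfloor> / real n) *\<^sub>R b)" for x
  have [measurable]: "s \<in> borel_measurable M" unfolding s_def by measurable
  have ds: "norm (f0 x - s x) \<le> real DIM('k) / real n" for x
  proof -
    have "f0 x - s x = (\<Sum>b\<in>Basis. (inner (f0 x) b - of_int \<lfloor>real n * inner (f0 x) b\<rfloor> / real n) *\<^sub>R b)"
      unfolding s_def by (subst (1) euclidean_representation[of "f0 x", symmetric]) (simp add: sum_subtractf scaleR_diff_left)
    also have "norm \<dots> \<le> (\<Sum>b\<in>(Basis :: 'k set). 1 / real n)"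
    proof (rule sum_norm_le)
      fix b :: 'k assume b: "b \<in> Basis"
      have "\<bar>real n * inner (f0 x) b - of_int \<lfloor>real n * inner (f0 x) b\<rfloor>\<bar> \<le> 1" by linarith
      then have "\<bar>inner (f0 x) b - of_int \<lfloor>real n * inner (f0 x) b\<rfloor> / real n\<bar> \<le> 1 / real n"
      proof -
        have "inner (f0 x) b - of_int \<lfloor>real n * inner (f0 x) b\<rfloor> / real n
          = (real n * inner (f0 x) b - of_int \<lfloor>real n * inner (f0 x) b\<rfloor>) / real n"
          using n0 by (simp add: diff_divide_distrib)
        then have "\<bar>inner (f0 x) b - of_int \<lfloor>real n * inner (f0 x) b\<rfloor> / real n\<bar>
          = \<bar>real n * inner (f0 x) b - of_int \<lfloor>real n * inner (f0 x) b\<rfloor>\<bar> / real n" by simp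
        also have "\<dots> \<le> 1 / real n"
          using \<open>\<bar>real n * inner (f0 x) b - of_int \<lfloor>real n * inner (f0 x) b\<rfloor>\<bar> \<le> 1\<close>
          by (rule divide_right_mono) simp
        finally show ?thesis .
      qed
      then show "norm ((inner (f0 x) b - of_int \<lfloor>real n * inner (f0 x) b\<rfloor> / real n) *\<^sub>R b) \<le> 1 / real n"
        using b by simp
    qed
    finally show ?thesis by simp
  qed
  have ran: "\<lfloor>real n * inner (f0 x) b\<rfloor> \<in> {- \<lceil>real n * \<bar>r\<bar>\<rceil> .. \<lceil>real n * \<bar>r\<bar>\<rceil>}" if "b \<in> Basis" for x b
  proof -
    have "\<bar>inner (f0 x) b\<bar> \<le> \<bar>r\<bar>" using Basis_le_norm[OF that, of "f0 x"] f0[of x] by linarith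
    then have "\<bar>real n * inner (f0 x) b\<bar> \<le> real n * \<bar>r\<bar>" by (simp add: abs_mult mult_left_mono)
    then show ?thesis by (simp add: le_floor_iff floor_le_iff abs_le_iff) linarith
  qed
  have "finite (s ` space M)"
  proof (rule finite_subset)
    show "s ` space M \<subseteq> (\<lambda>c. \<Sum>b\<in>Basis. (of_int (c b) / real n) *\<^sub>R b) `
        (Basis \<rightarrow>\<^sub>E {- \<lceil>real n * \<bar>r\<bar>\<rceil> .. \<lceil>real n * \<bar>r\<bar>\<rceil>})"
    proof
      fix y assume "y \<in> s ` space M"
      then obtain x where "y = s x" by blast
      then have "y = (\<Sum>b\<in>Basis. (of_int (restrict (\<lambda>b. \<lfloor>real n * inner (f0 x) b\<rfloor>) Basis b) / real n) *\<^sub>R b)"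
        by (simp add: s_def)
      moreover have "restrict (\<lambda>b. \<lfloor>real n * inner (f0 x) b\<rfloor>) Basis \<in> (Basis \<rightarrow>\<^sub>E {- \<lceil>real n * \<bar>r\<bar>\<rceil> .. \<lceil>real n * \<bar>r\<bar>\<rceil>})"
        using ran by auto
      ultimately show "y \<in> (\<lambda>c. \<Sum>b\<in>Basis. (of_int (c b) / real n) *\<^sub>R b) `
        (Basis \<rightarrow>\<^sub>E {- \<lceil>real n * \<bar>r\<bar>\<rceil> .. \<lceil>real n * \<bar>r\<bar>\<rceil>})" by blast
    qed
  qed (auto intro!: finite_imageI finite_PiE)
  then have "simple_function M s" by (intro simple_function_borel_measurable) auto
  moreover have "s \<in> lpf"
  proof (subst Linf_in_lpf_iff[OF p])
    have "norm (s x) \<le> \<bar>r\<bar> + real DIM('k) / real n" for x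
      using ds[of x] f0[of x] norm_triangle_ineq4[of "f0 x" "f0 x - s x"] by simp
    then show "\<exists>r. AE x in M. norm (s x) \<le> r" by (auto intro!: AE_I2)
  qed simp
  moreover have "lp_norm p M (\<lambda>x. f x - s x) \<le> real DIM('k) / real n"
  proof (subst Linf_norm_le_iff[OF p])
    show "(\<lambda>x. f x - s x) \<in> lpf" using lpf_add[OF f lpf_scale[OF \<open>s \<in> lpf\<close>, of "-1"]] by simp
    show "AE x in M. norm (f x - s x) \<le> real DIM('k) / real n"
      using r
    proof eventually_elim
      case (elim x)
      then show ?case using ds[of x] by (simp add: f0_def)
    qed
  qed simp
  moreover have "real DIM('k) / real n < \<epsilon>" using n n0 \<epsilon> by (simp add: field_simps)
  ultimately show ?thesis by (intro exI[of _ s]) linarith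
qed

lemma op_eq_on_simple:
  assumes T1: "T1 \<in> vectors B" and T2: "T2 \<in> vectors B"
    and agree: "\<And>A. A \<in> sets M \<Longrightarrow> (indicator A :: 'a \<Rightarrow> 'k) \<in> lpf \<Longrightarrow> T1 (cl (indicator A)) = T2 (cl (indicator A))"
    and Y: "finite Y" "\<forall>y\<in>Y. C y \<in> sets M \<and> (indicator (C y) :: 'a \<Rightarrow> 'k) \<in> lpf"
  shows "(\<lambda>x. \<Sum>y\<in>Y. y * indicator (C y) x) \<in> lpf \<and>
    T1 (cl (\<lambda>x. \<Sum>y\<in>Y. y * indicator (C y) x)) = T2 (cl (\<lambda>x. \<Sum>y\<in>Y. y * indicator (C y) x))"
  using Y
proof (induction Y rule: finite_induct)
  case empty
  then show ?case by (simp add: opD_zero[OF T1] opD_zero[OF T2])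
next
  case (insert y Y)
  define s where "s x = (\<Sum>y\<in>Y. y * indicator (C y) x)" for x
  have s: "s \<in> lpf" "T1 (cl s) = T2 (cl s)" using insert by (auto simp: s_def[abs_def])
  have C: "C y \<in> sets M" "(indicator (C y) :: 'a \<Rightarrow> 'k) \<in> lpf" using insert.prems by auto
  have e: "(\<lambda>x. \<Sum>y\<in>insert y Y. y * indicator (C y) x) = (\<lambda>x. y * indicator (C y) x + s x)"
    unfolding s_def sum.insert[OF insert.hyps] ..
  have v: "cl s \<in> V" "cl (indicator (C y)) \<in> V" using s C by (simp_all add: lpf_measurable)
  have d: "cl (\<lambda>x. y * indicator (C y) x + s x) = y \<cdot> cl (indicator (C y)) \<oplus> cl s"
    using C s by (simp add: lpf_measurable)
  have "T1 (y \<cdot> cl (indicator (C y)) \<oplus> cl s) = T2 (y \<cdot> cl (indicator (C y)) \<oplus> cl s)"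
    using v s(2) agree[OF C] by (simp add: opD(3,4)[OF T1] opD(3,4)[OF T2] del: L0_scale_class L0_add_class)
  then show ?case unfolding e d using lpf_add[OF lpf_scale[OF C(2), of y] s(1)] by simp
qed

lemma op_eq_on_indicators:
  assumes T1: "T1 \<in> vectors B" and T2: "T2 \<in> vectors B"
    and agree: "\<And>A. A \<in> sets M \<Longrightarrow> (indicator A :: 'a \<Rightarrow> 'k) \<in> lpf \<Longrightarrow> T1 (cl (indicator A)) = T2 (cl (indicator A))"
    and F: "F \<in> V"
  shows "T1 F = T2 F"
proof -
  obtain f where f: "f \<in> lpf" "F = cl f" using F by (rule LpE)
  obtain K1 where K1: "0 < K1" "\<forall>F\<in>V. nrm (T1 F) \<le> K1 * nrm F" by (rule op_bound[OF T1])
  obtain K2 where K2: "0 < K2" "\<forall>F\<in>V. nrm (T2 F) \<le> K2 * nrm F" by (rule op_bound[OF T2])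
  have v: "T1 F \<in> V" "T2 F \<in> V" using opD(1)[OF T1 F] opD(1)[OF T2 F] .
  have "nrm (T1 F \<ominus> T2 F) \<le> 4 * max K1 K2 * \<epsilon>" if \<epsilon>: "0 < \<epsilon>" for \<epsilon>
  proof -
    obtain s where s: "simple_function M s" "s \<in> lpf" "lp_norm p M (\<lambda>x. f x - s x) < \<epsilon>"
      using simple_approx_finite[OF _ f(1) \<epsilon>] simple_approx_infinite[OF _ f(1) \<epsilon>] by blast
    obtain Y C where YC: "finite Y" "\<forall>y\<in>Y. C y \<in> sets M \<and> (indicator (C y) :: 'a \<Rightarrow> 'k) \<in> lpf"
      "\<forall>x\<in>space M. s x = (\<Sum>y\<in>Y. y * indicator (C y) x)" by (rule simple_sum[OF s(1,2)])
    have se: "cl s = cl (\<lambda>x. \<Sum>y\<in>Y. y * indicator (C y) x)" by (rule ae_class_eqI, rule AE_I2) (use YC(3) in blast)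
    have sT: "T1 (cl s) = T2 (cl s)" unfolding se using op_eq_on_simple[OF T1 T2 agree YC(1,2)] by blast
    have sv: "cl s \<in> V" using s by (simp add: lpf_measurable)
    define G where "G = F \<ominus> cl s"
    have G: "G \<in> V" using F sv by (simp add: G_def)
    have nG: "nrm G < \<epsilon>" using f s by (simp add: G_def nrm_class lpf_measurable)
    have TG: "T1 G \<in> V" "T2 G \<in> V" using opD(1)[OF T1 G] opD(1)[OF T2 G] .
    have FG: "F = G \<oplus> cl s" using F sv by (simp add: G_def)
    have TS: "T1 (cl s) \<in> V" "T2 (cl s) \<in> V" using opD(1)[OF T1 sv] opD(1)[OF T2 sv] .
    have "T1 F = T1 G \<oplus> T2 (cl s)" "T2 F = T2 G \<oplus> T2 (cl s)"
      unfolding FG using G sv sT by (simp_all only: opD(3)[OF T1] opD(3)[OF T2])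
    then have "T1 F \<ominus> T2 F = T1 G \<ominus> T2 G"
      using TG TS by - (erule LpE, erule LpE, erule LpE, erule LpE, simp add: algebra_simps)
    moreover have "nrm (T1 G \<ominus> T2 G) \<le> 4 * max (nrm (T1 G)) (nrm ((-1) \<cdot> T2 G))"
      using TG by (intro nrm_add_le) auto
    moreover have "nrm ((-1) \<cdot> T2 G) = nrm (T2 G)" using nrm_scale[OF TG(2), of "-1"] by simp
    moreover have "nrm (T1 G) \<le> max K1 K2 * \<epsilon>" "nrm (T2 G) \<le> max K1 K2 * \<epsilon>"
    proof -
      have "nrm (T1 G) \<le> K1 * nrm G" "nrm (T2 G) \<le> K2 * nrm G" using K1 K2 G by auto
      moreover have "K1 * nrm G \<le> max K1 K2 * \<epsilon>" "K2 * nrm G \<le> max K1 K2 * \<epsilon>"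
        using nG K1 K2 nrm_nonneg[OF G] by (intro mult_mono; auto)+
      ultimately show "nrm (T1 G) \<le> max K1 K2 * \<epsilon>" "nrm (T2 G) \<le> max K1 K2 * \<epsilon>" by linarith+
    qed
    ultimately show ?thesis by simp
  qed
  then have "nrm (T1 F \<ominus> T2 F) \<le> 0"
  proof -
    assume *: "\<And>\<epsilon>. 0 < \<epsilon> \<Longrightarrow> nrm (T1 F \<ominus> T2 F) \<le> 4 * max K1 K2 * \<epsilon>"
    define c where "c = 4 * max K1 K2"
    have c: "0 < c" using K1 by (simp add: c_def less_max_iff_disj)
    have "nrm (T1 F \<ominus> T2 F) \<le> \<delta>" if "0 < \<delta>" for \<delta>
      using *[of "\<delta> / c"] c that by (simp add: c_def[symmetric])
    then show ?thesis using field_le_epsilon[of "nrm (T1 F \<ominus> T2 F)" 0] by simp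
  qed
  moreover have sv: "T1 F \<ominus> T2 F \<in> V" using v by simp
  ultimately have "nrm (T1 F \<ominus> T2 F) = 0" using nrm_nonneg[OF sv] by linarith
  then have "T1 F \<ominus> T2 F = nul" using nrm_eq_0_iff[OF sv] by simp
  then show ?thesis using class_algebra(6)[OF v(1) v(2)] v class_algebra(2)[OF v(2)] by simp
qed

section \<open>Mutually inverse isometries between bands\<close>

text \<open>
  \<open>T\<close> and \<open>T'\<close> restrict to mutually inverse isometries between \<open>L\<^sup>p(D')\<close> and \<open>L\<^sup>p(D)\<close>, and
  vanish on functions that are supported off \<open>D'\<close> and off \<open>D\<close>, respectively.
\<close>

definition isometric_pair where
  "isometric_pair T T' D D' \<longleftrightarrow> D \<in> sets M \<and> D' \<in> sets M \<and> contractive B T \<and> contractive B T' \<and>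
     (\<forall>F\<in>V. T (T' F) = restr D F) \<and> (\<forall>F\<in>V. T' (T F) = restr D' F) \<and>
     (\<forall>F\<in>V. T (T' (T F)) = T F) \<and> (\<forall>F\<in>V. T' (T (T' F)) = T' F)"

lemma isometric_pair_sym: "isometric_pair T T' D D' \<Longrightarrow> isometric_pair T' T D' D"
  by (auto simp: isometric_pair_def)

text \<open>
  \<open>T'\<close> restricts a vector to \<open>D\<close> and then applies the inverse of the bijection that \<open>T\<close> induces
  between the vectors supported in \<open>D'\<close> and those supported in \<open>D\<close>.
\<close>

lemma isometric_pairI:
  assumes D: "D \<in> sets M" "D' \<in> sets M" and T: "T \<in> vectors B"
    and iso: "\<And>F. F \<in> V \<Longrightarrow> nrm (T F) = nrm (restr D' F)"
    and ran: "\<And>F. F \<in> V \<Longrightarrow> restr D (T F) = T F"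
    and onto: "\<And>G. G \<in> V \<Longrightarrow> \<exists>F\<in>V. T F = restr D G"
  obtains T' where "isometric_pair T T' D D'"
proof -
  have sub: "X \<ominus> Y \<in> V" "X \<ominus> Y = nul \<Longrightarrow> X = Y" if "X \<in> V" "Y \<in> V" for X Y
    using that class_algebra(6)[OF that(1) that(2)] class_algebra(2)[OF that(2)] by simp_all
  have Tsub: "T (X \<ominus> Y) = T X \<ominus> T Y" if "X \<in> V" "Y \<in> V" for X Y
    using that by (simp add: opD(3)[OF T] opD(4)[OF T])
  have uniq: "X = Y" if "X \<in> V" "Y \<in> V" "restr D' X = X" "restr D' Y = Y" "T X = T Y" for X Y
  proof (rule sub(2)[OF that(1,2)])
    have "restr D' (X \<ominus> Y) = X \<ominus> Y" using that D by (simp add: restr_linear)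
    then have "nrm (X \<ominus> Y) = nrm (T X \<ominus> T Y)" using iso[OF sub(1)[OF that(1,2)]] by (simp add: Tsub that(1,2))
    also have "\<dots> = 0" using that(5) opD(1)[OF T that(2)] by simp
    finally show "X \<ominus> Y = nul" using nrm_eq_0_iff[OF sub(1)[OF that(1,2)]] by simp
  qed
  have Tr: "T (restr D' F) = T F" if F: "F \<in> V" for F
  proof -
    have r: "restr D' F \<in> V" using F D by simp
    have z: "restr D' (restr D' F \<ominus> F) = nul"
      using F D by (simp add: restr_linear restr_restr)
    have "nrm (T (restr D' F \<ominus> F)) = 0" using iso[OF sub(1)[OF r F]] z by simp
    then have "T (restr D' F) \<ominus> T F = nul"
      using opD(1)[OF T sub(1)[OF r F]] by (simp add: nrm_eq_0_iff Tsub[OF r F])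
    then show ?thesis by (rule sub(2)[OF opD(1)[OF T r] opD(1)[OF T F]])
  qed
  define T' where "T' = (\<lambda>G\<in>V. SOME F. F \<in> V \<and> restr D' F = F \<and> T F = restr D G)"
  have T': "T' G \<in> V \<and> restr D' (T' G) = T' G \<and> T (T' G) = restr D G" if G: "G \<in> V" for G
  proof -
    obtain F where F: "F \<in> V" "T F = restr D G" using onto[OF G] by blast
    have "\<exists>F. F \<in> V \<and> restr D' F = F \<and> T F = restr D G"
      by (rule exI[of _ "restr D' F"]) (use F D Tr in \<open>simp add: restr_restr\<close>)
    from someI_ex[OF this] show ?thesis using G by (simp add: T'_def)
  qed
  have T'_eq: "T' G = F" if "G \<in> V" "F \<in> V" "restr D' F = F" "T F = restr D G" for F G
    using uniq[of "T' G" F] T'[OF that(1)] that by simp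
  show thesis
  proof (rule that, unfold isometric_pair_def, intro conjI D ballI)
    show "contractive B T" unfolding contractive_iff using T iso nrm_restr_le[OF D(2)] by simp
    show "contractive B T'"
    proof (rule contractiveI)
      show "T' \<in> extensional V" by (simp add: T'_def)
      show "T' F \<in> V" if "F \<in> V" for F using T'[OF that] by blast
      show "T' (F \<oplus> G) = T' F \<oplus> T' G" if "F \<in> V" "G \<in> V" for F G
        by (rule T'_eq) (use that T'[OF that(1)] T'[OF that(2)] D in \<open>auto simp: restr_linear opD(3)[OF T]\<close>)
      show "T' (c \<cdot> F) = c \<cdot> T' F" if "F \<in> V" for F c
        by (rule T'_eq) (use that T'[OF that(1)] D in \<open>auto simp: restr_linear opD(4)[OF T]\<close>)
      show "nrm (T' F) \<le> nrm F" if "F \<in> V" for F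
        using iso[of "T' F"] T'[OF that] nrm_restr_le[OF D(1) that] by simp
    qed
    fix F assume F: "F \<in> V"
    note TF = opD(1)[OF T F]
    show "T (T' F) = restr D F" using T'[OF F] by blast
    show "T' (T F) = restr D' F" by (rule T'_eq) (use TF F D ran Tr in \<open>simp_all add: restr_restr\<close>)
    show "T (T' (T F)) = T F" using T'[OF TF] ran[OF F] by simp
    show "T' (T (T' F)) = T' F" by (rule T'_eq) (use T'[OF F] opD(1)[OF T, of "T' F"] F D in \<open>auto simp: restr_restr\<close>)
  qed
qed

end

section \<open>Spatial partial isometries are isometric\<close>

lemma set_iso_rel_sym:
  fixes f g :: "'a \<Rightarrow> 'k::{real_normed_field,euclidean_space}"
  assumes iso: "set_iso M D D' \<Phi> \<Phi>'" and r: "set_iso.rel M D' D \<Phi>' g f"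
    and off: "AE x in M. x \<notin> D \<longrightarrow> g x = 0"
  shows "set_iso.rel M D D' \<Phi> f g"
proof -
  interpret set_iso M D D' \<Phi> \<Phi>' by fact
  interpret i: set_iso M D' D \<Phi>' \<Phi> by (rule inverse_iso)
  note m = i.rel_measurable[OF r]
  show ?thesis
    unfolding rel_def
  proof (intro conjI m off ballI)
    fix U :: "'k set" assume U: "U \<in> sets borel"
    let ?A = "{x \<in> D'. f x \<in> U}" and ?B = "{x \<in> D. g x \<in> U}"
    have A: "?A \<in> sets M" by (rule vimage_sets[OF m(2) U])
    have B: "?B \<in> sets M" by (rule i.vimage_sets[OF m(1) U])
    have "AE x in M. x \<in> \<Phi>' ?B \<longleftrightarrow> x \<in> ?A" using r U by (simp add: i.rel_def)
    then have "AE x in M. x \<in> \<Phi> (\<Phi>' ?B) \<longleftrightarrow> x \<in> \<Phi> ?A"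
      using A B \<Phi>'[OF B] by (intro AE_cong) auto
    with AE_inv[OF B] show "AE x in M. x \<in> \<Phi> ?A \<longleftrightarrow> x \<in> D \<and> g x \<in> U" by (auto elim: eventually_elim2)
  qed
qed

text \<open>
  Only the modulus of the weight \<open>W\<close> is prescribed, so that the locale covers all spatial
  partial isometries with the underlying isomorphism \<open>\<Phi>\<close>.
\<close>

locale spatial = lp_scalar p M scalar + set_iso M D D' \<Phi> \<Phi>'
  for p :: ennreal and M :: "'a measure" and scalar :: "'k::{real_normed_field,euclidean_space} itself"
    and D D' \<Phi> \<Phi>' +
  fixes W :: "'a \<Rightarrow> 'k"
  assumes loc: "localizable M" and W_measurable [measurable]: "W \<in> borel_measurable M"
    and W_off: "\<And>x. x \<notin> D \<Longrightarrow> W x = 0"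
    and W_norm: "AE x in M. x \<in> D \<longrightarrow> norm (W x) = rho x powr enn2real (inverse p)"
begin

lemma W_nonzero: "AE x in M. x \<in> D \<longrightarrow> W x \<noteq> 0"
  using W_norm rho_pos[OF loc] by eventually_elim auto

text \<open>
  For finite \<open>p\<close> the derivative \<open>|W|\<^sup>p\<close> compensates for the change of variables. For \<open>p = \<infinity>\<close> the
  weight has modulus one, and almost everywhere bounds are transported.
\<close>

lemma lp_size_transport:
  assumes fg: "rel f g"
  shows "lp_size p M (\<lambda>x. W x * g x) = lp_size p M (\<lambda>x. indicator D' x * f x)"
proof (cases "p = \<infinity>")
  case True
  note [measurable] = rel_measurable[OF fg]
  have iff: "(AE x in M. ennreal (norm (W x * g x)) \<le> c) \<longleftrightarrow> (AE x in M. ennreal (norm (indicator D' x * f x)) \<le> c)" for c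
  proof -
    have comp [measurable]: "(\<lambda>s. s ()) \<in> borel_measurable (Pi\<^sub>M UNIV (\<lambda>_::unit. borel :: 'k measure))"
      by (rule measurable_component_singleton) simp
    have X: "Measurable.pred (Pi\<^sub>M UNIV (\<lambda>_::unit. borel :: 'k measure)) (\<lambda>s. ennreal (norm (s ())) \<le> c)" by measurable
    have W1: "AE x in M. x \<in> D \<longrightarrow> norm (W x) = 1"
      using W_norm rho_pos[OF loc] by eventually_elim (auto simp: True)
    have "(AE x in M. ennreal (norm (W x * g x)) \<le> c) \<longleftrightarrow> (AE x in M. x \<in> D \<longrightarrow> ennreal (norm (g x)) \<le> c)"
      by (rule eventually_subst, use W1 in eventually_elim) (auto simp: W_off norm_mult)
    also have "\<dots> \<longleftrightarrow> (AE x in M. x \<in> D' \<longrightarrow> ennreal (norm (f x)) \<le> c)"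
      using rel_AE[where f = "\<lambda>_::unit. f" and g = "\<lambda>_. g", OF fg X] by simp
    also have "\<dots> \<longleftrightarrow> (AE x in M. ennreal (norm (indicator D' x * f x)) \<le> c)"
      by (rule eventually_subst, rule AE_I2) (auto simp: indicator_def)
    finally show ?thesis .
  qed
  have le: "lp_size p M a \<le> lp_size p M b"
    if [measurable]: "a \<in> borel_measurable M" "b \<in> borel_measurable M"
      and *: "\<And>c. (AE x in M. ennreal (norm (b x)) \<le> c) \<Longrightarrow> (AE x in M. ennreal (norm (a x)) \<le> c)" for a b :: "'a \<Rightarrow> 'k"
    unfolding lp_size_def if_P[OF True] by (intro esssup_I * esssup_AE) simp
  show ?thesis
  proof (rule antisym)
    show "lp_size p M (\<lambda>x. W x * g x) \<le> lp_size p M (\<lambda>x. indicator D' x * f x)"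
      by (rule le) (simp_all add: iff)
    show "lp_size p M (\<lambda>x. indicator D' x * f x) \<le> lp_size p M (\<lambda>x. W x * g x)"
      by (rule le) (simp_all only: iff, simp_all)
  qed
next
  case False
  note [measurable] = rel_measurable[OF fg]
  define q where "q = enn2real p"
  have q: "1 \<le> q" using p_ge_1[OF False] by (simp add: q_def)
  have pq: "p = ennreal q" unfolding q_def using False by (simp add: less_top)
  have e: "enn2real (inverse p) = 1 / q" using q unfolding pq by (subst inverse_ennreal) (auto simp: inverse_eq_divide)
  have "(\<integral>\<^sup>+x. ennreal (norm (W x * g x) powr q) \<partial>M) = (\<integral>\<^sup>+x. ennreal (rho x) * indicator D x * ennreal (norm (g x) powr q) \<partial>M)"
  proof (rule nn_integral_cong_AE)
    show "AE x in M. ennreal (norm (W x * g x) powr q) = ennreal (rho x) * indicator D x * ennreal (norm (g x) powr q)"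
      using W_norm
    proof eventually_elim
      case (elim x)
      show ?case
      proof (cases "x \<in> D")
        case True
        have "norm (W x) powr q = rho x" using elim True q by (simp add: e powr_powr)
        then show ?thesis using True by (simp add: norm_mult powr_mult ennreal_mult')
      qed (simp add: W_off)
    qed
  qed
  also have "\<dots> = (\<integral>\<^sup>+x. indicator D' x * ennreal (norm (f x) powr q) \<partial>M)"
    by (rule rel_nn_integral[OF loc fg]) simp
  also have "\<dots> = (\<integral>\<^sup>+x. ennreal (norm (indicator D' x * f x) powr q) \<partial>M)"
    using q by (intro nn_integral_cong) (auto simp: indicator_def)
  finally show ?thesis using False by (simp add: lp_size_def q_def)
qed

text \<open>
  To reach a given function \<open>k\<close> supported in \<open>D\<close>, divide it by \<open>W\<close> and transport the quotient
  back to \<open>D'\<close>.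
\<close>

lemma spatial_pair:
  assumes S: "is_T\<^sub>\<Phi> M D' \<Phi> S" and ext: "T \<in> extensional V"
    and T: "\<And>F. F \<in> V \<Longrightarrow> T F = L0_mult M (cl W) (S F)"
  obtains T' where "isometric_pair T T' D D'"
proof -
  have Tc: "T (cl f) = cl (\<lambda>x. W x * g x)" if "rel f g" "f \<in> lpf" for f g
  proof -
    note [measurable] = rel_measurable[OF that(1)]
    show ?thesis using T[of "cl f"] that by (simp add: rel_is_T[OF S that(1)])
  qed
  have VE: "\<exists>f g. f \<in> lpf \<and> rel f g \<and> F = cl f" if "F \<in> V" for F
    using that by (rule LpE) (use rel_ex lpf_measurable in blast)
  have Wg: "(\<lambda>x. W x * g x) \<in> lpf" "lp_norm p M (\<lambda>x. W x * g x) = lp_norm p M (\<lambda>x. indicator D' x * f x)"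
    if fg: "rel f g" "f \<in> lpf" for f g
  proof -
    note [measurable] = rel_measurable[OF fg(1)]
    show "(\<lambda>x. W x * g x) \<in> lpf"
      using lpf_indicator_mult[OF D' fg(2)] lp_size_transport[OF fg(1)] by (simp add: lpf_def)
    show "lp_norm p M (\<lambda>x. W x * g x) = lp_norm p M (\<lambda>x. indicator D' x * f x)"
      unfolding lp_norm_def lp_size_transport[OF fg(1)] ..
  qed
  have TV: "T F \<in> V" and Tn: "nrm (T F) = nrm (restr D' F)" and Tr: "restr D (T F) = T F" if F: "F \<in> V" for F
  proof -
    obtain f g where fg: "f \<in> lpf" "rel f g" "F = cl f" using VE[OF F] by blast
    note [measurable] = rel_measurable[OF fg(2)]
    show "T F \<in> V" unfolding fg(3) Tc[OF fg(2,1)] using Wg[OF fg(2,1)] by simp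
    show "nrm (T F) = nrm (restr D' F)"
      unfolding fg(3) Tc[OF fg(2,1)] using Wg[OF fg(2,1)] D' by (simp add: nrm_class restr_class)
    show "restr D (T F) = T F"
    proof -
      have "AE x in M. indicator D x * (W x * g x) = W x * g x"
        by (rule AE_I2) (auto simp: W_off indicator_def)
      then show ?thesis unfolding fg(3) Tc[OF fg(2,1)] using D by (simp add: restr_class ae_class_eqI)
    qed
  qed
  have "T \<in> vectors B"
  proof (rule opI[where K = 1])
    show "nrm (T F) \<le> 1 * nrm F" if "F \<in> V" for F using Tn[OF that] nrm_restr_le[OF D' that] by simp
    fix F assume F: "F \<in> V"
    obtain f g where fg: "f \<in> lpf" "rel f g" "F = cl f" using VE[OF F] by blast
    note [measurable] = rel_measurable[OF fg(2)]
    show "T (c \<cdot> F) = c \<cdot> T F" for c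
      unfolding fg(3) Tc[OF fg(2,1)] using Tc[OF rel_scale[OF fg(2), of c] lpf_scale[OF fg(1)]] 
      by (simp add: mult.left_commute)
    fix G assume G: "G \<in> V"
    obtain f' g' where fg': "f' \<in> lpf" "rel f' g'" "G = cl f'" using VE[OF G] by blast
    note [measurable] = rel_measurable[OF fg'(2)]
    show "T (F \<oplus> G) = T F \<oplus> T G"
      unfolding fg(3) fg'(3) Tc[OF fg(2,1)] Tc[OF fg'(2,1)]
      using Tc[OF rel_add[OF fg(2) fg'(2)] lpf_add[OF fg(1) fg'(1)]] by (simp add: distrib_left)
  qed (use TV ext in auto)
  then show thesis
  proof (rule isometric_pairI[OF D D' _ Tn Tr _ that])
    fix G assume G: "G \<in> V"
    obtain k where k: "k \<in> lpf" "G = cl k" using G by (rule LpE)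
    note [measurable] = lpf_measurable[OF k(1)]
    interpret i: set_iso M D' D \<Phi>' \<Phi> by (rule inverse_iso)
    define g where "g x = (if x \<in> D then k x / W x else 0)" for x
    have [measurable]: "g \<in> borel_measurable M" unfolding g_def by measurable
    obtain f where if_: "i.rel g f" using i.rel_ex[of g] by auto
    have fg: "rel f g" by (rule set_iso_rel_sym[OF set_iso_axioms if_]) (simp add: g_def)
    note [measurable] = rel_measurable[OF fg]
    have Wgk: "AE x in M. W x * g x = indicator D x * k x"
      using W_nonzero by eventually_elim (auto simp: g_def indicator_def)
    have "(\<lambda>x. indicator D x * k x) \<in> lpf" by (rule lpf_indicator_mult[OF D k(1)])
    then have "(\<lambda>x. W x * g x) \<in> lpf"
      by (rule lpf_mono) (use Wgk in \<open>auto elim!: eventually_mono\<close>)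
    then have "(\<lambda>x. indicator D' x * f x) \<in> lpf" using lp_size_transport[OF fg] by (simp add: lpf_def)
    moreover have "AE x in M. indicator D' x * f x = f x"
      using i.rel_off[OF if_] by eventually_elim (auto simp: indicator_def)
    then have "AE x in M. norm (f x) \<le> norm (indicator D' x * f x)" by eventually_elim (auto simp: norm_mult)
    ultimately have fl: "f \<in> lpf" using lpf_mono[OF _ rel_measurable(1)[OF fg]] by blast
    have "T (cl f) = restr D G" unfolding Tc[OF fg fl] k(2) using D Wgk by (simp add: restr_class ae_class_eqI)
    then show "\<exists>F\<in>V. T F = restr D G" using fl by (intro bexI[of _ "cl f"]) auto
  qed
qed

end

section \<open>Isometric pairs are spatial\<close>

context lp_scalar begin

lemma lp_split_supports:
  assumes E: "E \<in> sets M" and X: "X \<in> V" "restr E X = X" and Y: "Y \<in> V" "restr E Y = nul"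
  shows "lp_split (nrm (X \<oplus> Y)) (nrm X) (nrm Y)"
proof -
  have "restr E (X \<oplus> Y) = X" using X Y E by (simp add: restr_linear)
  moreover have "(X \<oplus> Y) \<ominus> X = Y" using X(1) Y(1) by - (erule LpE, erule LpE, simp)
  ultimately show ?thesis using lp_split_restr[OF E, of "X \<oplus> Y"] X Y by simp
qed

lemma class_split: "X \<in> V \<Longrightarrow> Y \<in> V \<Longrightarrow> X = Y \<oplus> (X \<ominus> Y)"
  by (erule LpE, erule LpE) simp

lemma lp_split_trans:
  assumes "0 \<le> a" "0 \<le> b" "0 \<le> c" "0 \<le> d"
    and "lp_split x d c" "lp_split d a b" "lp_split y b c"
  shows "lp_split x a y"
  using assms unfolding lp_split_def by (auto split: if_splits)

context
  fixes T T' D D'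
  assumes pair: "isometric_pair T T' D D'"
begin

lemma pair_sets: "D \<in> sets M" "D' \<in> sets M"
  using pair by (auto simp: isometric_pair_def)

lemma pair_vectors: "T \<in> vectors B" "T' \<in> vectors B"
  using pair by (auto simp: isometric_pair_def contractive_iff)

lemma pair_V [simp]: "F \<in> V \<Longrightarrow> T F \<in> V" "F \<in> V \<Longrightarrow> T' F \<in> V"
  using opD(1) pair_vectors by blast+

lemma pair_comp:
  assumes "F \<in> V"
  shows "T (T' F) = restr D F" "T' (T F) = restr D' F"
    "restr D (T F) = T F" "restr D' (T' F) = T' F" "T (restr D' F) = T F" "T' (restr D F) = T' F"
proof -
  have c: "T (T' G) = restr D G" "T' (T G) = restr D' G" "T (T' (T G)) = T G" "T' (T (T' G)) = T' G" if "G \<in> V" for G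
    using pair that by (auto simp: isometric_pair_def)
  show "T (T' F) = restr D F" "T' (T F) = restr D' F" using c assms by auto
  show "restr D (T F) = T F" using c(1)[of "T F"] c(3)[OF assms] assms by simp
  show "restr D' (T' F) = T' F" using c(2)[of "T' F"] c(4)[OF assms] assms by simp
  show "T (restr D' F) = T F" using c(2)[OF assms] c(3)[OF assms] by simp
  show "T' (restr D F) = T' F" using c(1)[OF assms] c(4)[OF assms] by simp
qed

lemma pair_norm:
  assumes F: "F \<in> V"
  shows "nrm (T F) = nrm (restr D' F)"
proof (rule antisym)
  have le: "nrm (T G) \<le> nrm G" "nrm (T' G) \<le> nrm G" if "G \<in> V" for G
    using pair that by (auto simp: isometric_pair_def contractive_iff)
  show "nrm (T F) \<le> nrm (restr D' F)" using le(1)[of "restr D' F"] F pair_sets pair_comp[OF F] by simp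
  show "nrm (restr D' F) \<le> nrm (T F)" using le(2)[of "T F"] F pair_comp[OF F] by simp
qed

end

context
  fixes T T' D D'
  assumes loc: "localizable M" and p2: "p \<noteq> 2" and pair: "isometric_pair T T' D D'"
begin

lemmas psets = pair_sets[OF pair] and pvectors = pair_vectors[OF pair] and pcomp = pair_comp[OF pair]
  and pnorm = pair_norm[OF pair] and pV [simp] = pair_V[OF pair]

text \<open>
  \<open>P = T 1\<^sub>C T'\<close> is an \<open>L\<^sup>p\<close>-projection. Indeed, \<open>T\<close> carries the decomposition of \<open>T' F\<close> into
  its parts on \<open>C\<close> and off \<open>C\<close> isometrically to a decomposition of \<open>1\<^sub>D F\<close>, one part of which is
  \<open>P F\<close>, and the part of \<open>F\<close> off \<open>D\<close> is added to the other one.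
\<close>

lemma pair_conj_mult:
  assumes C: "C \<in> sets M" "C \<subseteq> D'"
  shows "\<exists>E. E \<in> sets M \<and> E \<subseteq> D \<and> (\<forall>F\<in>V. T (restr C (T' F)) = restr E F)"
proof -
  note s = psets
  define P where "P = (\<lambda>F\<in>V. T (restr C (T' F)))"
  have P: "P F = T (restr C (T' F))" if "F \<in> V" for F using that by (simp add: P_def)
  have CD: "restr D' (restr C F) = restr C F" if "F \<in> V" for F
    using that C s by (simp add: restr_restr Int_absorb1)
  have Pv: "P \<in> vectors B"
  proof (rule opI[where K = 1])
    show "P F \<in> V" if "F \<in> V" for F using that C by (simp add: P)
    show "P \<in> extensional V" by (simp add: P_def)
    show "P (F \<oplus> G) = P F \<oplus> P G" if "F \<in> V" "G \<in> V" for F G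
      using that C by (simp add: P opD(3)[OF pvectors(1)] opD(3)[OF pvectors(2)] restr_linear)
    show "P (c \<cdot> F) = c \<cdot> P F" if "F \<in> V" for F c
      using that C by (simp add: P opD(4)[OF pvectors(1)] opD(4)[OF pvectors(2)] restr_linear)
    show "nrm (P F) \<le> 1 * nrm F" if F: "F \<in> V" for F
    proof -
      have "nrm (P F) = nrm (restr C (T' F))" using F C CD pnorm[of "restr C (T' F)"] by (simp add: P)
      also have "\<dots> \<le> nrm (T' F)" using F C by (simp add: nrm_restr_le)
      also have "\<dots> \<le> nrm F" using pair F by (auto simp: isometric_pair_def contractive_iff)
      finally show ?thesis by simp
    qed
  qed
  have "Lp_projection p (Lp_space p M) P"
    unfolding Lp_projection_iff
  proof (intro conjI Pv ballI)
    fix F assume F: "F \<in> V"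
    have PF: "P F \<in> V" by (rule opD(1)[OF Pv F])
    show "P (P F) = P F"
      using F C PF pcomp(2)[of "restr C (T' F)"] by (simp add: P CD restr_restr)
    define A where "A = restr C (T' F)"
    have A: "A \<in> V" "restr D' A = A" using F C CD by (auto simp: A_def)
    define A' where "A' = T' F \<ominus> A"
    have A': "A' \<in> V" "restr D' A' = A'" using F A s pcomp(4)[OF F] by (auto simp: A'_def restr_linear)
    define N where "N = F \<ominus> restr D F"
    have N: "N \<in> V" "restr D N = nul" using F s by (auto simp: N_def restr_linear restr_restr)
    have TA: "T A = P F" using F by (simp add: A_def P)
    have "T' F = A \<oplus> A'" using F A(1) unfolding A'_def by (intro class_split) simp_all
    then have DF: "restr D F = P F \<oplus> T A'"
      using F A A' pcomp(1)[OF F] by (simp add: opD(3)[OF pvectors(1)] TA)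
    have TA': "T A' \<in> V" using A' by simp
    have e1: "F = restr D F \<oplus> N" unfolding N_def using F s by (intro class_split) simp_all
    have e2: "F \<ominus> P F = T A' \<oplus> N"
      unfolding arg_cong[OF e1, of "\<lambda>X. X \<ominus> P F"] DF
      using PF TA' N(1) by - (erule LpE, erule LpE, erule LpE, simp)
    have "lp_split (nrm F) (nrm (restr D F)) (nrm N)"
      using lp_split_restr[OF s(1) F] by (simp add: N_def)
    moreover have "lp_split (nrm (T' F)) (nrm A) (nrm A')"
      using lp_split_restr[OF C(1), of "T' F"] F by (simp add: A_def A'_def)
    then have "lp_split (nrm (restr D F)) (nrm (P F)) (nrm (T A'))"
      using pnorm[OF A(1)] pnorm[OF A'(1)] pnorm[of "T' F"] F A A' pcomp(1,4)[OF F] by (simp add: TA)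
    moreover have "lp_split (nrm (F \<ominus> P F)) (nrm (T A')) (nrm N)"
      unfolding e2 using TA' N pcomp(3)[OF A'(1)] by (intro lp_split_supports[OF s(1)])
    ultimately show "lp_split (nrm F) (nrm (P F)) (nrm (F \<ominus> P F))"
      using lp_split_trans[of "nrm (P F)" "nrm (T A')" "nrm N" "nrm (restr D F)"] PF TA' N F s by simp
  qed
  then obtain E where E: "E \<in> sets M" "\<forall>F\<in>V. P F = restr E F"
    by (rule Lp_projection_mult[OF p2 loc])
  have "T (restr C (T' F)) = restr (D \<inter> E) F" if F: "F \<in> V" for F
  proof -
    have "restr (D \<inter> E) F = restr D (P F)" using E F s by (simp add: restr_restr)
    also have "\<dots> = T (restr C (T' F))" using F C pcomp(3)[of "restr C (T' F)"] by (simp add: P)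
    finally show ?thesis by simp
  qed
  then show ?thesis using E s by (intro exI[of _ "D \<inter> E"]) auto
qed

definition pair_set :: "'a set \<Rightarrow> 'a set" where
  "pair_set C = (SOME E. E \<in> sets M \<and> E \<subseteq> D \<and> (\<forall>F\<in>V. T (restr C (T' F)) = restr E F))"

lemma pair_set:
  assumes "C \<in> sets M" "C \<subseteq> D'"
  shows "pair_set C \<in> sets M" "pair_set C \<subseteq> D" "F \<in> V \<Longrightarrow> T (restr C (T' F)) = restr (pair_set C) F"
  using someI_ex[OF pair_conj_mult[OF assms]] by (auto simp: pair_set_def)

lemma pair_set_local:
  assumes "C \<in> sets M" "C \<subseteq> D'" "F \<in> V"
  shows "T (restr C F) = restr (pair_set C) (T F)"
proof -
  have "restr (pair_set C) (T F) = T (restr C (restr D' F))"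
    using pair_set(3)[OF assms(1,2), of "T F"] assms pcomp(2)[of F] by simp
  also have "restr C (restr D' F) = restr C F" using assms psets by (simp add: restr_restr Int_absorb2)
  finally show ?thesis by simp
qed

text \<open>
  \<open>C \<subseteq> C'\<close> means that \<open>1\<^sub>C = 1\<^sub>C\<^sub>' 1\<^sub>C\<close>, and such identities survive conjugation by \<open>T\<close> and
  \<open>T'\<close>.
\<close>

lemma pair_set_mono:
  assumes C: "C \<in> sets M" "C \<subseteq> D'" and C': "C' \<in> sets M" "C' \<subseteq> D'" and le: "le_ae M C C'"
  shows "le_ae M (pair_set C) (pair_set C')"
proof (rule restr_le_ae[OF loc pair_set(1)[OF C] pair_set(1)[OF C']])
  fix F assume F: "F \<in> V"
  have "restr C G = restr C' (restr C G)" if G: "G \<in> V" for G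
  proof -
    obtain g where g: "g \<in> lpf" "G = cl g" using G by (rule LpE)
    have "AE x in M. indicator C x * g x = indicator (C' \<inter> C) x * g x"
      using le C C' by (simp add: le_ae_AE) (auto simp: indicator_def elim!: eventually_mono)
    then show ?thesis
      unfolding restr_restr[OF C'(1) C(1) G] using g C C' by (simp add: restr_class ae_class_eqI lpf_measurable)
  qed
  then have "restr (pair_set C) F = T (restr C' (restr C (T' F)))" using pair_set(3)[OF C F] F by simp
  also have "\<dots> = restr (pair_set C') (T (restr C (T' F)))" using F C by (intro pair_set_local[OF C']) simp
  also have "\<dots> = restr (pair_set C' \<inter> pair_set C) F"
    using pair_set[OF C] pair_set[OF C'] F by (simp add: restr_restr)
  finally show "restr (pair_set C) F = restr (pair_set C' \<inter> pair_set C) F" .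
qed

end

lemma eq_ae_restr:
  assumes "localizable M" "A \<in> sets M" "A' \<in> sets M" "\<And>F. F \<in> V \<Longrightarrow> restr A F = restr A' F"
  shows "eq_ae M A A'"
  unfolding eq_ae_def
proof
  show "le_ae M A A'"
    by (rule restr_le_ae[OF assms(1-3)]) (use assms in \<open>simp add: restr_restr[symmetric], simp add: restr_restr\<close>)
  show "le_ae M A' A"
    by (rule restr_le_ae[OF assms(1,3,2)]) (use assms in \<open>simp add: restr_restr[symmetric], simp add: restr_restr\<close>)
qed

lemma pair_set_inverse:
  assumes loc: "localizable M" and p2: "p \<noteq> 2" and pair: "isometric_pair T T' D D'"
    and C: "C \<in> sets M" "C \<subseteq> D'"
  shows "eq_ae M (pair_set T' T D' (pair_set T T' D C)) C"
proof -
  note pair' = isometric_pair_sym[OF pair]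
  note E = pair_set[OF loc p2 pair C]
  note E' = pair_set[OF loc p2 pair' E(1,2)]
  note s = pair_sets[OF pair]
  note V = pair_V[OF pair]
  show ?thesis
  proof (rule eq_ae_restr[OF loc E'(1) C(1)])
    fix F assume F: "F \<in> V"
    have "restr (pair_set T' T D' (pair_set T T' D C)) F = T' (T (restr C (T' (T F))))"
      using E'(3)[OF F] E(3)[of "T F"] F V by simp
    also have "\<dots> = restr D' (restr C (restr D' F))"
      using pair_comp(2)[OF pair] F C V s by simp
    also have "\<dots> = restr C F" using F C s by (simp add: restr_restr Int_absorb1 Int_absorb2)
    finally show "restr (pair_set T' T D' (pair_set T T' D C)) F = restr C F" .
  qed
qed

lemma pair_set_iso:
  assumes loc: "localizable M" and p2: "p \<noteq> 2" and pair: "isometric_pair T T' D D'"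
  shows "set_iso M D D' (pair_set T T' D) (pair_set T' T D')"
proof
  note pair' = isometric_pair_sym[OF pair]
  show "D \<in> sets M" "D' \<in> sets M" using pair_sets[OF pair] by auto
  show "pair_set T T' D A \<in> sets M \<and> pair_set T T' D A \<subseteq> D" if "A \<in> sets M" "A \<subseteq> D'" for A
    using pair_set[OF loc p2 pair that] by simp
  show "pair_set T' T D' A \<in> sets M \<and> pair_set T' T D' A \<subseteq> D'" if "A \<in> sets M" "A \<subseteq> D" for A
    using pair_set[OF loc p2 pair' that] by simp
  show "le_ae M (pair_set T T' D A) (pair_set T T' D A')"
    if "A \<in> sets M" "A \<subseteq> D'" "A' \<in> sets M" "A' \<subseteq> D'" "le_ae M A A'" for A A'
    by (rule pair_set_mono[OF loc p2 pair that])
  show "le_ae M (pair_set T' T D' A) (pair_set T' T D' A')"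
    if "A \<in> sets M" "A \<subseteq> D" "A' \<in> sets M" "A' \<subseteq> D" "le_ae M A A'" for A A'
    by (rule pair_set_mono[OF loc p2 pair' that])
  show "eq_ae M (pair_set T' T D' (pair_set T T' D A)) A" if "A \<in> sets M" "A \<subseteq> D'" for A
    by (rule pair_set_inverse[OF loc p2 pair that])
  show "eq_ae M (pair_set T T' D (pair_set T' T D' A)) A" if "A \<in> sets M" "A \<subseteq> D" for A
    by (rule pair_set_inverse[OF loc p2 pair' that])
qed

lemma indicator_lpf_cong:
  assumes "A \<in> sets M" "A' \<in> sets M" "AE x in M. x \<in> A \<longrightarrow> x \<in> A'" "(indicator A' :: 'a \<Rightarrow> 'k) \<in> lpf"
  shows "(indicator A :: 'a \<Rightarrow> 'k) \<in> lpf"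
  using assms(1,3) by (intro lpf_mono[OF assms(4)]) (auto simp: indicator_def elim!: eventually_mono)

text \<open>
  For \<open>p = \<infinity>\<close> the weight is \<open>T 1\<^sub>D\<^sub>'\<close>. In general \<open>1\<^sub>D\<^sub>'\<close> need not belong to \<open>L\<^sup>p\<close>, so that \<open>w\<close>
  is glued from the functions \<open>T 1\<^sub>A\<close> for those sets \<open>A\<close> with \<open>1\<^sub>A\<close> in \<open>L\<^sup>p\<close>.
\<close>

lemma pair_weight:
  assumes loc: "localizable M" and p2: "p \<noteq> 2" and pair: "isometric_pair T T' D D'"
  obtains w :: "'a \<Rightarrow> 'k" where "w \<in> borel_measurable M"
    "\<forall>A\<in>sets M. A \<subseteq> D' \<longrightarrow> (indicator A :: 'a \<Rightarrow> 'k) \<in> lpf \<longrightarrow>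
       T (cl (indicator A)) = cl (\<lambda>x. w x * indicator (pair_set T T' D A) x)"
proof -
  let ?\<Phi> = "pair_set T T' D" and ?\<Phi>' = "pair_set T' T D'"
  interpret iso: set_iso M D D' ?\<Phi> ?\<Phi>' by (rule pair_set_iso[OF loc p2 pair])
  define \<A> where "\<A> = {A \<in> sets M. A \<subseteq> D \<and> (indicator (?\<Phi>' A) :: 'a \<Rightarrow> 'k) \<in> lpf}"
  define \<phi> where "\<phi> A = (SOME f. f \<in> lpf \<and> T (cl (indicator (?\<Phi>' A))) = cl f)" for A
  have As: "A \<in> sets M" "A \<subseteq> D" "?\<Phi>' A \<in> sets M" "?\<Phi>' A \<subseteq> D'" "cl (indicator (?\<Phi>' A)) \<in> V" if "A \<in> \<A>" for A
    using that iso.\<Phi>'[of A] by (auto simp: \<A>_def)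
  have \<phi>: "\<phi> A \<in> lpf" "T (cl (indicator (?\<Phi>' A))) = cl (\<phi> A)" if A: "A \<in> \<A>" for A
  proof -
    have "T (cl (indicator (?\<Phi>' A))) \<in> V" using pair_V(1)[OF pair] As(5)[OF A] .
    then obtain f where "f \<in> lpf" "T (cl (indicator (?\<Phi>' A))) = cl f" by (rule LpE)
    then have "\<exists>f. f \<in> lpf \<and> T (cl (indicator (?\<Phi>' A))) = cl f" by blast
    from someI_ex[OF this] show "\<phi> A \<in> lpf" "T (cl (indicator (?\<Phi>' A))) = cl (\<phi> A)" by (auto simp: \<phi>_def)
  qed
  \<comment> \<open>Multiplication by the indicator function of the smaller set commutes with \<open>T\<close> up to \<open>\<Phi>\<close>.\<close>
  have loc_AE: "AE x in M. x \<in> A \<inter> A' \<longrightarrow> \<phi> A x = \<phi> (A \<inter> A') x" and sub: "A \<inter> A' \<in> \<A>"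
    if A: "A \<in> \<A>" and A': "A' \<in> \<A>" for A A'
  proof -
    have I: "A \<inter> A' \<in> sets M" "A \<inter> A' \<subseteq> D" using As[OF A] As[OF A'] by auto
    note \<Phi>I = iso.\<Phi>'[OF I]
    interpret i: set_iso M D' D ?\<Phi>' ?\<Phi> by (rule iso.inverse_iso)
    have le: "AE x in M. x \<in> ?\<Phi>' (A \<inter> A') \<longrightarrow> x \<in> ?\<Phi>' A"
      using As[OF A] I by (intro i.AE_mono) auto
    have "(indicator (?\<Phi>' (A \<inter> A')) :: 'a \<Rightarrow> 'k) \<in> lpf"
      using A by (intro indicator_lpf_cong[OF _ _ le]) (use \<Phi>I As[OF A] in \<open>auto simp: \<A>_def\<close>)
    with I show sub: "A \<inter> A' \<in> \<A>" by (simp add: \<A>_def)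
    have "cl (indicator (?\<Phi>' (A \<inter> A')) :: 'a \<Rightarrow> 'k) = restr (?\<Phi>' (A \<inter> A')) (cl (indicator (?\<Phi>' A)))"
    proof -
      have "AE x in M. (indicator (?\<Phi>' (A \<inter> A')) x :: 'k) = indicator (?\<Phi>' (A \<inter> A')) x * indicator (?\<Phi>' A) x"
        using le by eventually_elim (auto simp: indicator_def)
      then show ?thesis using \<Phi>I As[OF A] by (simp add: restr_class ae_class_eqI)
    qed
    then have "cl (\<phi> (A \<inter> A')) = restr (?\<Phi> (?\<Phi>' (A \<inter> A'))) (cl (\<phi> A))"
      using pair_set_local[OF loc p2 pair \<Phi>I[THEN conjunct1] \<Phi>I[THEN conjunct2] As(5)[OF A]] \<phi>[OF A] \<phi>[OF sub] by simp
    moreover have [measurable]: "?\<Phi> (?\<Phi>' (A \<inter> A')) \<in> sets M" "\<phi> A \<in> borel_measurable M" "\<phi> (A \<inter> A') \<in> borel_measurable M"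
      using iso.\<Phi>[of "?\<Phi>' (A \<inter> A')"] \<Phi>I \<phi>(1)[OF A] \<phi>(1)[OF sub] lpf_measurable by auto
    ultimately have "AE x in M. \<phi> (A \<inter> A') x = indicator (?\<Phi> (?\<Phi>' (A \<inter> A'))) x * \<phi> A x"
      by (simp add: restr_class ae_class_eq_iff)
    with iso.AE_inv[OF I] show "AE x in M. x \<in> A \<inter> A' \<longrightarrow> \<phi> A x = \<phi> (A \<inter> A') x"
      by eventually_elim auto
  qed
  have "\<exists>w\<in>borel_measurable M. \<forall>A\<in>\<A>. AE x in M. x \<in> A \<longrightarrow> w x = \<phi> A x"
  proof (rule glue[OF loc])
    show "\<A> \<subseteq> sets M" by (auto simp: \<A>_def)
    show "\<phi> A \<in> borel_measurable M" if "A \<in> \<A>" for A using \<phi>(1)[OF that] by (rule lpf_measurable)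
    fix A A' assume "A \<in> \<A>" "A' \<in> \<A>"
    from loc_AE[OF this] loc_AE[OF this(2,1)] show "AE x in M. x \<in> A \<inter> A' \<longrightarrow> \<phi> A x = \<phi> A' x"
      by eventually_elim (simp add: Int_commute)
  qed
  then obtain w where w: "w \<in> borel_measurable M" "\<forall>A\<in>\<A>. AE x in M. x \<in> A \<longrightarrow> w x = \<phi> A x" by blast
  show thesis
  proof (rule that[OF w(1)], intro ballI impI)
    fix A assume A: "A \<in> sets M" "A \<subseteq> D'" "(indicator A :: 'a \<Rightarrow> 'k) \<in> lpf"
    note \<Phi>A = iso.\<Phi>[OF A(1,2)]
    have \<Phi>'A: "?\<Phi>' (?\<Phi> A) \<in> sets M" using iso.\<Phi>'[of "?\<Phi> A"] \<Phi>A by simp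
    note e = iso.AE_inv'[OF A(1,2)]
    have ie: "cl (indicator (?\<Phi>' (?\<Phi> A)) :: 'a \<Rightarrow> 'k) = cl (indicator A)"
      by (rule ae_class_eqI) (use e in \<open>auto simp: indicator_def elim!: eventually_mono\<close>)
    have "(indicator (?\<Phi>' (?\<Phi> A)) :: 'a \<Rightarrow> 'k) \<in> lpf"
      by (rule indicator_lpf_cong[OF \<Phi>'A A(1) _ A(3)]) (use e in \<open>auto elim!: eventually_mono\<close>)
    then have m: "?\<Phi> A \<in> \<A>" using \<Phi>A by (simp add: \<A>_def)
    have v: "cl (indicator A :: 'a \<Rightarrow> 'k) \<in> V" using A by simp
    have TA: "T (cl (indicator A)) = cl (\<phi> (?\<Phi> A))" using \<phi>(2)[OF m] by (simp add: ie)
    have "(\<lambda>x. indicator A x * indicator A x) = (indicator A :: 'a \<Rightarrow> 'k)" by (auto simp: indicator_def)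
    then have "restr A (cl (indicator A)) = cl (indicator A :: 'a \<Rightarrow> 'k)"
      using A by (simp add: restr_class)
    then have "restr (?\<Phi> A) (T (cl (indicator A))) = T (cl (indicator A))"
      using pair_set_local[OF loc p2 pair A(1,2) v] by simp
    then have "AE x in M. indicator (?\<Phi> A) x * \<phi> (?\<Phi> A) x = \<phi> (?\<Phi> A) x"
    proof -
      have [measurable]: "\<phi> (?\<Phi> A) \<in> borel_measurable M" "?\<Phi> A \<in> sets M" using \<phi>(1)[OF m] \<Phi>A lpf_measurable by auto
      assume "restr (?\<Phi> A) (T (cl (indicator A))) = T (cl (indicator A))"
      then show ?thesis unfolding TA by (simp add: restr_class ae_class_eq_iff)
    qed
    with w(2)[rule_format, OF m] have "AE x in M. \<phi> (?\<Phi> A) x = w x * indicator (?\<Phi> A) x"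
      by eventually_elim (auto simp: indicator_def split: if_splits)
    then show "T (cl (indicator A)) = cl (\<lambda>x. w x * indicator (?\<Phi> A) x)"
      unfolding TA by (rule ae_class_eqI)
  qed
qed

lemma lp_norm_indicator:
  assumes "A \<in> sets M" 
  shows "p \<noteq> \<infinity> \<Longrightarrow> (indicator A :: 'a \<Rightarrow> 'k) \<in> lpf \<Longrightarrow> ennreal (lp_norm p M (indicator A :: 'a \<Rightarrow> 'k) powr enn2real p) = emeasure M A"
proof -
  assume "p \<noteq> \<infinity>" "(indicator A :: 'a \<Rightarrow> 'k) \<in> lpf"
  then have "ennreal (lp_norm p M (indicator A :: 'a \<Rightarrow> 'k) powr enn2real p)
    = (\<integral>\<^sup>+x. ennreal (norm (indicator A x :: 'k) powr enn2real p) \<partial>M)" by (rule lp_norm_powr)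
  also have "\<dots> = (\<integral>\<^sup>+x. indicator A x \<partial>M)"
    by (intro nn_integral_cong) (auto simp: indicator_def)
  also have "\<dots> = emeasure M A" using assms by (rule nn_integral_indicator)
  finally show "ennreal (lp_norm p M (indicator A :: 'a \<Rightarrow> 'k) powr enn2real p) = emeasure M A" .
qed

text \<open>
  For finite \<open>p\<close>, the integral of \<open>|w|\<^sup>p\<close> over a small set \<open>B\<close> is the \<open>p\<close>-th power of the norm
  of \<open>T 1\<^sub>A\<close> for \<open>A = \<Phi>' B\<close>, that is, the transported measure of \<open>B\<close>. For \<open>p = \<infinity>\<close>, the function
  \<open>w\<close> has essential supremum one on every non-null subset of \<open>D\<close>.
\<close>

lemma pair_weight_norm:
  assumes loc: "localizable M" and p2: "p \<noteq> 2" and pair: "isometric_pair T T' D D'"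
    and w [measurable]: "w \<in> borel_measurable M"
    and Tw: "\<forall>A\<in>sets M. A \<subseteq> D' \<longrightarrow> (indicator A :: 'a \<Rightarrow> 'k) \<in> lpf \<longrightarrow>
       T (cl (indicator A)) = cl (\<lambda>x. w x * indicator (pair_set T T' D A) x)"
  shows "AE x in M. x \<in> D \<longrightarrow> norm (w x) = set_iso.rho M D (pair_set T' T D') x powr enn2real (inverse p)"
proof -
  let ?\<Phi> = "pair_set T T' D" and ?\<Phi>' = "pair_set T' T D'"
  interpret iso: set_iso M D D' ?\<Phi> ?\<Phi>' by (rule pair_set_iso[OF loc p2 pair])
  have norm_eq: "(\<lambda>x. w x * indicator A x) \<in> lpf \<and> lp_norm p M (\<lambda>x. w x * indicator A x) = lp_norm p M (indicator (?\<Phi>' A) :: 'a \<Rightarrow> 'k)"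
    if A: "A \<in> sets M" "A \<subseteq> D" and l: "(indicator (?\<Phi>' A) :: 'a \<Rightarrow> 'k) \<in> lpf" for A
  proof -
    note \<Phi>'A = iso.\<Phi>'[OF A]
    note \<Phi>\<Phi>'A = iso.\<Phi>[OF \<Phi>'A[THEN conjunct1] \<Phi>'A[THEN conjunct2]]
    let ?f = "indicator (?\<Phi>' A) :: 'a \<Rightarrow> 'k"
    have v: "cl ?f \<in> V" using l \<Phi>'A by simp
    have "T (cl ?f) = cl (\<lambda>x. w x * indicator (?\<Phi> (?\<Phi>' A)) x)" using Tw l \<Phi>'A by blast
    also have "\<dots> = cl (\<lambda>x. w x * indicator A x)"
      by (rule ae_class_eqI) (use iso.AE_inv[OF A] in \<open>auto simp: indicator_def elim!: eventually_mono\<close>)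
    finally have TA: "T (cl ?f) = cl (\<lambda>x. w x * indicator A x)" .
    have m: "(\<lambda>x. w x * indicator A x) \<in> borel_measurable M" using A by measurable
    have "AE x in M. indicator D' x * ?f x = ?f x" by (rule AE_I2) (use \<Phi>'A in \<open>auto simp: indicator_def\<close>)
    then have "cl (\<lambda>x. indicator D' x * ?f x) = cl ?f" by (rule ae_class_eqI)
    then have "restr D' (cl ?f) = cl ?f" using \<Phi>'A[THEN conjunct1] iso.D' by (simp add: restr_class)
    then have "nrm (cl (\<lambda>x. w x * indicator A x)) = nrm (cl ?f)"
      using pair_norm[OF pair v] by (simp add: TA)
    moreover have "cl (\<lambda>x. w x * indicator A x) \<in> V" using pair_V(1)[OF pair v] by (simp add: TA)
    ultimately show ?thesis using m l \<Phi>'A by (simp add: nrm_class)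
  qed
  show ?thesis
  proof (cases "p = \<infinity>")
    case False
    define q where "q = enn2real p"
    have q: "1 \<le> q" using p_ge_1[OF False] by (simp add: q_def)
    have pq: "p = ennreal q" unfolding q_def using False by (simp add: less_top)
    have e: "enn2real (inverse p) = 1 / q" using q unfolding pq by (subst inverse_ennreal) (auto simp: inverse_eq_divide)
    have "AE x in M. x \<in> D \<longrightarrow> norm (w x) powr q = iso.rho x"
    proof (rule iso.rho_unique[OF loc])
      fix A assume "A \<in> iso.small"
      then have A: "A \<in> sets M" "A \<subseteq> D" "emeasure M (?\<Phi>' A) < \<infinity>" by (auto simp: iso.small_def)
      have \<Phi>'A: "?\<Phi>' A \<in> sets M" using iso.\<Phi>'[OF A(1,2)] by simp
      have l: "(indicator (?\<Phi>' A) :: 'a \<Rightarrow> 'k) \<in> lpf" by (rule indicator_lpf[OF \<Phi>'A A(3)])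
      note n = norm_eq[OF A(1,2) l]
      have "(\<integral>\<^sup>+x. ennreal (norm (w x) powr q) * indicator A x \<partial>M) = (\<integral>\<^sup>+x. ennreal (norm (w x * indicator A x) powr q) \<partial>M)"
        using q by (intro nn_integral_cong) (auto simp: indicator_def)
      also have "\<dots> = ennreal (lp_norm p M (\<lambda>x. w x * indicator A x) powr q)"
        using lp_norm_powr[OF False conjunct1[OF n]] by (simp only: q_def)
      also have "\<dots> = emeasure M (?\<Phi>' A)" using n lp_norm_indicator[OF \<Phi>'A False l] by (simp add: q_def)
      finally show "(\<integral>\<^sup>+x. ennreal (norm (w x) powr q) * indicator A x \<partial>M) = emeasure M (?\<Phi>' A)" .
    qed auto
    then show ?thesis
    proof eventually_elim
      case (elim x)
      show ?case
      proof
        assume "x \<in> D"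
        then have "iso.rho x powr (1 / q) = (norm (w x) powr q) powr (1 / q)" using elim by simp
        also have "\<dots> = norm (w x)" using q by (simp add: powr_powr)
        finally show "norm (w x) = iso.rho x powr enn2real (inverse p)" by (simp add: e)
      qed
    qed
  next
    case True
    have ind: "(indicator A :: 'a \<Rightarrow> 'k) \<in> lpf" if "A \<in> sets M" for A
      using that by (subst Linf_in_lpf_iff[OF True]) (auto intro!: exI[of _ 1] simp: indicator_def)
    have nle: "(AE x in M. x \<in> A \<longrightarrow> norm (w x) \<le> r) \<longleftrightarrow> lp_norm p M (indicator (?\<Phi>' A) :: 'a \<Rightarrow> 'k) \<le> r"
      if A: "A \<in> sets M" "A \<subseteq> D" and r: "0 \<le> r" for A r
    proof -
      have \<Phi>'A: "?\<Phi>' A \<in> sets M" using iso.\<Phi>'[OF A(1,2)] by simp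
      note n = norm_eq[OF A ind[OF \<Phi>'A]]
      have "(AE x in M. x \<in> A \<longrightarrow> norm (w x) \<le> r) \<longleftrightarrow> (AE x in M. norm (w x * indicator A x) \<le> r)"
        by (rule eventually_subst, rule AE_I2) (use r in \<open>auto simp: indicator_def\<close>)
      also have "\<dots> \<longleftrightarrow> lp_norm p M (\<lambda>x. w x * indicator A x) \<le> r"
        using Linf_norm_le_iff[OF True _ r, of "\<lambda>x. w x * indicator A x"] n by simp
      finally show ?thesis using n by simp
    qed
    have one: "lp_norm p M (indicator A :: 'a \<Rightarrow> 'k) \<le> r \<longleftrightarrow> (AE x in M. x \<in> A \<longrightarrow> 1 \<le> r)"
      if A: "A \<in> sets M" and r: "0 \<le> r" for A and r :: real
    proof -
      have "lp_norm p M (indicator A :: 'a \<Rightarrow> 'k) \<le> r \<longleftrightarrow> (AE x in M. norm (indicator A x :: 'k) \<le> r)"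
        by (rule Linf_norm_le_iff[OF True ind[OF A] r])
      also have "\<dots> \<longleftrightarrow> (AE x in M. x \<in> A \<longrightarrow> 1 \<le> r)"
        by (rule eventually_subst, rule AE_I2) (use r in \<open>auto simp: indicator_def\<close>)
      finally show ?thesis .
    qed
    have D'D: "?\<Phi>' D \<in> sets M" using iso.\<Phi>'[OF iso.D] by simp
    have le1: "AE x in M. x \<in> D \<longrightarrow> norm (w x) \<le> 1"
      by (subst nle) (use iso.D one[OF D'D, of 1] in auto)
    have ge1: "AE x in M. \<forall>n. \<not> (x \<in> D \<and> norm (w x) \<le> 1 - 1 / real (Suc n))"
      unfolding AE_all_countable
    proof
      fix n
      define r where "r = 1 - 1 / real (Suc n)"
      have r: "0 \<le> r" "r < 1" by (auto simp: r_def)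
      let ?A = "{x \<in> D. norm (w x) \<le> r}"
      have A: "?A \<in> sets M"
      proof -
        have "?A = D \<inter> {x \<in> space M. norm (w x) \<le> r}" using sets.sets_into_space[OF iso.D] by auto
        then show ?thesis using iso.D by simp
      qed
      interpret i: set_iso M D' D ?\<Phi>' ?\<Phi> by (rule iso.inverse_iso)
      have \<Phi>'A: "?\<Phi>' ?A \<in> sets M" using iso.\<Phi>'[OF A] by simp
      have "lp_norm p M (indicator (?\<Phi>' ?A) :: 'a \<Rightarrow> 'k) \<le> r"
        by (subst nle[symmetric]) (use A r in auto)
      then have "AE x in M. x \<notin> ?\<Phi>' ?A" using one[OF \<Phi>'A r(1)] r by (simp add: not_le)
      then have "AE x in M. x \<notin> ?A" using i.null_iff[OF A] by simp
      then show "AE x in M. \<not> (x \<in> D \<and> norm (w x) \<le> 1 - 1 / real (Suc n))" by (simp add: r_def)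
    qed
    show ?thesis
      using le1 ge1 iso.rho_pos[OF loc]
    proof eventually_elim
      case (elim x)
      show ?case
      proof
        assume x: "x \<in> D"
        have "\<not> norm (w x) < 1"
        proof
          assume "norm (w x) < 1"
          then have "0 < 1 - norm (w x)" by simp
          then obtain n where "1 / real (Suc n) < 1 - norm (w x)" by (rule nat_approx_posE)
          then have "norm (w x) \<le> 1 - 1 / real (Suc n)" by linarith
          then show False using elim(2) x by blast
        qed
        then have "norm (w x) = 1" using elim(1) x by simp
        then show "norm (w x) = iso.rho x powr enn2real (inverse p)" using elim(3) x by (simp add: True)
      qed
    qed
  qed
qed

text \<open>
  The polar decomposition of \<open>w\<close> provides the unimodular function \<open>\<omega>\<close>. The resulting spatial
  partial isometry agrees with \<open>T\<close> on indicator functions, and simple functions are dense.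
\<close>

theorem pair_SPIso:
  assumes loc: "localizable M" and p2: "p \<noteq> 2" and pair: "isometric_pair T T' D D'"
  shows "T \<in> SPIso p M"
proof -
  let ?\<Phi> = "pair_set T T' D" and ?\<Phi>' = "pair_set T' T D'"
  interpret iso: set_iso M D D' ?\<Phi> ?\<Phi>' by (rule pair_set_iso[OF loc p2 pair])
  obtain w :: "'a \<Rightarrow> 'k" where w [measurable]: "w \<in> borel_measurable M" and
    Tw: "\<forall>A\<in>sets M. A \<subseteq> D' \<longrightarrow> (indicator A :: 'a \<Rightarrow> 'k) \<in> lpf \<longrightarrow>
       T (cl (indicator A)) = cl (\<lambda>x. w x * indicator (?\<Phi> A) x)"
    by (rule pair_weight[OF loc p2 pair])
  have wn: "AE x in M. x \<in> D \<longrightarrow> norm (w x) = iso.rho x powr enn2real (inverse p)"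
    by (rule pair_weight_norm[OF loc p2 pair w Tw])
  \<comment> \<open>Off \<open>D\<close> the function \<open>w\<close> is arbitrary; the value \<open>1\<close> at its zeros keeps \<open>\<omega>\<close> unimodular.\<close>
  define \<omega> where "\<omega> x = (if w x = 0 then 1 else inverse (norm (w x)) *\<^sub>R w x)" for x
  have \<omega> [measurable]: "\<omega> \<in> borel_measurable M" unfolding \<omega>_def by measurable
  have \<omega>1: "norm (\<omega> x) = 1" for x by (simp add: \<omega>_def)
  have \<omega>w: "\<omega> x * of_real (norm (w x)) = w x" for x
    by (auto simp: \<omega>_def scaleR_conv_of_real mult.assoc[symmetric] mult.commute[of "w x"] simp flip: of_real_mult)
  define W where "W = spatial_weight p M D ?\<Phi>' \<omega>"
  have W: "W x = (if x \<in> D then \<omega> x * of_real (iso.rho x powr enn2real (inverse p)) else 0)" for x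
    by (simp add: W_def spatial_weight_def iso.rho_def)
  have [measurable]: "W \<in> borel_measurable M" unfolding W by measurable
  interpret spatial p M scalar D D' ?\<Phi> ?\<Phi>' W
  proof unfold_locales
    show "AE x in M. x \<in> D \<longrightarrow> norm (W x) = iso.rho x powr enn2real (inverse p)"
      by (rule AE_I2) (simp add: W norm_mult \<omega>1)
  qed (use loc W in auto)
  have Ww: "AE x in M. x \<in> D \<longrightarrow> W x = w x"
    using wn
  proof eventually_elim
    case (elim x)
    show ?case
    proof
      assume "x \<in> D"
      then show "W x = w x" using elim \<omega>w[of x] unfolding W by (simp only: simp_thms if_True)
    qed
  qed
  obtain S :: "('a \<Rightarrow> 'k) set \<Rightarrow> ('a \<Rightarrow> 'k) set" where S: "is_T\<^sub>\<Phi> M D' ?\<Phi> S" using iso.ex_is_T by blast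
  define T0 where "T0 = (\<lambda>F\<in>V. L0_mult M (cl W) (S F))"
  have T0: "T0 F = L0_mult M (cl W) (S F)" if "F \<in> V" for F using that by (simp add: T0_def)
  have T0_ext: "T0 \<in> extensional V" by (simp add: T0_def)
  obtain T0' where pair0: "isometric_pair T0 T0' D D'"
    by (rule spatial_pair[OF S T0_ext T0])
  have "T F = T0 F" if F: "F \<in> V" for F
  proof (rule op_eq_on_indicators[OF pair_vectors(1)[OF pair] pair_vectors(1)[OF pair0] _ F])
    fix A assume A: "A \<in> sets M" "(indicator A :: 'a \<Rightarrow> 'k) \<in> lpf"
    have I: "A \<inter> D' \<in> sets M" "A \<inter> D' \<subseteq> D'" using A iso.D' by auto
    have l: "(indicator (A \<inter> D') :: 'a \<Rightarrow> 'k) \<in> lpf"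
      by (rule indicator_lpf_cong[OF I(1) A(1) _ A(2)]) simp
    have v: "cl (indicator A :: 'a \<Rightarrow> 'k) \<in> V" using A by simp
    have "AE x in M. indicator D' x * indicator A x = (indicator (A \<inter> D') x :: 'k)"
      by (rule AE_I2) (auto simp: indicator_def)
    then have "cl (\<lambda>x. indicator D' x * indicator A x) = cl (indicator (A \<inter> D') :: 'a \<Rightarrow> 'k)" by (rule ae_class_eqI)
    then have r: "restr D' (cl (indicator A :: 'a \<Rightarrow> 'k)) = cl (indicator (A \<inter> D'))"
      using A iso.D' by (simp add: restr_class)
    have "T (cl (indicator A)) = T (cl (indicator (A \<inter> D')))"
      using pair_comp(5)[OF pair v] by (simp add: r)
    also have "\<dots> = cl (\<lambda>x. w x * indicator (?\<Phi> (A \<inter> D')) x)" using Tw I l by blast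
    also have "\<dots> = cl (\<lambda>x. W x * indicator (?\<Phi> (A \<inter> D')) x)"
    proof (rule ae_class_eqI)
      show "AE x in M. w x * indicator (?\<Phi> (A \<inter> D')) x = W x * indicator (?\<Phi> (A \<inter> D')) x"
        using Ww by eventually_elim (use iso.\<Phi>[OF I] in \<open>auto simp: indicator_def\<close>)
    qed
    also have "\<dots> = T0 (cl (indicator A))"
    proof -
      have "?\<Phi> (A \<inter> D') \<in> sets M" using iso.\<Phi>[OF I] by simp
      then show ?thesis using S A unfolding T0[OF v] by (simp add: is_T\<^sub>\<Phi>_def)
    qed
    finally show "T (cl (indicator A)) = T0 (cl (indicator A))" .
  qed
  then have TS: "\<forall>F\<in>V. T F = L0_mult M (cl (spatial_weight p M D ?\<Phi>' \<omega>)) (S F)"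
    using T0 by (simp add: W_def)
  have "T \<in> extensional V" using opD(2)[OF pair_vectors(1)[OF pair]] .
  moreover have "partial_set_automorphism M D D' ?\<Phi> ?\<Phi>'"
    by (simp add: partial_set_automorphism_iff_set_iso iso.set_iso_axioms)
  moreover have "\<omega> \<in> borel_measurable (restrict_space M D)" by (rule measurable_restrict_space1) simp
  ultimately show ?thesis unfolding SPIso_def using \<omega>1 S TS by blast
qed

theorem SPIso_pair:
  assumes loc: "localizable M" and T: "T \<in> SPIso p M"
  obtains T' D D' where "isometric_pair (T :: ('a \<Rightarrow> 'k) set \<Rightarrow> ('a \<Rightarrow> 'k) set) T' D D'"
proof -
  obtain D D' \<Phi> \<Phi>' \<omega> S where ps: "partial_set_automorphism M D D' \<Phi> \<Phi>'"
    and \<omega>: "\<omega> \<in> borel_measurable (restrict_space M D)" "\<forall>x\<in>D. norm (\<omega> x) = 1"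
    and S: "is_T\<^sub>\<Phi> M D' \<Phi> S" and Text: "T \<in> extensional V"
    and TF: "\<forall>F\<in>V. T F = L0_mult M (cl (spatial_weight p M D \<Phi>' \<omega>)) (S F)"
    using T unfolding SPIso_def by blast
  interpret iso: set_iso M D D' \<Phi> \<Phi>' using ps by (simp add: partial_set_automorphism_iff_set_iso)
  define W where "W = spatial_weight p M D \<Phi>' \<omega>"
  have W: "W x = (if x \<in> D then \<omega> x * of_real (iso.rho x powr enn2real (inverse p)) else 0)" for x
    by (simp add: W_def spatial_weight_def iso.rho_def)
  have "(\<lambda>x. indicator D x *\<^sub>R \<omega> x) \<in> borel_measurable M"
    using \<omega>(1) iso.D by (subst (asm) borel_measurable_restrict_space_iff) auto
  then have "(\<lambda>x. (indicator D x *\<^sub>R \<omega> x) * of_real (iso.rho x powr enn2real (inverse p))) \<in> borel_measurable M"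
    by measurable
  moreover have "W = (\<lambda>x. (indicator D x *\<^sub>R \<omega> x) * of_real (iso.rho x powr enn2real (inverse p)))"
    by (rule ext) (simp add: W indicator_def)
  ultimately have Wm: "W \<in> borel_measurable M" by simp
  interpret spatial p M scalar D D' \<Phi> \<Phi>' W
  proof unfold_locales
    show "AE x in M. x \<in> D \<longrightarrow> norm (W x) = iso.rho x powr enn2real (inverse p)"
      by (rule AE_I2) (simp add: W norm_mult \<omega>(2))
  qed (use loc W Wm in auto)
  obtain T' where "isometric_pair T T' D D'"
    by (rule spatial_pair[OF S Text]) (use TF in \<open>simp_all add: W_def\<close>)
  then show thesis by (rule that)
qed

end

section \<open>Partial isometries with prescribed range projections\<close>

context lp_scalar begin

lemma inverse_idempotent:
  assumes "generalized_inverse B T T'"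
  shows "amult B T T' \<in> vectors B" "F \<in> V \<Longrightarrow> amult B T T' (amult B T T' F) = amult B T T' F"
    "amult B T' T \<in> vectors B" "F \<in> V \<Longrightarrow> amult B T' T (amult B T' T F) = amult B T' T F"
proof -
  have v: "T \<in> vectors B" "T' \<in> vectors B" and g: "\<And>F. F \<in> V \<Longrightarrow> T (T' (T F)) = T F" "\<And>F. F \<in> V \<Longrightarrow> T' (T (T' F)) = T' F"
    using assms unfolding generalized_inverse_iff by blast+
  show "amult B T T' \<in> vectors B" "amult B T' T \<in> vectors B" using amult_vectors v by blast+
  show "F \<in> V \<Longrightarrow> amult B T T' (amult B T T' F) = amult B T T' F"
    "F \<in> V \<Longrightarrow> amult B T' T (amult B T' T F) = amult B T' T F"
    using opD(1)[OF v(1)] opD(1)[OF v(2)] g by simp_all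
qed

text \<open>
  The classes of partial isometries differ only in the condition imposed on the idempotents
  \<open>T T'\<close> and \<open>T' T\<close>. It remains to see that each condition means, for an idempotent, to be the
  restriction to a measurable set.
\<close>

lemma pair_iff_range_restr:
  "(\<exists>T' D D'. isometric_pair T T' D D') \<longleftrightarrow>
    contractive B T \<and> (\<exists>T'. contractive B T' \<and> generalized_inverse B T T' \<and>
      (\<exists>D\<in>sets M. \<forall>F\<in>V. amult B T T' F = restr D F) \<and> (\<exists>D'\<in>sets M. \<forall>F\<in>V. amult B T' T F = restr D' F))"
  unfolding isometric_pair_def generalized_inverse_iff contractive_iff by (simp only: amult_apply cong: ball_cong) blast

lemma mult_iff_pair:
  assumes loc: "localizable M" and T: "contractive B T"
  shows "(\<exists>T'. contractive B T' \<and> generalized_inverse B T T' \<and>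
      multiplication_operator p M (amult B T T') \<and> multiplication_operator p M (amult B T' T)) \<longleftrightarrow>
    (\<exists>T' D D'. isometric_pair T T' D D')"
proof -
  have "multiplication_operator p M P \<longleftrightarrow> (\<exists>D\<in>sets M. \<forall>F\<in>V. P F = restr D F)"
    if P: "P \<in> vectors B" "\<And>F. F \<in> V \<Longrightarrow> P (P F) = P F" for P
  proof
    assume "multiplication_operator p M P"
    from mult_idempotent_restr[OF loc this P(2)] obtain D where "D \<in> sets M" "\<forall>F\<in>V. P F = restr D F" .
    then show "\<exists>D\<in>sets M. \<forall>F\<in>V. P F = restr D F" by blast
  next
    assume "\<exists>D\<in>sets M. \<forall>F\<in>V. P F = restr D F"
    then show "multiplication_operator p M P" using restr_multiplication_operator[OF _ P(1)] by blast
  qed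
  then have "multiplication_operator p M (amult B T T') \<longleftrightarrow> (\<exists>D\<in>sets M. \<forall>F\<in>V. amult B T T' F = restr D F)"
    "multiplication_operator p M (amult B T' T) \<longleftrightarrow> (\<exists>D\<in>sets M. \<forall>F\<in>V. amult B T' T F = restr D F)"
    if "generalized_inverse B T T'" for T' using inverse_idempotent[OF that] by blast+
  then show ?thesis unfolding pair_iff_range_restr using T by blast
qed

lemma Lp_PIso_iff_pair:
  assumes loc: "localizable M" and p2: "p \<noteq> 2"
  shows "T \<in> Lp_PIso p (Lp_space p M) \<longleftrightarrow> (\<exists>T' D D'. isometric_pair T T' D D')"
proof -
  have "Lp_projection p (Lp_space p M) P \<longleftrightarrow> (\<exists>D\<in>sets M. \<forall>F\<in>V. P F = restr D F)"
    if P: "P \<in> vectors B" for P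
  proof
    assume "Lp_projection p (Lp_space p M) P"
    from Lp_projection_mult[OF p2 loc this] obtain D where "D \<in> sets M" "\<forall>F\<in>V. P F = restr D F" .
    then show "\<exists>D\<in>sets M. \<forall>F\<in>V. P F = restr D F" by blast
  next
    assume "\<exists>D\<in>sets M. \<forall>F\<in>V. P F = restr D F"
    then show "Lp_projection p (Lp_space p M) P" using restr_Lp_projection[OF _ P] by blast
  qed
  then have "Lp_projection p (Lp_space p M) (amult B T T') \<longleftrightarrow> (\<exists>D\<in>sets M. \<forall>F\<in>V. amult B T T' F = restr D F)"
    "Lp_projection p (Lp_space p M) (amult B T' T) \<longleftrightarrow> (\<exists>D\<in>sets M. \<forall>F\<in>V. amult B T' T F = restr D F)"
    if "generalized_inverse B T T'" for T' using inverse_idempotent[OF that] by blast+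
  then show ?thesis unfolding pair_iff_range_restr Lp_PIso_def by blast
qed

lemma SPIso_iff_pair:
  assumes "localizable M" "p \<noteq> 2"
  shows "T \<in> SPIso p M \<longleftrightarrow> (\<exists>T' D D'. isometric_pair T T' D D')"
proof
  assume "T \<in> SPIso p M"
  then show "\<exists>T' D D'. isometric_pair T T' D D'" by (rule SPIso_pair[OF assms(1)]) blast
qed (use pair_SPIso[OF assms] in blast)

section \<open>The operator norm\<close>

lemma vadd_vectors:
  assumes S: "S \<in> vectors B" and T: "T \<in> vectors B"
  shows "vadd B S T \<in> vectors B"
proof -
  obtain K where K: "0 < K" "\<forall>F\<in>V. nrm (S F) \<le> K * nrm F" by (rule op_bound[OF S])
  obtain L where L: "0 < L" "\<forall>F\<in>V. nrm (T F) \<le> L * nrm F" by (rule op_bound[OF T])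
  note v = opD(1)[OF S] opD(1)[OF T]
  show ?thesis
  proof (rule opI[where K = "4 * max K L"])
    fix F assume F: "F \<in> V"
    have "nrm (S F \<oplus> T F) \<le> 4 * max (nrm (S F)) (nrm (T F))" using v F by (intro nrm_add_le)
    also have "\<dots> \<le> 4 * (max K L * nrm F)"
    proof -
      have "K * nrm F \<le> max K L * nrm F" "L * nrm F \<le> max K L * nrm F"
        using F by (intro mult_right_mono; simp)+
      then show ?thesis using K(2)[rule_format, OF F] L(2)[rule_format, OF F] by simp
    qed
    finally show "nrm (vadd B S T F) \<le> 4 * max K L * nrm F" using F by simp
    show "vadd B S T (c \<cdot> F) = c \<cdot> vadd B S T F" for c
      using v[OF F] F by (simp add: opD(4)[OF S] opD(4)[OF T]) (erule LpE, erule LpE, simp add: distrib_left)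
    fix G assume G: "G \<in> V"
    show "vadd B S T (F \<oplus> G) = vadd B S T F \<oplus> vadd B S T G"
      using v[OF F] v[OF G] F G
      by (simp add: opD(3)[OF S] opD(3)[OF T]) (erule LpE, erule LpE, erule LpE, erule LpE, simp add: add_ac)
  qed (use v in auto)
qed

lemma vscale_vectors:
  assumes T: "T \<in> vectors B"
  shows "vscale B c T \<in> vectors B"
proof -
  obtain L where L: "0 < L" "\<forall>F\<in>V. nrm (T F) \<le> L * nrm F" by (rule op_bound[OF T])
  note v = opD(1)[OF T]
  show ?thesis
  proof (rule opI[where K = "norm c * L"])
    fix F assume F: "F \<in> V"
    show "nrm (vscale B c T F) \<le> norm c * L * nrm F"
      using F v L(2)[rule_format, OF F] by (simp add: nrm_scale mult.assoc mult_left_mono)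
    show "vscale B c T (d \<cdot> F) = d \<cdot> vscale B c T F" for d
      using v[OF F] F by (simp add: opD(4)[OF T]) (erule LpE, simp add: mult.left_commute)
    fix G assume G: "G \<in> V"
    show "vscale B c T (F \<oplus> G) = vscale B c T F \<oplus> vscale B c T G"
      using v[OF F] v[OF G] F G
      by (simp add: opD(3)[OF T]) (erule LpE, erule LpE, simp add: distrib_left)
  qed (use v in auto)
qed

lemma norm_ratio_le:
  assumes "F \<in> V" "x \<le> K * nrm F" "0 \<le> K"
  shows "x / nrm F \<le> K"
proof (cases "nrm F = 0")
  case False
  then have "0 < nrm F" using nrm_nonneg[OF assms(1)] by linarith
  then show ?thesis using assms by (simp add: divide_le_eq)
qed (use assms in simp)

lemma opnorm_bdd:
  assumes T: "T \<in> vectors B"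
  shows "bdd_above ((\<lambda>F. nrm (T F) / nrm F) ` V)"
proof -
  obtain K where K: "0 < K" "\<forall>F\<in>V. nrm (T F) \<le> K * nrm F" by (rule op_bound[OF T])
  show ?thesis
  proof (rule bdd_aboveI2)
    fix F assume F: "F \<in> V"
    then show "nrm (T F) / nrm F \<le> K"
      using K by (intro norm_ratio_le) auto
  qed
qed

lemma opnorm_apply:
  assumes T: "T \<in> vectors B" and F: "F \<in> V"
  shows "nrm (T F) \<le> vnorm B T * nrm F"
proof (cases "nrm F = 0")
  case True
  then show ?thesis using F by (simp add: nrm_eq_0_iff opD_zero[OF T])
next
  case False
  then have "0 < nrm F" using nrm_nonneg[OF F] by linarith
  moreover have "nrm (T F) / nrm F \<le> vnorm B T"
    unfolding bounded_ops_simps(1) by (rule cSUP_upper[OF F opnorm_bdd[OF T]])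
  ultimately show ?thesis by (simp add: divide_le_eq)
qed

lemma opnorm_le:
  assumes "\<And>F. F \<in> V \<Longrightarrow> nrm (T F) \<le> K * nrm F" "0 \<le> K"
  shows "vnorm B T \<le> K"
  unfolding bounded_ops_simps(1)
proof (rule cSUP_least)
  show "V \<noteq> {}" using V_closed(3) by blast
  fix F assume F: "F \<in> V"
  then show "nrm (T F) / nrm F \<le> K" using assms by (intro norm_ratio_le) auto
qed

lemma opnorm_nonneg:
  assumes T: "T \<in> vectors B"
  shows "0 \<le> vnorm B T"
proof -
  have "nrm (T nul) / nrm nul \<le> vnorm B T"
    unfolding bounded_ops_simps(1) by (rule cSUP_upper[OF V_closed(3) opnorm_bdd[OF T]])
  then show ?thesis by simp
qed

section \<open>Rotations about the kernel of an idempotent\<close>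

text \<open>
  \<open>1 + (c - 1) P\<close>. If \<open>P\<close> is idempotent, this is the identity on the kernel of \<open>P\<close> and
  multiplication by \<open>c\<close> on its range; for \<open>c = exp(it)\<close> it is \<open>exp(itP)\<close>.
\<close>

definition rotation :: "(('a \<Rightarrow> 'k) set \<Rightarrow> ('a \<Rightarrow> 'k) set) \<Rightarrow> 'k \<Rightarrow> ('a \<Rightarrow> 'k) set \<Rightarrow> ('a \<Rightarrow> 'k) set" where
  "rotation P c = (\<lambda>F\<in>V. F \<oplus> (c - 1) \<cdot> P F)"

lemma rotation_eq: "rotation P c = vadd B (\<lambda>F\<in>V. F) (vscale B (c - 1) P)"
  unfolding rotation_def by (simp, rule restrict_ext) simp

lemma id_vectors: "(\<lambda>F\<in>V. F) \<in> vectors B"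
  by (rule opI[where K = 1]) auto

lemma rotation_vectors: "P \<in> vectors B \<Longrightarrow> rotation P c \<in> vectors B"
  unfolding rotation_eq by (intro vadd_vectors id_vectors vscale_vectors)

lemma rotation_apply: "F \<in> V \<Longrightarrow> rotation P c F = F \<oplus> (c - 1) \<cdot> P F"
  by (simp add: rotation_def)

lemma rotation_mult:
  assumes P: "P \<in> vectors B" "\<forall>F\<in>V. P (P F) = P F" and F: "F \<in> V"
  shows "rotation P c (rotation P d F) = rotation P (c * d) F"
proof -
  have PF: "P F \<in> V" by (rule opD(1)[OF P(1) F])
  have "P (F \<oplus> (d - 1) \<cdot> P F) = P F \<oplus> (d - 1) \<cdot> P F"
    using F PF P(2)[rule_format, OF F] by (simp add: opD(3)[OF P(1)] opD(4)[OF P(1)])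
  then have "rotation P c (rotation P d F) = (F \<oplus> (d - 1) \<cdot> P F) \<oplus> (c - 1) \<cdot> (P F \<oplus> (d - 1) \<cdot> P F)"
    using F PF by (simp add: rotation_apply)
  also have "\<dots> = F \<oplus> (c * d - 1) \<cdot> P F"
    using F PF by - (erule LpE, erule LpE, simp add: algebra_simps)
  finally show ?thesis using F by (simp add: rotation_apply)
qed

lemma rotation_one: "P \<in> vectors B \<Longrightarrow> F \<in> V \<Longrightarrow> rotation P 1 F = F"
  by (simp add: rotation_apply opD(1))

text \<open>
  An invertible isometry and its inverse form an isometric pair with \<open>D\<close> and \<open>D'\<close> equal to the
  whole space. Therefore \<open>U 1\<^sub>C = 1\<^sub>E U\<close> for some \<open>E\<close>, where \<open>C\<close> is the support of \<open>f\<close>.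
\<close>

lemma isometry_disjoint:
  assumes loc: "localizable M" and p2: "p \<noteq> 2"
    and U: "contractive B U" and U': "contractive B U'"
    and inv: "\<And>F. F \<in> V \<Longrightarrow> U (U' F) = F" "\<And>F. F \<in> V \<Longrightarrow> U' (U F) = F"
    and FG: "F \<in> V" "G \<in> V" "disj F G"
  shows "disj (U F) (U G)"
proof -
  have Uv: "U \<in> vectors B" "U' \<in> vectors B" using U U' by (auto simp: contractive_iff)
  have pair: "isometric_pair U U' (space M) (space M)"
    unfolding isometric_pair_def using U U' inv opD(1)[OF Uv(1)] opD(1)[OF Uv(2)] by simp
  obtain f where f: "f \<in> lpf" "F = cl f" using FG(1) by (rule LpE)
  obtain g where g: "g \<in> lpf" "G = cl g" using FG(2) by (rule LpE)
  note [measurable] = lpf_measurable[OF f(1)] lpf_measurable[OF g(1)]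
  let ?C = "{x \<in> space M. f x \<noteq> 0}"
  have C: "?C \<in> sets M" "?C \<subseteq> space M" by auto
  let ?E = "pair_set U U' (space M) ?C"
  note E = pair_set[OF loc p2 pair C]
  have "AE x in M. f x = 0 \<or> g x = 0" using FG(3) by (simp add: f g disj_class)
  then have "AE x in M. indicator ?C x * g x = 0" by eventually_elim (auto simp: indicator_def)
  moreover have "AE x in M. indicator ?C x * f x = f x" by (rule AE_I2) (auto simp: indicator_def)
  ultimately have "cl (\<lambda>x. indicator ?C x * f x) = cl f" "cl (\<lambda>x. indicator ?C x * g x) = nul"
    by (simp_all only: ae_class_eqI)
  then have "restr ?C F = F" "restr ?C G = nul" using C by (simp_all add: f g restr_class)
  then have UF: "restr ?E (U F) = U F" and UG: "restr ?E (U G) = nul"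
    using pair_set_local[OF loc p2 pair C FG(1)] pair_set_local[OF loc p2 pair C FG(2)] opD_zero[OF Uv(1)] by simp_all
  obtain f' where f': "f' \<in> lpf" "U F = cl f'" using opD(1)[OF Uv(1) FG(1)] by (rule LpE)
  obtain g' where g': "g' \<in> lpf" "U G = cl g'" using opD(1)[OF Uv(1) FG(2)] by (rule LpE)
  note [measurable] = lpf_measurable[OF f'(1)] lpf_measurable[OF g'(1)] E(1)
  have "AE x in M. indicator ?E x * f' x = f' x" "AE x in M. indicator ?E x * g' x = 0"
    using UF UG by (simp_all add: f' g' restr_class ae_class_eq_iff)
  then have "AE x in M. f' x = 0 \<or> g' x = 0" by eventually_elim (auto simp: indicator_def split: if_splits)
  then show ?thesis by (simp add: f' g' disj_class)
qed

text \<open>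
  Suppose that \<open>f\<close> and \<open>g\<close> are both nonzero on a set of positive measure. On a non-null part \<open>A\<close>
  of it, \<open>f / g\<close> is close to a constant \<open>a\<close>, so that \<open>f - a g\<close> is small compared with \<open>f\<close>. As
  \<open>P\<close> is local, it maps \<open>1\<^sub>A (f - a g)\<close> to \<open>1\<^sub>A f\<close>, which contradicts the boundedness of \<open>P\<close>.
\<close>

lemma local_disjoint_ranges:
  assumes P: "P \<in> vectors B"
    and local: "\<And>E F. E \<in> sets M \<Longrightarrow> F \<in> V \<Longrightarrow> P (restr E F) = restr E (P F)"
    and FG: "F \<in> V" "P F = F" "G \<in> V" "P G = nul"
  shows "disj F G"
proof -
  obtain f where f: "f \<in> lpf" "F = cl f" using FG(1) by (rule LpE)
  obtain g where g: "g \<in> lpf" "G = cl g" using FG(3) by (rule LpE)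
  note [measurable] = lpf_measurable[OF f(1)] lpf_measurable[OF g(1)]
  obtain K where K: "0 < K" "\<forall>F\<in>V. nrm (P F) \<le> K * nrm F" by (rule op_bound[OF P])
  \<comment> \<open>any value with \<open>K * \<epsilon> < 1\<close> would do\<close>
  define \<epsilon> where "\<epsilon> = 1 / (2 * K)"
  have \<epsilon>: "0 < \<epsilon>" using K by (simp add: \<epsilon>_def)
  obtain Q :: "'k set" where Q: "countable Q" "\<And>X. open X \<Longrightarrow> X \<noteq> {} \<Longrightarrow> \<exists>d\<in>Q. d \<in> X"
    using countable_dense_exists by metis
  define A where "A a = {x \<in> space M. f x \<noteq> 0 \<and> norm (f x - a * g x) \<le> \<epsilon> * norm (f x)}" for a
  have A [measurable]: "A a \<in> sets M" for a unfolding A_def by measurable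
  have null: "A a \<in> null_sets M" for a
  proof -
    define H where "H = restr (A a) (F \<oplus> (- a) \<cdot> G)"
    have H: "H \<in> V" using FG A by (simp add: H_def)
    have AF: "restr (A a) F \<in> V" using FG A by simp
    have "P H = restr (A a) F"
      using FG A by (simp add: H_def local opD(3)[OF P] opD(4)[OF P])
    then have 1: "nrm (restr (A a) F) \<le> K * nrm H" using K H by metis
    have Hc: "H = cl (\<lambda>x. indicator (A a) x * (f x - a * g x))"
      using A by (simp add: H_def f g restr_class)
    have AFc: "restr (A a) F = cl (\<lambda>x. indicator (A a) x * f x)" using A by (simp add: f restr_class)
    have fl: "(\<lambda>x. indicator (A a) x * f x) \<in> lpf" by (rule lpf_indicator_mult[OF A f(1)])
    have "lp_norm p M (\<lambda>x. indicator (A a) x * (f x - a * g x)) \<le> lp_norm p M (\<lambda>x. of_real \<epsilon> * (indicator (A a) x * f x))"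
    proof (rule lp_norm_mono[OF lpf_scale[OF fl]])
      show "AE x in M. norm (indicator (A a) x * (f x - a * g x)) \<le> norm (of_real \<epsilon> * (indicator (A a) x * f x))"
        using \<epsilon> by (intro AE_I2) (auto simp: indicator_def A_def norm_mult)
    qed measurable
    also have "\<dots> = \<epsilon> * lp_norm p M (\<lambda>x. indicator (A a) x * f x)"
      using lp_norm_scale[OF fl, of "of_real \<epsilon>"] \<epsilon> by simp
    finally have "nrm H \<le> \<epsilon> * nrm (restr (A a) F)" unfolding Hc AFc by (simp add: nrm_class)
    then have "K * nrm H \<le> K * (\<epsilon> * nrm (restr (A a) F))" using K by (intro mult_left_mono) auto
    also have "\<dots> = nrm (restr (A a) F) / 2" using K by (simp add: \<epsilon>_def)
    finally have "nrm (restr (A a) F) = 0" using 1 nrm_nonneg[OF AF] by linarith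
    then have "AE x in M. indicator (A a) x * f x = 0"
      using nrm_eq_0_iff[OF AF] unfolding AFc by (simp add: ae_class_eq_iff)
    then have "AE x in M. x \<notin> A a" by eventually_elim (auto simp: A_def)
    then show ?thesis using A by (simp add: null_sets_AE)
  qed
  have "AE x in M. \<forall>a\<in>Q. x \<notin> A a" using null by (subst AE_ball_countable[OF Q(1)]) (auto intro: AE_not_in)
  then have "AE x in M. f x = 0 \<or> g x = 0"
  proof (rule AE_mp[OF _ AE_I2], intro impI)
    fix x assume x: "x \<in> space M" "\<forall>a\<in>Q. x \<notin> A a"
    show "f x = 0 \<or> g x = 0"
    proof (rule ccontr)
      assume "\<not> ?thesis"
      then have nz: "f x \<noteq> 0" "g x \<noteq> 0" by auto
      obtain a where a: "a \<in> Q" "a \<in> ball (f x / g x) (\<epsilon> * norm (f x / g x))"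
      proof -
        have "f x / g x \<in> ball (f x / g x) (\<epsilon> * norm (f x / g x))" using \<epsilon> nz by simp
        then show thesis using Q(2)[OF open_ball] that by blast
      qed
      have "f x - a * g x = (f x / g x - a) * g x" using nz by (simp add: algebra_simps)
      then have "norm (f x - a * g x) = norm (f x / g x - a) * norm (g x)" by (simp add: norm_mult)
      also have "\<dots> \<le> (\<epsilon> * norm (f x / g x)) * norm (g x)"
        using a(2) by (intro mult_right_mono) (auto simp: dist_norm)
      also have "\<dots> = \<epsilon> * norm (f x)" using nz by (simp add: norm_divide)
      finally have "x \<in> A a" using x nz by (simp add: A_def)
      then show False using x a by blast
    qed
  qed
  then show ?thesis by (simp add: f g disj_class)
qed

text \<open>
  Let \<open>f\<close> and \<open>g\<close> be disjoint. At a point with \<open>f \<noteq> 0\<close> and \<open>P g \<noteq> 0\<close>, one has \<open>g = 0\<close>, so that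
  the rotated functions \<open>g + (c - 1) P g\<close> and \<open>g + (d - 1) P g\<close> are nonzero; then
  \<open>f + (c - 1) P f\<close> and \<open>f + (d - 1) P f\<close> both vanish, which is impossible as \<open>c \<noteq> d\<close> and
  \<open>f \<noteq> 0\<close>. Hence \<open>f\<close> is disjoint from \<open>P g\<close>, that is, \<open>P\<close> does not enlarge supports.
\<close>

lemma rotations_local:
  assumes P: "P \<in> vectors B"
    and rot: "\<And>F G. F \<in> V \<Longrightarrow> G \<in> V \<Longrightarrow> disj F G \<Longrightarrow> disj (rotation P c F) (rotation P c G)"
      "\<And>F G. F \<in> V \<Longrightarrow> G \<in> V \<Longrightarrow> disj F G \<Longrightarrow> disj (rotation P d F) (rotation P d G)"
    and cd: "c \<noteq> 1" "d \<noteq> 1" "c \<noteq> d"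
    and E: "E \<in> sets M" and F: "F \<in> V"
  shows "P (restr E F) = restr E (P F)"
proof -
  have key: "disj X (P Y)" if XY: "X \<in> V" "Y \<in> V" "disj X Y" for X Y
  proof -
    obtain f where f: "f \<in> lpf" "X = cl f" using XY(1) by (rule LpE)
    obtain g where g: "g \<in> lpf" "Y = cl g" using XY(2) by (rule LpE)
    obtain f' where f': "f' \<in> lpf" "P X = cl f'" using opD(1)[OF P XY(1)] by (rule LpE)
    obtain g' where g': "g' \<in> lpf" "P Y = cl g'" using opD(1)[OF P XY(2)] by (rule LpE)
    note [measurable] = lpf_measurable[OF f(1)] lpf_measurable[OF g(1)] lpf_measurable[OF f'(1)] lpf_measurable[OF g'(1)]
    have r: "AE x in M. f x + (e - 1) * f' x = 0 \<or> g x + (e - 1) * g' x = 0"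
      if "disj (rotation P e X) (rotation P e Y)" for e
    proof -
      have "rotation P e X = cl (\<lambda>x. f x + (e - 1) * f' x)" "rotation P e Y = cl (\<lambda>x. g x + (e - 1) * g' x)"
        unfolding rotation_apply[OF XY(1)] rotation_apply[OF XY(2)] f'(2) g'(2) unfolding f(2) g(2) by simp_all
      then show ?thesis using that by (simp add: disj_class)
    qed
    have "AE x in M. f x = 0 \<or> g x = 0" using XY(3) by (simp add: f g disj_class)
    then have "AE x in M. f x = 0 \<or> g' x = 0"
      using r[OF rot(1)[OF XY]] r[OF rot(2)[OF XY]]
    proof eventually_elim
      case (elim x)
      show ?case
      proof (rule ccontr)
        assume "\<not> ?thesis"
        then have nz: "f x \<noteq> 0" "g' x \<noteq> 0" by auto
        then have "g x = 0" using elim(1) by blast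
        then have "f x + (c - 1) * f' x = 0" "f x + (d - 1) * f' x = 0" using elim(2,3) cd nz by auto
        moreover have "(c - d) * f' x = (f x + (c - 1) * f' x) - (f x + (d - 1) * f' x)"
          by (simp add: algebra_simps)
        ultimately have "(c - d) * f' x = 0" by simp
        then have "f' x = 0" using cd by simp
        with \<open>f x + (c - 1) * f' x = 0\<close> nz show False by simp
      qed
    qed
    then show ?thesis by (simp add: f g' disj_class)
  qed
  have off: "restr A (P (restr (space M - A) Y)) = nul" if A: "A \<in> sets M" and Y: "Y \<in> V" for A Y
  proof -
    let ?G = "restr (space M - A) Y"
    have G: "?G \<in> V" using A Y by simp
    obtain g where g: "g \<in> lpf" "Y = cl g" using Y by (rule LpE)
    obtain h where h: "h \<in> lpf" "P ?G = cl h" using opD(1)[OF P G] by (rule LpE)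
    note [measurable] = lpf_measurable[OF g(1)] lpf_measurable[OF h(1)] A
    have rh: "restr A (P ?G) = cl (\<lambda>x. indicator A x * h x)" using A by (simp add: h restr_class)
    have Ge: "?G = cl (\<lambda>x. indicator (space M - A) x * g x)" by (simp add: g restr_class)
    have "disj (restr A (P ?G)) ?G" unfolding rh unfolding Ge
      by (subst disj_class) (auto simp: indicator_def)
    then have "disj (restr A (P ?G)) (P ?G)" using A G opD(1)[OF P G] by (intro key) simp_all
    then have "AE x in M. indicator A x * h x = 0 \<or> h x = 0" unfolding rh unfolding h(2) by (simp add: disj_class)
    then have "AE x in M. indicator A x * h x = 0" by eventually_elim auto
    then show ?thesis unfolding rh by (rule ae_class_eqI)
  qed
  have E': "space M - E \<in> sets M" "space M - (space M - E) = E" using E sets.sets_into_space[OF E] by auto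
  have rF: "restr E F \<in> V" "restr (space M - E) F \<in> V" using E F by simp_all
  have FE: "F = restr E F \<oplus> restr (space M - E) F"
    using class_split[OF F rF(1)] restr_compl[OF E F] by simp
  have PF: "P (restr E F) \<in> V" "P (restr (space M - E) F) \<in> V" using opD(1)[OF P] rF by auto
  have "P F = P (restr E F) \<oplus> P (restr (space M - E) F)"
    using arg_cong[OF FE, of P] opD(3)[OF P rF] by simp
  then have "restr E (P F) = restr E (P (restr E F))"
    using PF E off[OF E F] by (simp add: restr_linear)
  also have "\<dots> = P (restr E F)"
  proof -
    have "restr (space M - E) (P (restr E F)) = nul" using off[OF E'(1) F] E'(2) by simp
    then show ?thesis using class_split[OF PF(1), of "restr E (P (restr E F))"] restr_compl[OF E PF(1)] PF E by simp
  qed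
  finally show ?thesis ..
qed

lemma rotation_restr_norm:
  assumes E: "E \<in> sets M" and c: "norm c = 1" and P: "\<And>F. F \<in> V \<Longrightarrow> P F = restr E F" and F: "F \<in> V"
  shows "nrm (rotation P c F) = nrm F"
proof -
  obtain f where f: "f \<in> lpf" "F = cl f" using F by (rule LpE)
  note [measurable] = lpf_measurable[OF f(1)] E
  have "rotation P c F = cl (\<lambda>x. f x + (c - 1) * (indicator E x * f x))"
    unfolding rotation_apply[OF F] P[OF F] unfolding f(2) by (simp add: restr_class)
  also have "nrm \<dots> = lp_norm p M (\<lambda>x. f x + (c - 1) * (indicator E x * f x))" by (subst nrm_class) simp_all
  also have "\<dots> = lp_norm p M f"
  proof (rule lp_norm_cong)
    show "AE x in M. norm (f x + (c - 1) * (indicator E x * f x)) = norm (f x)"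
      using c by (intro AE_I2) (auto simp: indicator_def left_diff_distrib norm_mult)
  qed simp_all
  finally show ?thesis by (simp add: f nrm_class)
qed

end

section \<open>Hermitian idempotents\<close>

locale lp_complex = lp_scalar p M "TYPE(complex)" for p :: ennreal and M :: "'a measure"
begin

definition exp_sum :: "complex \<Rightarrow> nat \<Rightarrow> complex" where
  "exp_sum z n = (\<Sum>k<n. inverse (fact k) * z ^ k)"

lemma exp_sum_tendsto: "exp_sum z \<longlonglongrightarrow> exp z"
  using exp_converges[of z] unfolding sums_def exp_sum_def by (simp add: scaleR_conv_of_real)

text \<open>
  All positive powers of \<open>P\<close> coincide, so that only the scalar coefficients accumulate. The
  formula starts with the first term \<open>P\<^sup>0 = 1\<close>; the empty partial sum is \<open>0\<close>, and not \<open>1 - P\<close>.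
\<close>

lemma exp_partial_sum_idempotent:
  assumes P: "P \<in> vectors B" "\<forall>F\<in>V. P (P F) = P F" and F: "F \<in> V"
  shows "exp_partial_sum B (vscale B z P) (Suc n) F = rotation P (exp_sum z (Suc n)) F"
proof -
  have PV: "P G \<in> V" if "G \<in> V" for G by (rule opD(1)[OF P(1) that])
  have pow: "apower B (vscale B z P) (Suc n) G = z ^ Suc n \<cdot> P G" if G: "G \<in> V" for n G
  proof (induction n)
    case 0
    then show ?case using G by simp
  next
    case (Suc n)
    have "apower B (vscale B z P) (Suc (Suc n)) G = vscale B z P (apower B (vscale B z P) (Suc n) G)"
      using G by (simp only: apower.simps(2)[of _ _ "Suc n"] amult_apply)
    also have "\<dots> = z \<cdot> P (z ^ Suc n \<cdot> P G)" using G PV unfolding Suc.IH by simp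
    also have "\<dots> = z \<cdot> z ^ Suc n \<cdot> P G" using PV[OF G] by (simp only: opD(4)[OF P(1)] P(2)[rule_format, OF G])
    also have "\<dots> = z ^ Suc (Suc n) \<cdot> P G" using PV[OF G] class_algebra2(3) by simp
    finally show ?case .
  qed
  show ?thesis
  proof (induction n)
    case 0
    then show ?case using F PV by (simp add: exp_sum_def rotation_apply)
  next
    case (Suc n)
    have "exp_partial_sum B (vscale B z P) (Suc (Suc n)) F
      = rotation P (exp_sum z (Suc n)) F \<oplus> inverse (fact (Suc n)) \<cdot> z ^ Suc n \<cdot> P F"
    proof -
      have "exp_partial_sum B a (Suc m) F = exp_partial_sum B a m F \<oplus> inverse (fact m) \<cdot> apower B a m F" for a m
        using F by simp
      then show ?thesis unfolding Suc.IH[symmetric] pow[OF F, symmetric] .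
    qed
    also have "\<dots> = rotation P (exp_sum z (Suc (Suc n))) F"
    proof -
      have e: "exp_sum z (Suc (Suc n)) = exp_sum z (Suc n) + inverse (fact (Suc n)) * z ^ Suc n"
        by (simp add: exp_sum_def)
      show ?thesis
        unfolding e rotation_apply[OF F] using F PV[OF F]
        by - (erule LpE, erule LpE, simp add: algebra_simps del: power_Suc fact_Suc)
    qed
    finally show ?case .
  qed
qed

lemma rotation_diff:
  assumes P: "P \<in> vectors B" and F: "F \<in> V"
  shows "rotation P c F \<ominus> rotation P d F = (c - d) \<cdot> P F"
  unfolding rotation_apply[OF F] using F opD(1)[OF P F]
  by - (erule LpE, erule LpE, simp add: algebra_simps)

lemma exp_partial_vectors:
  assumes P: "P \<in> vectors B"
  shows "exp_partial_sum B P n \<in> vectors B"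
proof -
  have a: "apower B P n \<in> vectors B" for n
  proof (induction n)
    case 0 show ?case unfolding apower.simps bounded_ops_simps(3) by (rule id_vectors)
  next
    case (Suc n) then show ?case using amult_vectors[OF P] by (simp del: bounded_ops_simps)
  qed
  show ?thesis
  proof (induction n)
    case 0
    have "(\<lambda>F\<in>V. nul) \<in> vectors B" by (rule opI[where K = 0]) auto
    then show ?case by (simp only: exp_partial_sum.simps bounded_ops_simps(4) Lp_space_simps(3))
  next
    case (Suc n)
    show ?case unfolding exp_partial_sum.simps by (intro vadd_vectors vscale_vectors Suc.IH a)
  qed
qed

lemma exp_sums_iff:
  assumes P: "P \<in> vectors B" "\<forall>F\<in>V. P (P F) = P F"
  shows "exp_sums B (vscale B z P) e \<longleftrightarrow> e = rotation P (exp z)"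
proof -
  let ?s = "\<lambda>n. exp_partial_sum B (vscale B z P) n"
  have sv: "?s n \<in> vectors B" for n by (intro exp_partial_vectors vscale_vectors P)
  have conv: "exp_sums B (vscale B z P) e" if e: "e = rotation P (exp z)" for e
  proof -
    have ev: "e \<in> vectors B" unfolding e by (rule rotation_vectors[OF P(1)])
    obtain K where K: "0 < K" "\<forall>F\<in>V. nrm (P F) \<le> K * nrm F" by (rule op_bound[OF P(1)])
    have bound: "vnorm B (vadd B (?s (Suc n)) (vscale B (-1) e)) \<le> norm (exp_sum z (Suc n) - exp z) * K" for n
    proof (rule opnorm_le)
      fix F assume F: "F \<in> V"
      have "vadd B (?s (Suc n)) (vscale B (-1) e) F = ?s (Suc n) F \<ominus> e F"
        using F by (simp del: exp_partial_sum.simps)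
      also have "?s (Suc n) F = rotation P (exp_sum z (Suc n)) F" by (rule exp_partial_sum_idempotent[OF P F])
      also have "\<dots> \<ominus> e F = (exp_sum z (Suc n) - exp z) \<cdot> P F"
        unfolding e by (rule rotation_diff[OF P(1) F])
      finally have "nrm (vadd B (?s (Suc n)) (vscale B (-1) e) F) = norm (exp_sum z (Suc n) - exp z) * nrm (P F)"
        using opD(1)[OF P(1) F] by (simp only: nrm_scale)
      also have "\<dots> \<le> norm (exp_sum z (Suc n) - exp z) * (K * nrm F)"
        using K F by (intro mult_left_mono) auto
      finally show "nrm (vadd B (?s (Suc n)) (vscale B (-1) e) F) \<le> norm (exp_sum z (Suc n) - exp z) * K * nrm F"
        by (simp only: mult.assoc)
    qed (use K in simp)
    have "(\<lambda>n. norm (exp_sum z (Suc n) - exp z) * K) \<longlonglongrightarrow> 0 * K"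
      using LIMSEQ_Suc[OF exp_sum_tendsto[of z]] by (intro tendsto_mult tendsto_const tendsto_norm_zero) (simp add: LIM_zero_iff)
    then have "(\<lambda>n. norm (exp_sum z (Suc n) - exp z) * K) \<longlonglongrightarrow> 0" by simp
    note lim0 = this
    have nn: "0 \<le> vnorm B (vadd B (?s (Suc n)) (vscale B (-1) e))" for n
      by (intro opnorm_nonneg vadd_vectors vscale_vectors sv ev)
    have "(\<lambda>n. vnorm B (vadd B (?s (Suc n)) (vscale B (-1) e))) \<longlonglongrightarrow> 0"
      by (rule tendsto_sandwich[OF _ _ tendsto_const lim0]; intro always_eventually allI; rule nn bound)
    then have "(\<lambda>n. vnorm B (vadd B (?s n) (vscale B (-1) e))) \<longlonglongrightarrow> 0" by (rule LIMSEQ_imp_Suc)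
    then show "exp_sums B (vscale B z P) e" unfolding exp_sums_def using ev by blast
  qed
  have "e = rotation P (exp z)" if e: "exp_sums B (vscale B z P) e"
  proof -
    define e0 where "e0 = rotation P (exp z)"
    have e0: "exp_sums B (vscale B z P) e0" unfolding e0_def by (rule conv[OF refl])
    have ev: "e \<in> vectors B" "e0 \<in> vectors B" using e e0 by (auto simp: exp_sums_def)
    have "e F = e0 F" if F: "F \<in> V" for F
    proof -
      have lim: "(\<lambda>n. nrm (?s n F \<ominus> e' F)) \<longlonglongrightarrow> 0" if e': "exp_sums B (vscale B z P) e'" for e'
      proof -
        have e'v: "e' \<in> vectors B" and l: "(\<lambda>n. vnorm B (vadd B (?s n) (vscale B (-1) e'))) \<longlonglongrightarrow> 0"
          using e' by (auto simp: exp_sums_def)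
        have b: "nrm (?s n F \<ominus> e' F) \<le> vnorm B (vadd B (?s n) (vscale B (-1) e')) * nrm F" for n
          using opnorm_apply[OF vadd_vectors[OF sv vscale_vectors[OF e'v]] F, of n "-1"] F by simp
        have n: "0 \<le> nrm (?s n F \<ominus> e' F)" for n
          using opD(1)[OF sv F] opD(1)[OF e'v F] by (intro nrm_nonneg) simp
        have "(\<lambda>n. vnorm B (vadd B (?s n) (vscale B (-1) e')) * nrm F) \<longlonglongrightarrow> 0 * nrm F"
          using l by (intro tendsto_mult tendsto_const)
        then have z: "(\<lambda>n. vnorm B (vadd B (?s n) (vscale B (-1) e')) * nrm F) \<longlonglongrightarrow> 0" by simp
        show ?thesis
          by (rule tendsto_sandwich[OF _ _ tendsto_const z]; intro always_eventually allI; rule n b)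
      qed
      have v: "e F \<in> V" "e0 F \<in> V" using opD(1)[OF ev(1) F] opD(1)[OF ev(2) F] .
      have le: "nrm (e F \<ominus> e0 F) \<le> 4 * max (nrm (?s n F \<ominus> e F)) (nrm (?s n F \<ominus> e0 F))" for n
      proof -
        have s: "?s n F \<in> V" by (rule opD(1)[OF sv F])
        have eq: "e F \<ominus> e0 F = (-1) \<cdot> (?s n F \<ominus> e F) \<oplus> (?s n F \<ominus> e0 F)"
          using v s by - (erule LpE, erule LpE, erule LpE, simp add: algebra_simps)
        have "nrm ((-1) \<cdot> (?s n F \<ominus> e F)) = nrm (?s n F \<ominus> e F)"
          using nrm_scale[of "?s n F \<ominus> e F" "-1"] v s by simp
        then show ?thesis unfolding eq
          using nrm_add_le[of "(-1) \<cdot> (?s n F \<ominus> e F)" "?s n F \<ominus> e0 F"] v s by simp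
      qed
      have "(\<lambda>n. 4 * max (nrm (?s n F \<ominus> e F)) (nrm (?s n F \<ominus> e0 F))) \<longlonglongrightarrow> 4 * max 0 0"
        by (intro tendsto_mult tendsto_const tendsto_max lim e e0)
      then have "nrm (e F \<ominus> e0 F) \<le> 4 * max 0 0"
        by (rule LIMSEQ_le_const) (use le in blast)
      moreover have d: "e F \<ominus> e0 F \<in> V" using v by simp
      ultimately have "nrm (e F \<ominus> e0 F) = 0" using nrm_nonneg[OF d] by simp
      then have "e F \<ominus> e0 F = nul" using nrm_eq_0_iff[OF d] by simp
      then show ?thesis using class_algebra(6)[OF v] class_algebra(2)[OF v(2)] by simp
    qed
    then have "e = e0" using opD(2)[OF ev(1)] opD(2)[OF ev(2)] by (rule op_eqI[rotated 2])
    then show "e = rotation P (exp z)" by (simp add: e0_def)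
  qed
  with conv show ?thesis by blast
qed

lemma hermitian_idempotent_iff:
  assumes P: "P \<in> vectors B" "\<forall>F\<in>V. P (P F) = P F"
  shows "hermitian B P \<longleftrightarrow> (\<forall>t::real. vnorm B (rotation P (exp (\<i> * of_real t))) = 1)"
  unfolding hermitian_def exp_sums_iff[OF P] using P(1) by blast

text \<open>
  \<open>exp(itP)\<close> at \<open>t = \<pi>\<close> and \<open>t = \<pi> / 2\<close> provides rotations by two different factors, \<open>-1\<close> and
  \<open>\<i>\<close>, as required for the locality of \<open>P\<close>; the exponentials at \<open>-t\<close> are their inverses.
\<close>

lemma hermitian_idempotent_restr:
  assumes loc: "localizable M" and p2: "p \<noteq> 2"
    and P: "P \<in> vectors B" "\<forall>F\<in>V. P (P F) = P F" and herm: "hermitian B P"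
  obtains E where "E \<in> sets M" "\<forall>F\<in>V. P F = restr E F"
proof -
  have con: "contractive B (rotation P (exp (\<i> * of_real t)))" for t :: real
    unfolding contractive_def using rotation_vectors[OF P(1)] herm hermitian_idempotent_iff[OF P] by simp
  have dis: "disj (rotation P (exp (\<i> * of_real t)) F) (rotation P (exp (\<i> * of_real t)) G)"
    if FG: "F \<in> V" "G \<in> V" "disj F G" for F G and t :: real
  proof (rule isometry_disjoint[OF loc p2 con con[of "- t"] _ _ FG])
    have "exp (\<i> * of_real t) * exp (\<i> * of_real (- t)) = 1" by (simp add: exp_minus)
    then show "rotation P (exp (\<i> * of_real t)) (rotation P (exp (\<i> * of_real (- t))) F) = F"
      "rotation P (exp (\<i> * of_real (- t))) (rotation P (exp (\<i> * of_real t)) F) = F" if "F \<in> V" for F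
      unfolding rotation_mult[OF P that] using rotation_one[OF P(1) that] by (simp_all only: mult.commute)
  qed
  have e: "exp (\<i> * of_real pi) = -1" "exp (\<i> * of_real (pi / 2)) = \<i>"
    by (simp_all only: cis_conv_exp[symmetric] cis_pi cis_pi_half)
  have local: "P (restr E F) = restr E (P F)" if "E \<in> sets M" "F \<in> V" for E F
  proof (rule rotations_local[OF P(1), where c = "-1" and d = \<i>])
    show "disj (rotation P (-1) X) (rotation P (-1) Y)" if "X \<in> V" "Y \<in> V" "disj X Y" for X Y
      using dis[OF that, of pi] unfolding e .
    show "disj (rotation P \<i> X) (rotation P \<i> Y)" if "X \<in> V" "Y \<in> V" "disj X Y" for X Y
      using dis[OF that, of "pi / 2"] unfolding e .
  qed (use that in \<open>simp_all add: complex_eq_iff\<close>)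
  show thesis
    by (rule disjoint_ranges_mult[OF loc P(1)]) (use P(2) local_disjoint_ranges[OF P(1) local] that in blast)+
qed

text \<open>
  The exponential is multiplication by a unimodular function. Its norm is one, and not zero,
  because \<open>L\<^sup>p\<close> contains a nonzero vector.
\<close>

lemma restr_hermitian:
  assumes loc: "localizable M" and ne: "emeasure M (space M) \<noteq> 0"
    and P: "P \<in> vectors B" and E: "E \<in> sets M" "\<And>F. F \<in> V \<Longrightarrow> P F = restr E F"
  shows "hermitian B P"
proof -
  have PP: "\<forall>F\<in>V. P (P F) = P F" using E by (simp add: restr_restr)
  have "space M \<notin> null_sets M" using ne by auto
  then obtain C where C: "C \<in> sets M" "C \<subseteq> space M" "C \<notin> null_sets M" "emeasure M C < \<infinity>"
    by (rule localizable_finite_subset[OF loc sets.top])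
  define F0 where "F0 = cl (indicator C :: 'a \<Rightarrow> complex)"
  have F0: "F0 \<in> V" using indicator_lpf[OF C(1,4)] C(1) by (simp add: F0_def)
  have "nrm F0 \<noteq> 0"
  proof
    assume "nrm F0 = 0"
    then have "AE x in M. (indicator C x :: complex) = 0"
      using nrm_eq_0_iff[OF F0] C(1) by (simp add: F0_def ae_class_eq_iff)
    then have "AE x in M. x \<notin> C" by eventually_elim (simp add: indicator_def split: if_splits)
    then show False using C by (simp add: null_sets_AE)
  qed
  have "vnorm B (rotation P (exp (\<i> * of_real t))) = 1" for t :: real
  proof -
    let ?U = "rotation P (exp (\<i> * of_real t))"
    have Uv: "?U \<in> vectors B" by (rule rotation_vectors[OF P])
    have n: "nrm (?U F) = nrm F" if "F \<in> V" for F
      by (rule rotation_restr_norm[OF E(1) _ E(2) that]) (simp_all add: norm_exp_i_times)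
    have "vnorm B ?U \<le> 1" by (rule opnorm_le) (simp_all add: n)
    moreover have "1 \<le> vnorm B ?U"
      using opnorm_apply[OF Uv F0] n[OF F0] \<open>nrm F0 \<noteq> 0\<close> nrm_nonneg[OF F0]
      by (metis less_eq_real_def mult_le_cancel_right1 not_less)
    ultimately show ?thesis by simp
  qed
  then show ?thesis using hermitian_idempotent_iff[OF P PP] by simp
qed

lemma MP_PIso_iff_pair:
  assumes loc: "localizable M" and p2: "p \<noteq> 2" and ne: "emeasure M (space M) \<noteq> 0"
  shows "T \<in> MP_PIso B \<longleftrightarrow> (\<exists>T' D D'. isometric_pair T T' D D')"
proof -
  have "hermitian B P \<longleftrightarrow> (\<exists>D\<in>sets M. \<forall>F\<in>V. P F = restr D F)"
    if P: "P \<in> vectors B" "\<forall>F\<in>V. P (P F) = P F" for P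
  proof
    assume "hermitian B P"
    from hermitian_idempotent_restr[OF loc p2 P this] obtain D where "D \<in> sets M" "\<forall>F\<in>V. P F = restr D F" .
    then show "\<exists>D\<in>sets M. \<forall>F\<in>V. P F = restr D F" by blast
  next
    assume "\<exists>D\<in>sets M. \<forall>F\<in>V. P F = restr D F"
    then show "hermitian B P" using restr_hermitian[OF loc ne P(1)] by blast
  qed
  then have "hermitian B (amult B T T') \<longleftrightarrow> (\<exists>D\<in>sets M. \<forall>F\<in>V. amult B T T' F = restr D F)"
    "hermitian B (amult B T' T) \<longleftrightarrow> (\<exists>D\<in>sets M. \<forall>F\<in>V. amult B T' T F = restr D F)"
    if "generalized_inverse B T T'" for T' using inverse_idempotent[OF that] by blast+
  then show ?thesis unfolding pair_iff_range_restr MP_PIso_def by blast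
qed

end

section \<open>Equality of the four classes\<close>

theorem theorem2p28:
  fixes p :: ennreal and M :: "'a measure"
  assumes "1 \<le> p" and "p \<noteq> 2" and "localizable M"
  shows
    "(\<forall>T :: ('a \<Rightarrow> real) set \<Rightarrow> ('a \<Rightarrow> real) set. contractive (B_Lp p M) T \<longrightarrow>
        (T \<in> SPIso p M \<longleftrightarrow>
          (\<exists>T'. contractive (B_Lp p M) T' \<and> generalized_inverse (B_Lp p M) T T' \<and>
             multiplication_operator p M (amult (B_Lp p M) T T') \<and>
             multiplication_operator p M (amult (B_Lp p M) T' T)))) \<and>
     (\<forall>T :: ('a \<Rightarrow> complex) set \<Rightarrow> ('a \<Rightarrow> complex) set. contractive (B_Lp p M) T \<longrightarrow>
        (T \<in> SPIso p M \<longleftrightarrow>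
          (\<exists>T'. contractive (B_Lp p M) T' \<and> generalized_inverse (B_Lp p M) T T' \<and>
             multiplication_operator p M (amult (B_Lp p M) T T') \<and>
             multiplication_operator p M (amult (B_Lp p M) T' T)))) \<and>
     (SPIso p M :: (('a \<Rightarrow> real) set \<Rightarrow> ('a \<Rightarrow> real) set) set) = Lp_PIso p (Lp_space p M) \<and>
     (SPIso p M :: (('a \<Rightarrow> complex) set \<Rightarrow> ('a \<Rightarrow> complex) set) set) = Lp_PIso p (Lp_space p M) \<and>
     (emeasure M (space M) \<noteq> 0 \<longrightarrow>
        (SPIso p M :: (('a \<Rightarrow> complex) set \<Rightarrow> ('a \<Rightarrow> complex) set) set) = MP_PIso (B_Lp p M))"
proof -
  interpret r: lp_scalar p M "TYPE(real)" by unfold_locales (rule assms)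
  interpret c: lp_complex p M by unfold_locales (rule assms)
  note loc = assms(3) and p2 = assms(2)
  show ?thesis
    using r.SPIso_iff_pair[OF loc p2] r.mult_iff_pair[OF loc] r.Lp_PIso_iff_pair[OF loc p2]
      c.SPIso_iff_pair[OF loc p2] c.mult_iff_pair[OF loc] c.Lp_PIso_iff_pair[OF loc p2]
      c.MP_PIso_iff_pair[OF loc p2]
    by (intro conjI allI impI set_eqI) (simp_all del: bounded_ops_simps)
qed

end
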